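(* Let $p_{\tau,h}\in\mathcal W^{r,s}_{\tau,h}$, $\boldsymbol q_{\tau,h}\in\boldsymbol{\mathcal V}^{r,s}_{\tau,h}$ and $\boldsymbol u_{\tau,h}\in\boldsymbol{\mathcal Z}^{r,s+1}_{\tau,h}$ denote the fully discrete (continuous in time) space-time finite element approximation of the Biot system, represented on $\overline I_n$ by $p_{\tau,h}|_{I_n}=\sum_{j=0}^rP^j_{n,h}\varphi_{n,j}$, $\boldsymbol q_{\tau,h}|_{I_n}=\sum_{j=0}^r\boldsymbol Q^j_{n,h}\varphi_{n,j}$, $\boldsymbol u_{\tau,h}|_{I_n}=\sum_{j=0}^r\boldsymbol U^j_{n,h}\varphi_{n,j}$. Let $p^k_{\tau,h}|_{I_n}=\sum_{j=0}^rP^{j,k}_{n,h}\varphi_{n,j}$, $\boldsymbol q^k_{\tau,h}|_{I_n}=\sum_{j=0}^r\boldsymbol Q^{j,k}_{n,h}\varphi_{n,j}$, $\boldsymbol u^k_{\tau,h}|_{I_n}=\sum_{j=0}^r\boldsymbol U^{j,k}_{n,h}\varphi_{n,j}$ be the iterates whose coefficient functions are given by the fixed-stress iterative scheme (cGP($r$)–MFEM($s$)cG($s+1$)) described in the context. Then, for any $L\ge b^2/(2\lambda)$, the sequence $\{S_p^{i,k}\}_k$, where $S_p^{i,k}=\sum_{j=0}^r\alpha_{ij}(P^{j,k}_{n,h}-P^j_{n,h})$, converges geometrically in $W_h$ for $i=1,\dots,r$. For $n=1,\dots,N$ this implies the convergence of $\{p^k_{\tau,h}(t_n),\boldsymbol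 q^k_{\tau,h}(t_n),\boldsymbol u^k_{\tau,h}(t_n)\}$ to $\{p_{\tau,h}(t_n),\boldsymbol q_{\tau,h}(t_n),\boldsymbol u_{\tau,h}(t_n)\}$ in $W_h\times\boldsymbol V_h\times\boldsymbol H_h$ for $k\to\infty$.
   Context: Setting. $\Omega\subset\mathbb R^d$, $d\in\{2,3\}$, is a bounded polyhedral Lipschitz domain, $I=(0,T]$; $M,b,\mu,\lambda$ are positive constants; $\boldsymbol K\in\boldsymbol L^\infty(\Omega)$ is symmetric and uniformly positive definite; $f$ is a given source whose nodal values in time $f(t_{n,i})\in L^2(\Omega)$ are used below. $\langle\cdot,\cdot\rangle$ is the $L^2(\Omega)$ inner product and $\boldsymbol\varepsilon(\boldsymbol u)=(\nabla\boldsymbol u+(\nabla\boldsymbol u)^\top)/2$. The Biot system is $-\nabla\cdot(2\mu\boldsymbol\varepsilon(\boldsymbol u)+\lambda(\nabla\cdot\boldsymbol u)\boldsymbol I-b\,p\,\boldsymbol I)=\rho_b\boldsymbol g$, $\partial_t(\frac1Mp+\nabla\cdot(b\boldsymbol u))+\nabla\cdot\boldsymbol q=f$, $\boldsymbol q=-\boldsymbol K\nabla p$ with zero initial values for $p,\boldsymbol u$ and homogeneous Dirichlet conditions for $p,\boldsymbol u$ (the body force term does not appear in the discrete equations below). Discrete spaces. $\mathcal T_h$ is a decomposition of $\overline\Omega$ into quadrilaterals ($d=2$) or hexahedra ($d=3$) $K$ with reference maps $T_K:\widehat K\to K$. For $s\ge0$: $W_h=W_h^s=\{w_h\in L^2(\Omega)\mid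 w_h|_K\circ T_K\in\mathbb Q_s\}$, $\boldsymbol V_h=\boldsymbol V_h^s\subset\boldsymbol H(\mathrm{div};\Omega)$ is the corresponding Raviart–Thomas ($d=2$) or Raviart–Thomas–Nédélec ($d=3$) space, so that $(W_h,\boldsymbol V_h)$ is an inf-sup stable pair, and $\boldsymbol H_h=\boldsymbol H_h^{s+1}=\{\boldsymbol z_h\in C(\overline\Omega)^d\mid\boldsymbol z_h|_K\circ T_K\in\mathbb Q_{s+1}^d,\ \boldsymbol z_h|_{\partial\Omega}=\boldsymbol 0\}$; $\mathbb Q_m$ denotes polynomials of degree at most $m$ in each variable. $0=t_0<\dots<t_N=T$, $I_n=(t_{n-1},t_n]$, $\tau_n=t_n-t_{n-1}$. For $r\ge1$, $\mathcal W^{r,s}_{\tau,h}$, $\boldsymbol{\mathcal V}^{r,s}_{\tau,h}$, $\boldsymbol{\mathcal Z}^{r,s+1}_{\tau,h}$ are the spaces of functions on $\overline I$, continuous in time with values in $L^2(\Omega)$, $\boldsymbol H(\mathrm{div};\Omega)$, $\boldsymbol H^1_0(\Omega)$, whose restriction to each $I_n$ is a polynomial in time of degree at most $r$ with values in $W_h$, $\boldsymbol V_h$, $\boldsymbol H_h$, respectively. Time basis. On $\overline I_n$, $t_{n,0}=t_{n-1}$ and $t_{n,1},\dots,t_{n,r}$ are the points of the $r$-point Gauss quadrature formula on $I_n$; $\varphi_{n,0},\dots,\varphi_{n,r}$ are the Lagrange basis polynomials of degree $r$ for $t_{n,0},\dots,t_{n,r}$. For $i=1,\dots,r$, $j=0,\dots,r$: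 $\alpha_{ij}=\int_{I_n}\varphi_{n,j}'\varphi_{n,i}\,dt$, and $\tau_n\beta_{ii}$ is the value of $\int_{I_n}\varphi_{n,i}\varphi_{n,i}\,dt$ computed with the $r$-point Gauss formula (i.e. the $i$-th Gauss weight on $I_n$); $\beta_{ii}>0$. Discrete coupled solution. $(p_{\tau,h},\boldsymbol q_{\tau,h},\boldsymbol u_{\tau,h})$ is the solution (assumed to exist uniquely) of the coupled discretized Biot system (time integrals evaluated by the Gauss formula): $p_{\tau,h}(0)=0$, $\boldsymbol u_{\tau,h}(0)=\boldsymbol 0$, $\boldsymbol q_{\tau,h}(0)$ a fixed discrete initial flux in $\boldsymbol V_h$, and for all $n=1,\dots,N$, $i=1,\dots,r$, $w_h\in W_h$, $\boldsymbol v_h\in\boldsymbol V_h$, $\boldsymbol z_h\in\boldsymbol H_h$ $$\tfrac1M\sum_{j=0}^r\alpha_{ij}\langle P^j_{n,h},w_h\rangle+\tau_n\beta_{ii}\langle\nabla\cdot\boldsymbol Q^i_{n,h},w_h\rangle=\tau_n\beta_{ii}\langle f(t_{n,i}),w_h\rangle-b\sum_{j=0}^r\alpha_{ij}\langle\nabla\cdot\boldsymbol U^j_{n,h},w_h\rangle,$$ $$\langle\boldsymbol K^{-1}\boldsymbol Q^i_{n,h},\boldsymbol v_h\rangle-\langle P^i_{n,h},\nabla\cdot\boldsymbol v_h\rangle=0,$$ $$2\mu\langle\boldsymbol\varepsilon(\boldsymbol U^i_{n,h}),\boldsymbol\varepsilon(\boldsymbol z_h)\rangle+\lambda\langle\nabla\cdot\boldsymbol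 U^i_{n,h},\nabla\cdot\boldsymbol z_h\rangle-b\langle P^i_{n,h},\nabla\cdot\boldsymbol z_h\rangle=0.$$ Iterative scheme (parameter $L>0$). On each $I_n$, successively for $n=1,\dots,N$, iterate over $k$ (to the limit before proceeding to $I_{n+1}$): given the $k$-th iterate, find $P^{i,k+1}_{n,h}\in W_h$, $\boldsymbol Q^{i,k+1}_{n,h}\in\boldsymbol V_h$, $\boldsymbol U^{i,k+1}_{n,h}\in\boldsymbol H_h$, $i=1,\dots,r$, such that for all $w_h,\boldsymbol v_h,\boldsymbol z_h$ and $i=1,\dots,r$ $$\tfrac1M\sum_{j=0}^r\alpha_{ij}\langle P^{j,k+1}_{n,h},w_h\rangle+L\sum_{j=0}^r\alpha_{ij}\langle P^{j,k+1}_{n,h}-P^{j,k}_{n,h},w_h\rangle+\tau_n\beta_{ii}\langle\nabla\cdot\boldsymbol Q^{i,k+1}_{n,h},w_h\rangle=\tau_n\beta_{ii}\langle f(t_{n,i}),w_h\rangle-b\sum_{j=0}^r\alpha_{ij}\langle\nabla\cdot\boldsymbol U^{j,k}_{n,h},w_h\rangle,$$ $$\langle\boldsymbol K^{-1}\boldsymbol Q^{i,k+1}_{n,h},\boldsymbol v_h\rangle-\langle P^{i,k+1}_{n,h},\nabla\cdot\boldsymbol v_h\rangle=0,$$ $$2\mu\langle\boldsymbol\varepsilon(\boldsymbol U^{i,k+1}_{n,h}),\boldsymbol\varepsilon(\boldsymbol z_h)\rangle+\lambda\langle\nabla\cdot\boldsymbol U^{i,k+1}_{n,h},\nabla\cdot\boldsymbol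 z_h\rangle-b\langle P^{i,k+1}_{n,h},\nabla\cdot\boldsymbol z_h\rangle=0.$$ The coefficients with index $0$ are fixed by continuity in time: for all $k$, $P^{0,k}_{n,h}=\lim_{l\to\infty}p^l_{\tau,h}|_{I_{n-1}}(t_{n-1})$ for $n>1$ and $P^{0,k}_{1,h}=0$, and analogously $\boldsymbol Q^{0,k}_{n,h}$, $\boldsymbol U^{0,k}_{n,h}$ are the limit values at $t_{n-1}$ from $I_{n-1}$ (for $n=1$: the same discrete initial flux and $\boldsymbol 0$). Consequently the errors with index $0$ vanish: $P^{0,k}_{n,h}=P^0_{n,h}$, $\boldsymbol Q^{0,k}_{n,h}=\boldsymbol Q^0_{n,h}$, $\boldsymbol U^{0,k}_{n,h}=\boldsymbol U^0_{n,h}$ for all $k$. Geometric convergence of a sequence $x_k\to x$ in a normed space means $\|x_k-x\|\le Cq^k$ for some $C\ge0$, $q\in(0,1)$. *)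

theory Defs
  imports "HOL-Analysis.Analysis"
begin

section \<open>Function spaces on a domain\<close>

text \<open>
  Elements of the Lebesgue and Sobolev spaces are represented by functions on the whole space;
  only their values on the domain matter, and they are identified when they agree almost
  everywhere there (predicate \<open>eq_ae\<close>).
\<close>

definition eq_ae :: "(real^'d::finite) set \<Rightarrow> (real^'d \<Rightarrow> 'b) \<Rightarrow> (real^'d \<Rightarrow> 'b) \<Rightarrow> bool" where
  "eq_ae \<Omega> f g \<longleftrightarrow> (AE x in lebesgue_on \<Omega>. f x = g x)"

definition L2 :: "(real^'d::finite) set \<Rightarrow> (real^'d \<Rightarrow> 'b::euclidean_space) set" where
  "L2 \<Omega> = {f \<in> borel_measurable (lebesgue_on \<Omega>).
            integrable (lebesgue_on \<Omega>) (\<lambda>x. (norm (f x))\<^sup>2)}"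

definition l2_inner ::
  "(real^'d::finite) set \<Rightarrow> (real^'d \<Rightarrow> 'b::euclidean_space) \<Rightarrow> (real^'d \<Rightarrow> 'b) \<Rightarrow> real" where
  "l2_inner \<Omega> f g = (\<integral>x. f x \<bullet> g x \<partial>(lebesgue_on \<Omega>))"

definition l2_norm :: "(real^'d::finite) set \<Rightarrow> (real^'d \<Rightarrow> 'b::euclidean_space) \<Rightarrow> real" where
  "l2_norm \<Omega> f = sqrt (l2_inner \<Omega> f f)"

definition partial :: "'d::finite \<Rightarrow> (real^'d \<Rightarrow> real) \<Rightarrow> real^'d \<Rightarrow> real" where
  "partial i f x = frechet_derivative f (at x) (axis i 1)"

text \<open>Coinductively: differentiable, with all partial derivatives again smooth.\<close>

coinductive smooth_fun :: "(real^'d::finite \<Rightarrow> real) \<Rightarrow> bool" where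
  "(\<forall>x. f differentiable (at x)) \<Longrightarrow> (\<forall>i. smooth_fun (partial i f)) \<Longrightarrow> smooth_fun f"

definition test_functions :: "(real^'d::finite) set \<Rightarrow> (real^'d \<Rightarrow> real) set" where
  "test_functions \<Omega> = {\<phi>. smooth_fun \<phi> \<and> compact (closure {x. \<phi> x \<noteq> 0}) \<and>
                          closure {x. \<phi> x \<noteq> 0} \<subseteq> \<Omega>}"

definition has_weak_div ::
  "(real^'d::finite) set \<Rightarrow> (real^'d \<Rightarrow> real^'d) \<Rightarrow> (real^'d \<Rightarrow> real) \<Rightarrow> bool" where
  "has_weak_div \<Omega> v g \<longleftrightarrow>
     (\<forall>\<phi>\<in>test_functions \<Omega>.
        (\<integral>x. (\<Sum>i\<in>UNIV. v x $ i * partial i \<phi> x) \<partial>(lebesgue_on \<Omega>))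
          = - (\<integral>x. g x * \<phi> x \<partial>(lebesgue_on \<Omega>)))"

definition has_weak_grad ::
  "(real^'d::finite) set \<Rightarrow> (real^'d \<Rightarrow> real^'d) \<Rightarrow> (real^'d \<Rightarrow> real^'d^'d) \<Rightarrow> bool" where
  "has_weak_grad \<Omega> u G \<longleftrightarrow>
     (\<forall>\<phi>\<in>test_functions \<Omega>. \<forall>i j.
        (\<integral>x. u x $ i * partial j \<phi> x \<partial>(lebesgue_on \<Omega>))
          = - (\<integral>x. G x $ i $ j * \<phi> x \<partial>(lebesgue_on \<Omega>)))"

definition Hdiv :: "(real^'d::finite) set \<Rightarrow> (real^'d \<Rightarrow> real^'d) set" where
  "Hdiv \<Omega> = {v \<in> L2 \<Omega>. \<exists>g\<in>L2 \<Omega>. has_weak_div \<Omega> v g}"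

text \<open>
  On an open set weak derivatives are unique up to null sets, so the choices below only fix
  representatives; they are meaningful for arguments in \<open>Hdiv\<close> and \<open>H1\<close>, respectively.
\<close>

definition wdiv :: "(real^'d::finite) set \<Rightarrow> (real^'d \<Rightarrow> real^'d) \<Rightarrow> real^'d \<Rightarrow> real" where
  "wdiv \<Omega> v = (SOME g. g \<in> L2 \<Omega> \<and> has_weak_div \<Omega> v g)"

definition hdiv_norm :: "(real^'d::finite) set \<Rightarrow> (real^'d \<Rightarrow> real^'d) \<Rightarrow> real" where
  "hdiv_norm \<Omega> v = sqrt ((l2_norm \<Omega> v)\<^sup>2 + (l2_norm \<Omega> (wdiv \<Omega> v))\<^sup>2)"

definition H1 :: "(real^'d::finite) set \<Rightarrow> (real^'d \<Rightarrow> real^'d) set" where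
  "H1 \<Omega> = {u \<in> L2 \<Omega>. \<exists>G\<in>L2 \<Omega>. has_weak_grad \<Omega> u G}"

definition wgrad :: "(real^'d::finite) set \<Rightarrow> (real^'d \<Rightarrow> real^'d) \<Rightarrow> real^'d \<Rightarrow> real^'d^'d" where
  "wgrad \<Omega> u = (SOME G. G \<in> L2 \<Omega> \<and> has_weak_grad \<Omega> u G)"

definition h1_norm :: "(real^'d::finite) set \<Rightarrow> (real^'d \<Rightarrow> real^'d) \<Rightarrow> real" where
  "h1_norm \<Omega> u = sqrt ((l2_norm \<Omega> u)\<^sup>2 + (l2_norm \<Omega> (wgrad \<Omega> u))\<^sup>2)"

definition H10 :: "(real^'d::finite) set \<Rightarrow> (real^'d \<Rightarrow> real^'d) set" where
  "H10 \<Omega> = {u \<in> H1 \<Omega>. \<exists>\<Phi> :: nat \<Rightarrow> real^'d \<Rightarrow> real^'d.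
               (\<forall>m i. (\<lambda>x. \<Phi> m x $ i) \<in> test_functions \<Omega>) \<and>
               (\<lambda>m. h1_norm \<Omega> (\<lambda>x. u x - \<Phi> m x)) \<longlonglongrightarrow> 0}"

definition strain :: "(real^'d::finite) set \<Rightarrow> (real^'d \<Rightarrow> real^'d) \<Rightarrow> real^'d \<Rightarrow> real^'d^'d" where
  "strain \<Omega> u x = (1/2) *\<^sub>R (wgrad \<Omega> u x + transpose (wgrad \<Omega> u x))"


section \<open>Domain and permeability\<close>

text \<open>
  Near each boundary point the domain is the region strictly above the graph of a Lipschitz
  function, where the vertical direction is a unit vector \<open>e\<close> and the function is evaluated at
  the projection onto the orthogonal complement of \<open>e\<close>.
\<close>

definition lipschitz_boundary :: "(real^'d::finite) set \<Rightarrow> bool" where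
  "lipschitz_boundary \<Omega> \<longleftrightarrow>
     (\<forall>x\<in>frontier \<Omega>. \<exists>e \<rho> C \<gamma>. norm e = 1 \<and> \<rho> > 0 \<and>
        C-lipschitz_on UNIV (\<gamma> :: real^'d \<Rightarrow> real) \<and>
        \<Omega> \<inter> ball x \<rho> = {y \<in> ball x \<rho>. \<gamma> (y - (y \<bullet> e) *\<^sub>R e) < y \<bullet> e})"

definition polyhedral_lipschitz_domain :: "(real^'d::finite) set \<Rightarrow> bool" where
  "polyhedral_lipschitz_domain \<Omega> \<longleftrightarrow>
     open \<Omega> \<and> connected \<Omega> \<and> \<Omega> \<noteq> {} \<and> bounded \<Omega> \<and> lipschitz_boundary \<Omega> \<and>
     (\<exists>F. finite F \<and> (\<forall>P\<in>F. polytope P) \<and> closure \<Omega> = \<Union>F)"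

definition permeability :: "(real^'d::finite) set \<Rightarrow> (real^'d \<Rightarrow> real^'d^'d) \<Rightarrow> bool" where
  "permeability \<Omega> Kp \<longleftrightarrow>
     Kp \<in> borel_measurable (lebesgue_on \<Omega>) \<and>
     (\<exists>C. AE x in lebesgue_on \<Omega>. norm (Kp x) \<le> C) \<and>
     (AE x in lebesgue_on \<Omega>. transpose (Kp x) = Kp x) \<and>
     (\<exists>\<kappa>>0. AE x in lebesgue_on \<Omega>. \<forall>\<xi>. \<kappa> * (\<xi> \<bullet> \<xi>) \<le> \<xi> \<bullet> (Kp x *v \<xi>))"


section \<open>Spatial finite element spaces\<close>

text \<open>Polynomials of degree at most \<open>m i\<close> in the variable \<open>i\<close>.\<close>

definition multi_poly :: "('d::finite \<Rightarrow> nat) \<Rightarrow> (real^'d \<Rightarrow> real) set" where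
  "multi_poly m = {q. \<exists>c :: ('d \<Rightarrow> nat) \<Rightarrow> real.
      q = (\<lambda>x. \<Sum>k\<in>{k. \<forall>i. k i \<le> m i}. c k * (\<Prod>i\<in>UNIV. (x $ i) ^ k i))}"

definition Qpoly :: "nat \<Rightarrow> (real^'d::finite \<Rightarrow> real) set" where
  "Qpoly m = multi_poly (\<lambda>i. m)"

definition ref_cell :: "(real^'d::finite) set" where
  "ref_cell = cbox 0 1"

definition jacobian :: "(real^'d::finite \<Rightarrow> real^'d) \<Rightarrow> real^'d \<Rightarrow> real^'d^'d" where
  "jacobian F x = matrix (frechet_derivative F (at x))"

text \<open>
  Quadrilaterals and hexahedra are the nondegenerate images of the unit cube under multilinear
  maps; \<open>TK K\<close> is the reference map of \<open>K\<close>, given as a polynomial on the whole space.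
\<close>

definition hex_mesh ::
  "(real^'d::finite) set \<Rightarrow> (real^'d) set set \<Rightarrow> ((real^'d) set \<Rightarrow> real^'d \<Rightarrow> real^'d) \<Rightarrow> bool" where
  "hex_mesh \<Omega> Th TK \<longleftrightarrow>
     finite Th \<and> \<Union>Th = closure \<Omega> \<and>
     (\<forall>K\<in>Th. \<forall>K'\<in>Th. K \<noteq> K' \<longrightarrow> interior K \<inter> interior K' = {}) \<and>
     (\<forall>K\<in>Th. (\<forall>i. (\<lambda>x. TK K x $ i) \<in> Qpoly 1) \<and>
              bij_betw (TK K) ref_cell K \<and>
              (\<forall>x\<in>ref_cell. det (jacobian (TK K) x) \<noteq> 0))"

text \<open>
  For the discontinuous spaces the elementwise condition is imposed on the open cells, since
  values on the mesh skeleton (a null set) carry no information.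
\<close>

definition pressure_space ::
  "(real^'d::finite) set \<Rightarrow> (real^'d) set set \<Rightarrow> ((real^'d) set \<Rightarrow> real^'d \<Rightarrow> real^'d) \<Rightarrow> nat
     \<Rightarrow> (real^'d \<Rightarrow> real) set" where
  "pressure_space \<Omega> Th TK s =
     {w \<in> L2 \<Omega>. \<forall>K\<in>Th. \<exists>q\<in>Qpoly s. \<forall>x\<in>interior ref_cell. w (TK K x) = q x}"

definition RT_ref :: "nat \<Rightarrow> (real^'d::finite \<Rightarrow> real^'d) set" where
  "RT_ref s = {v. \<forall>i. (\<lambda>x. v x $ i) \<in> multi_poly (\<lambda>j. if j = i then s + 1 else s)}"

text \<open>The reference fields are mapped to the cells by the contravariant Piola transform.\<close>

definition flux_space ::
  "(real^'d::finite) set \<Rightarrow> (real^'d) set set \<Rightarrow> ((real^'d) set \<Rightarrow> real^'d \<Rightarrow> real^'d) \<Rightarrow> nat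
     \<Rightarrow> (real^'d \<Rightarrow> real^'d) set" where
  "flux_space \<Omega> Th TK s =
     {v \<in> Hdiv \<Omega>. \<forall>K\<in>Th. \<exists>vr\<in>RT_ref s. \<forall>x\<in>interior ref_cell.
        v (TK K x) = (1 / det (jacobian (TK K) x)) *\<^sub>R (jacobian (TK K) x *v vr x)}"

text \<open>The argument \<open>m\<close> is the polynomial degree (\<open>s + 1\<close> in the scheme).\<close>

definition displacement_space ::
  "(real^'d::finite) set \<Rightarrow> (real^'d) set set \<Rightarrow> ((real^'d) set \<Rightarrow> real^'d \<Rightarrow> real^'d) \<Rightarrow> nat
     \<Rightarrow> (real^'d \<Rightarrow> real^'d) set" where
  "displacement_space \<Omega> Th TK m =
     {z. continuous_on (closure \<Omega>) z \<and>
         (\<forall>K\<in>Th. \<forall>i. \<exists>q\<in>Qpoly m. \<forall>x\<in>ref_cell. z (TK K x) $ i = q x) \<and>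
         (\<forall>x\<in>frontier \<Omega>. z x = 0)}"

definition inf_sup_stable ::
  "(real^'d::finite) set \<Rightarrow> (real^'d \<Rightarrow> real) set \<Rightarrow> (real^'d \<Rightarrow> real^'d) set \<Rightarrow> bool" where
  "inf_sup_stable \<Omega> Wh Vh \<longleftrightarrow>
     (\<exists>\<gamma>>0. \<forall>w\<in>Wh. \<gamma> * l2_norm \<Omega> w
        \<le> (SUP v\<in>{v\<in>Vh. hdiv_norm \<Omega> v \<noteq> 0}. l2_inner \<Omega> (wdiv \<Omega> v) w / hdiv_norm \<Omega> v))"


section \<open>Time discretization\<close>

text \<open>
  The interval \<open>I\<^sub>n\<close> is \<open>{tt (n - 1)<..tt n}\<close>; \<open>tg n 0 = tt (n - 1)\<close> and \<open>tg n i\<close>, \<open>gw n i\<close>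
  with \<open>1 \<le> i \<le> r\<close> are the nodes and weights of the Gauss formula on \<open>I\<^sub>n\<close>, that is, of
  the \<open>r\<close>-point quadrature formula that is exact for polynomials of degree at most \<open>2 r - 1\<close>.
\<close>

definition gauss_formula ::
  "nat \<Rightarrow> real \<Rightarrow> real \<Rightarrow> (nat \<Rightarrow> real) \<Rightarrow> (nat \<Rightarrow> real) \<Rightarrow> bool" where
  "gauss_formula r a b x w \<longleftrightarrow>
     strict_mono_on {1..r} x \<and> (\<forall>i\<in>{1..r}. x i \<in> {a..b}) \<and>
     (\<forall>p :: real poly. degree p \<le> 2 * r - 1 \<longrightarrow>
        integral {a..b} (poly p) = (\<Sum>i=1..r. w i * poly p (x i)))"

definition time_grid ::
  "real \<Rightarrow> nat \<Rightarrow> nat \<Rightarrow> (nat \<Rightarrow> real) \<Rightarrow> (nat \<Rightarrow> nat \<Rightarrow> real) \<Rightarrow> (nat \<Rightarrow> nat \<Rightarrow> real) \<Rightarrow> bool" where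
  "time_grid T r N tt tg gw \<longleftrightarrow>
     N \<ge> 1 \<and> tt 0 = 0 \<and> tt N = T \<and> strict_mono_on {0..N} tt \<and>
     (\<forall>n\<in>{1..N}. tg n 0 = tt (n - 1) \<and> gauss_formula r (tt (n - 1)) (tt n) (tg n) (gw n))"

definition lagrange :: "nat \<Rightarrow> (nat \<Rightarrow> nat \<Rightarrow> real) \<Rightarrow> nat \<Rightarrow> nat \<Rightarrow> real \<Rightarrow> real" where
  "lagrange r tg n j t = (\<Prod>m\<in>{0..r} - {j}. (t - tg n m) / (tg n j - tg n m))"

definition \<alpha>c ::
  "nat \<Rightarrow> (nat \<Rightarrow> real) \<Rightarrow> (nat \<Rightarrow> nat \<Rightarrow> real) \<Rightarrow> nat \<Rightarrow> nat \<Rightarrow> nat \<Rightarrow> real" where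
  "\<alpha>c r tt tg n i j =
     integral {tt (n - 1)..tt n} (\<lambda>t. deriv (lagrange r tg n j) t * lagrange r tg n i t)"

text \<open>The product \<open>\<tau>\<^sub>n \<beta>\<^sub>i\<^sub>i\<close>: the Gauss formula applied to the square of the \<open>i\<close>-th basis polynomial.\<close>

definition \<tau>\<beta> ::
  "nat \<Rightarrow> (nat \<Rightarrow> nat \<Rightarrow> real) \<Rightarrow> (nat \<Rightarrow> nat \<Rightarrow> real) \<Rightarrow> nat \<Rightarrow> nat \<Rightarrow> real" where
  "\<tau>\<beta> r tg gw n i =
     (\<Sum>m=1..r. gw n m * (lagrange r tg n i (tg n m) * lagrange r tg n i (tg n m)))"

definition time_expansion ::
  "nat \<Rightarrow> (nat \<Rightarrow> nat \<Rightarrow> real) \<Rightarrow> (nat \<Rightarrow> nat \<Rightarrow> real^'d::finite \<Rightarrow> 'b::euclidean_space)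
     \<Rightarrow> nat \<Rightarrow> real \<Rightarrow> real^'d \<Rightarrow> 'b" where
  "time_expansion r tg P n t x = (\<Sum>j=0..r. lagrange r tg n j t *\<^sub>R P n j x)"

text \<open>
  Functions on \<open>{0..tt N}\<close>, continuous with values in the space \<open>X\<close> normed by \<open>nrm\<close>, and
  polynomial in time of degree at most \<open>r\<close> with values in \<open>Xh\<close> on each \<open>I\<^sub>n\<close>.
\<close>

definition time_space ::
  "(real^'d::finite) set \<Rightarrow> (real^'d \<Rightarrow> 'b::euclidean_space) set \<Rightarrow> ((real^'d \<Rightarrow> 'b) \<Rightarrow> real)
     \<Rightarrow> (real^'d \<Rightarrow> 'b) set \<Rightarrow> nat \<Rightarrow> nat \<Rightarrow> (nat \<Rightarrow> real) \<Rightarrow> (real \<Rightarrow> real^'d \<Rightarrow> 'b) set" where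
  "time_space \<Omega> X nrm Xh r N tt =
     {w. (\<forall>t\<in>{0..tt N}. w t \<in> X) \<and>
         (\<forall>t0\<in>{0..tt N}. ((\<lambda>t. nrm (\<lambda>x. w t x - w t0 x)) \<longlongrightarrow> 0) (at t0 within {0..tt N})) \<and>
         (\<forall>n\<in>{1..N}. \<exists>c. (\<forall>j\<in>{0..r}. c j \<in> Xh) \<and>
            (\<forall>t\<in>{tt (n - 1)<..tt n}. eq_ae \<Omega> (w t) (\<lambda>x. \<Sum>j=0..r. t ^ j *\<^sub>R c j x)))}"


section \<open>Coupled system and fixed-stress iteration\<close>

definition flux_eq ::
  "(real^'d::finite) set \<Rightarrow> (real^'d \<Rightarrow> real^'d^'d) \<Rightarrow> (real^'d \<Rightarrow> real^'d) set
     \<Rightarrow> (real^'d \<Rightarrow> real) \<Rightarrow> (real^'d \<Rightarrow> real^'d) \<Rightarrow> bool" where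
  "flux_eq \<Omega> Kp Vh P Q \<longleftrightarrow>
     (\<forall>v\<in>Vh. l2_inner \<Omega> (\<lambda>x. matrix_inv (Kp x) *v Q x) v - l2_inner \<Omega> P (wdiv \<Omega> v) = 0)"

definition mechanics_eq ::
  "(real^'d::finite) set \<Rightarrow> real \<Rightarrow> real \<Rightarrow> real \<Rightarrow> (real^'d \<Rightarrow> real^'d) set
     \<Rightarrow> (real^'d \<Rightarrow> real) \<Rightarrow> (real^'d \<Rightarrow> real^'d) \<Rightarrow> bool" where
  "mechanics_eq \<Omega> b \<mu> lam Hh P U \<longleftrightarrow>
     (\<forall>z\<in>Hh. 2 * \<mu> * l2_inner \<Omega> (strain \<Omega> U) (strain \<Omega> z)
             + lam * l2_inner \<Omega> (wdiv \<Omega> U) (wdiv \<Omega> z)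
             - b * l2_inner \<Omega> P (wdiv \<Omega> z) = 0)"

text \<open>
  \<open>P n j\<close>, \<open>Q n j\<close>, \<open>U n j\<close> are the coefficient functions on \<open>I\<^sub>n\<close> of \<open>p\<close>, \<open>q\<close>, \<open>u\<close>;
  \<open>q0\<close> is the discrete initial flux.
\<close>

definition coupled_solution ::
  "(real^'d::finite) set \<Rightarrow> real \<Rightarrow> real \<Rightarrow> real \<Rightarrow> real \<Rightarrow> (real^'d \<Rightarrow> real^'d^'d)
     \<Rightarrow> (real \<Rightarrow> real^'d \<Rightarrow> real)
     \<Rightarrow> (real^'d \<Rightarrow> real) set \<Rightarrow> (real^'d \<Rightarrow> real^'d) set \<Rightarrow> (real^'d \<Rightarrow> real^'d) set
     \<Rightarrow> nat \<Rightarrow> nat \<Rightarrow> (nat \<Rightarrow> real) \<Rightarrow> (nat \<Rightarrow> nat \<Rightarrow> real) \<Rightarrow> (nat \<Rightarrow> nat \<Rightarrow> real)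
     \<Rightarrow> (real^'d \<Rightarrow> real^'d)
     \<Rightarrow> (real \<Rightarrow> real^'d \<Rightarrow> real) \<Rightarrow> (real \<Rightarrow> real^'d \<Rightarrow> real^'d) \<Rightarrow> (real \<Rightarrow> real^'d \<Rightarrow> real^'d)
     \<Rightarrow> (nat \<Rightarrow> nat \<Rightarrow> real^'d \<Rightarrow> real) \<Rightarrow> (nat \<Rightarrow> nat \<Rightarrow> real^'d \<Rightarrow> real^'d)
     \<Rightarrow> (nat \<Rightarrow> nat \<Rightarrow> real^'d \<Rightarrow> real^'d) \<Rightarrow> bool" where
  "coupled_solution \<Omega> M b \<mu> lam Kp f Wh Vh Hh r N tt tg gw q0 p q u P Q U \<longleftrightarrow>
     p \<in> time_space \<Omega> (L2 \<Omega>) (l2_norm \<Omega>) Wh r N tt \<and>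
     q \<in> time_space \<Omega> (Hdiv \<Omega>) (hdiv_norm \<Omega>) Vh r N tt \<and>
     u \<in> time_space \<Omega> (H10 \<Omega>) (h1_norm \<Omega>) Hh r N tt \<and>
     (\<forall>n\<in>{1..N}. \<forall>j\<in>{0..r}. P n j \<in> Wh \<and> Q n j \<in> Vh \<and> U n j \<in> Hh) \<and>
     (\<forall>n\<in>{1..N}. \<forall>t\<in>{tt (n - 1)..tt n}.
        eq_ae \<Omega> (p t) (time_expansion r tg P n t) \<and>
        eq_ae \<Omega> (q t) (time_expansion r tg Q n t) \<and>
        eq_ae \<Omega> (u t) (time_expansion r tg U n t)) \<and>
     eq_ae \<Omega> (p 0) (\<lambda>x. 0) \<and> eq_ae \<Omega> (q 0) q0 \<and> eq_ae \<Omega> (u 0) (\<lambda>x. 0) \<and>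
     (\<forall>n\<in>{1..N}. \<forall>i\<in>{1..r}.
        (\<forall>w\<in>Wh.
           1 / M * (\<Sum>j=0..r. \<alpha>c r tt tg n i j * l2_inner \<Omega> (P n j) w)
           + \<tau>\<beta> r tg gw n i * l2_inner \<Omega> (wdiv \<Omega> (Q n i)) w
           = \<tau>\<beta> r tg gw n i * l2_inner \<Omega> (f (tg n i)) w
             - b * (\<Sum>j=0..r. \<alpha>c r tt tg n i j * l2_inner \<Omega> (wdiv \<Omega> (U n j)) w)) \<and>
        flux_eq \<Omega> Kp Vh (P n i) (Q n i) \<and>
        mechanics_eq \<Omega> b \<mu> lam Hh (P n i) (U n i))"

text \<open>
  \<open>Pk k n j\<close>, \<open>Qk k n j\<close>, \<open>Uk k n j\<close> are the coefficient functions on \<open>I\<^sub>n\<close> of the \<open>k\<close>-th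
  iterates \<open>pk k\<close>, \<open>qk k\<close>, \<open>uk k\<close>; the starting values \<open>k = 0\<close> with \<open>j \<ge> 1\<close> are arbitrary.
  On the first interval the coefficients of index \<open>0\<close> are the initial values, on later ones they
  are the limits of the iterates at \<open>tt (n - 1)\<close>, the right end of the previous interval. The last clause
  says that they are equal to the limit whenever the limit exists; convergence of the
  iteration is not built into the definition.
\<close>

definition fixed_stress_iterates ::
  "(real^'d::finite) set \<Rightarrow> real \<Rightarrow> real \<Rightarrow> real \<Rightarrow> real \<Rightarrow> (real^'d \<Rightarrow> real^'d^'d)
     \<Rightarrow> (real \<Rightarrow> real^'d \<Rightarrow> real)
     \<Rightarrow> (real^'d \<Rightarrow> real) set \<Rightarrow> (real^'d \<Rightarrow> real^'d) set \<Rightarrow> (real^'d \<Rightarrow> real^'d) set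
     \<Rightarrow> nat \<Rightarrow> nat \<Rightarrow> (nat \<Rightarrow> real) \<Rightarrow> (nat \<Rightarrow> nat \<Rightarrow> real) \<Rightarrow> (nat \<Rightarrow> nat \<Rightarrow> real)
     \<Rightarrow> (real^'d \<Rightarrow> real^'d) \<Rightarrow> real
     \<Rightarrow> (nat \<Rightarrow> real \<Rightarrow> real^'d \<Rightarrow> real) \<Rightarrow> (nat \<Rightarrow> real \<Rightarrow> real^'d \<Rightarrow> real^'d)
     \<Rightarrow> (nat \<Rightarrow> real \<Rightarrow> real^'d \<Rightarrow> real^'d)
     \<Rightarrow> (nat \<Rightarrow> nat \<Rightarrow> nat \<Rightarrow> real^'d \<Rightarrow> real) \<Rightarrow> (nat \<Rightarrow> nat \<Rightarrow> nat \<Rightarrow> real^'d \<Rightarrow> real^'d)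
     \<Rightarrow> (nat \<Rightarrow> nat \<Rightarrow> nat \<Rightarrow> real^'d \<Rightarrow> real^'d) \<Rightarrow> bool" where
  "fixed_stress_iterates \<Omega> M b \<mu> lam Kp f Wh Vh Hh r N tt tg gw q0 L pk qk uk Pk Qk Uk \<longleftrightarrow>
     (\<forall>k. \<forall>n\<in>{1..N}. \<forall>j\<in>{0..r}. Pk k n j \<in> Wh \<and> Qk k n j \<in> Vh \<and> Uk k n j \<in> Hh) \<and>
     (\<forall>k. \<forall>n\<in>{1..N}. \<forall>t\<in>{tt (n - 1)<..tt n}.
        eq_ae \<Omega> (pk k t) (time_expansion r tg (Pk k) n t) \<and>
        eq_ae \<Omega> (qk k t) (time_expansion r tg (Qk k) n t) \<and>
        eq_ae \<Omega> (uk k t) (time_expansion r tg (Uk k) n t)) \<and>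
     (\<forall>k. \<forall>n\<in>{1..N}. \<forall>i\<in>{1..r}.
        (\<forall>w\<in>Wh.
           1 / M * (\<Sum>j=0..r. \<alpha>c r tt tg n i j * l2_inner \<Omega> (Pk (Suc k) n j) w)
           + L * (\<Sum>j=0..r. \<alpha>c r tt tg n i j
                              * l2_inner \<Omega> (\<lambda>x. Pk (Suc k) n j x - Pk k n j x) w)
           + \<tau>\<beta> r tg gw n i * l2_inner \<Omega> (wdiv \<Omega> (Qk (Suc k) n i)) w
           = \<tau>\<beta> r tg gw n i * l2_inner \<Omega> (f (tg n i)) w
             - b * (\<Sum>j=0..r. \<alpha>c r tt tg n i j * l2_inner \<Omega> (wdiv \<Omega> (Uk k n j)) w)) \<and>
        flux_eq \<Omega> Kp Vh (Pk (Suc k) n i) (Qk (Suc k) n i) \<and>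
        mechanics_eq \<Omega> b \<mu> lam Hh (Pk (Suc k) n i) (Uk (Suc k) n i)) \<and>
     (\<forall>k. eq_ae \<Omega> (Pk k 1 0) (\<lambda>x. 0) \<and> eq_ae \<Omega> (Qk k 1 0) q0 \<and> eq_ae \<Omega> (Uk k 1 0) (\<lambda>x. 0)) \<and>
     (\<forall>k. \<forall>n\<in>{2..N}.
        (\<forall>y\<in>Wh. (\<lambda>l. l2_norm \<Omega> (\<lambda>x. pk l (tt (n - 1)) x - y x)) \<longlonglongrightarrow> 0
           \<longrightarrow> eq_ae \<Omega> (Pk k n 0) y) \<and>
        (\<forall>y\<in>Vh. (\<lambda>l. hdiv_norm \<Omega> (\<lambda>x. qk l (tt (n - 1)) x - y x)) \<longlonglongrightarrow> 0
           \<longrightarrow> eq_ae \<Omega> (Qk k n 0) y) \<and>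
        (\<forall>y\<in>Hh. (\<lambda>l. h1_norm \<Omega> (\<lambda>x. uk l (tt (n - 1)) x - y x)) \<longlonglongrightarrow> 0
           \<longrightarrow> eq_ae \<Omega> (Uk k n 0) y))"

definition converges_geometrically ::
  "((real^'d::finite \<Rightarrow> 'b::euclidean_space) \<Rightarrow> real)
     \<Rightarrow> (nat \<Rightarrow> real^'d \<Rightarrow> 'b) \<Rightarrow> (real^'d \<Rightarrow> 'b) \<Rightarrow> bool" where
  "converges_geometrically nrm X y \<longleftrightarrow>
     (\<exists>C\<ge>0. \<exists>\<rho>. 0 < \<rho> \<and> \<rho> < 1 \<and> (\<forall>k. nrm (\<lambda>x. X k x - y x) \<le> C * \<rho> ^ k))"

end

theory Submission
  imports Defs
begin

text \<open>
  The error of the \<open>i\<close>-th balance equation, divided by the Gauss weight \<open>w\<^sub>i\<close>, is tested with the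
  new \<open>S\<^sub>p\<^sup>i\<close> and summed over \<open>i\<close>. Since the errors of index \<open>0\<close> vanish and
  \<open>\<alpha>\<^sub>i\<^sub>j + \<alpha>\<^sub>j\<^sub>i = \<phi>\<^sub>i(t\<^sub>n) \<phi>\<^sub>j(t\<^sub>n)\<close> for \<open>i, j \<ge> 1\<close>, the flux terms add up to half the squared
  \<open>K\<^sup>-\<^sup>1\<close>-norm of the flux error at \<open>t\<^sub>n\<close> and can be dropped. The right-hand side is
  \<open>L S\<^sub>p - b (div S\<^sub>u)\<close> at the old iterate; the mechanics equation gives
  \<open>lam \<parallel>div S\<^sub>u\<parallel>\<^sup>2 \<le> b (S\<^sub>p, div S\<^sub>u)\<close>, so its norm is at most \<open>L \<parallel>S\<^sub>p\<parallel>\<close> when \<open>b\<^sup>2 \<le> 2 lam L\<close>.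
  Hence the sum of the \<open>\<parallel>S\<^sub>p\<^sup>i\<parallel>\<^sup>2 / w\<^sub>i\<close> contracts by the factor \<open>(L/2) / (1/M + L/2)\<close> from the second
  iterate on; the starting iterate need not satisfy the mechanics equation.

  Convergence at \<open>t\<^sub>n\<close> follows from the invertibility of \<open>(\<alpha>\<^sub>i\<^sub>j)\<close> together with stability of the
  flux equation (inverse inequality on the finite-dimensional flux space) and of the mechanics
  equation (Korn and Poincare inequalities), and \<open>n\<close> is increased by induction.
\<close>

section \<open>Square-integrable functions\<close>

text \<open>The energy argument needs weak derivatives to be linear, while \<open>wdiv\<close> and
  \<open>wgrad\<close> are arbitrary choices of representatives. Linearity almost everywhere follows
  from uniqueness, and uniqueness from the fundamental lemma of the calculus of variations, which
  needs enough smooth functions of compact support; they are built from exp(-1/t). A finite element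
  displacement is only piecewise a polynomial, and that in reference coordinates. Its extension by
  zero, however, is globally Lipschitz and differentiable off the mesh skeleton. This suffices for
  integration by parts and, through difference quotients, for Korn's inequality; neither traces nor
  second derivatives enter. The division by the weight lets the flux terms carry the bare
  coefficients \<alpha>_ij, whose symmetric part is a product l_i l_j and hence positive
  semidefinite. The contraction is one of squares, so the norms decay with the square root of its
  factor. The constant of flux stability depends on the mesh, which is harmless since only k
  varies.\<close>

lemma measurable_AE_eq:
  fixes f g :: "real^'d::finite \<Rightarrow> 'b::euclidean_space"
  assumes \<Omega>: "\<Omega> \<in> sets lebesgue" and f: "f \<in> borel_measurable (lebesgue_on \<Omega>)" and ae: "eq_ae \<Omega> f g"
  shows "g \<in> borel_measurable (lebesgue_on \<Omega>)"
proof -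
  have f': "(\<lambda>x. indicat_real \<Omega> x *\<^sub>R f x) \<in> borel_measurable lebesgue"
    using f \<Omega> by (subst (asm) borel_measurable_restrict_space_iff) auto
  have "AE x in lebesgue. x \<in> \<Omega> \<longrightarrow> f x = g x"
    using ae \<Omega> by (simp add: eq_ae_def AE_restrict_space_iff)
  then have "AE x in lebesgue. indicat_real \<Omega> x *\<^sub>R f x = indicat_real \<Omega> x *\<^sub>R g x"
    by eventually_elim (auto simp: indicator_def)
  \<comment> \<open>Completeness of Lebesgue measure allows an arbitrary change on a null set; the
    indicator carries the question from the restricted measure to the whole space.\<close>
  from borel_measurable_AE[OF f' this] show ?thesis
    using \<Omega> by (subst borel_measurable_restrict_space_iff) auto
qed

lemma eq_ae_refl [simp]: "eq_ae \<Omega> f f" by (simp add: eq_ae_def)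

lemma eq_ae_sym: "eq_ae \<Omega> f g \<Longrightarrow> eq_ae \<Omega> g f"
  unfolding eq_ae_def by (erule eventually_mono) simp

lemma eq_ae_trans: "eq_ae \<Omega> f g \<Longrightarrow> eq_ae \<Omega> g h \<Longrightarrow> eq_ae \<Omega> f h"
  unfolding eq_ae_def by (erule (1) eventually_elim2) simp

lemma eq_ae_diff: "eq_ae \<Omega> f f' \<Longrightarrow> eq_ae \<Omega> g g' \<Longrightarrow> eq_ae \<Omega> (\<lambda>x. f x - g x) (\<lambda>x. f' x - g' x)"
  unfolding eq_ae_def by (erule (1) eventually_elim2) simp

text \<open>By completeness the two functions are measurable together, and otherwise both integrals
  have the default value. So inner products and norms depend only on the class modulo null sets,
  even for arbitrary functions.\<close>

lemma integral_AE_cong: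
  fixes f g :: "real^'d::finite \<Rightarrow> 'b::euclidean_space"
  assumes \<Omega>: "\<Omega> \<in> sets lebesgue" and ae: "eq_ae \<Omega> f g"
  shows "(\<integral>x. f x \<partial>(lebesgue_on \<Omega>)) = (\<integral>x. g x \<partial>(lebesgue_on \<Omega>))"
proof (cases "f \<in> borel_measurable (lebesgue_on \<Omega>)")
  case True
  then show ?thesis using measurable_AE_eq[OF \<Omega> True ae] ae
    by (intro integral_cong_AE) (auto simp: eq_ae_def)
next
  case False
  then have "g \<notin> borel_measurable (lebesgue_on \<Omega>)" using measurable_AE_eq[OF \<Omega> _ eq_ae_sym[OF ae]] by auto
  then show ?thesis using False by (metis borel_measurable_integrable not_integrable_integral_eq)
qed

lemma l2_inner_cong:
  assumes "\<Omega> \<in> sets lebesgue" "eq_ae \<Omega> f f'" "eq_ae \<Omega> g g'"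
  shows "l2_inner \<Omega> f g = l2_inner \<Omega> f' g'"
  unfolding l2_inner_def
proof (rule integral_AE_cong[OF assms(1)])
  show "eq_ae \<Omega> (\<lambda>x. f x \<bullet> g x) (\<lambda>x. f' x \<bullet> g' x)"
    using assms(2,3) unfolding eq_ae_def by eventually_elim simp
qed

lemma l2_norm_cong:
  "\<Omega> \<in> sets lebesgue \<Longrightarrow> eq_ae \<Omega> f f' \<Longrightarrow> l2_norm \<Omega> f = l2_norm \<Omega> f'"
  unfolding l2_norm_def using l2_inner_cong by metis

lemma L2_AE_cong:
  assumes "\<Omega> \<in> sets lebesgue" "f \<in> L2 \<Omega>" "eq_ae \<Omega> f g"
  shows "g \<in> L2 \<Omega>"
proof -
  have m: "g \<in> borel_measurable (lebesgue_on \<Omega>)"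
    using assms measurable_AE_eq by (auto simp: L2_def)
  have "integrable (lebesgue_on \<Omega>) (\<lambda>x. (norm (g x))\<^sup>2)"
  proof (rule integrable_cong_AE_imp)
    show "integrable (lebesgue_on \<Omega>) (\<lambda>x. (norm (f x))\<^sup>2)" using assms by (simp add: L2_def)
    show "(\<lambda>x. (norm (g x))\<^sup>2) \<in> borel_measurable (lebesgue_on \<Omega>)" using m by measurable
    show "AE x in lebesgue_on \<Omega>. (norm (f x))\<^sup>2 = (norm (g x))\<^sup>2"
      using assms(3) unfolding eq_ae_def by eventually_elim simp
  qed
  with m show ?thesis by (simp add: L2_def)
qed

lemma L2_zero [simp]: "(\<lambda>x. 0) \<in> L2 \<Omega>" by (simp add: L2_def)

text \<open>Domination is the common route into \<open>L2\<close>: components, transposes, bounded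
  functions and the inverse permeability all pass through it.\<close>

lemma L2_bound:
  fixes f :: "real^'d::finite \<Rightarrow> 'b::euclidean_space" and g :: "real^'d \<Rightarrow> 'c::euclidean_space"
  assumes g: "g \<in> L2 \<Omega>" and f: "f \<in> borel_measurable (lebesgue_on \<Omega>)"
    and le: "AE x in lebesgue_on \<Omega>. norm (f x) \<le> C * norm (g x)"
  shows "f \<in> L2 \<Omega>"
proof -
  have "integrable (lebesgue_on \<Omega>) (\<lambda>x. (norm (f x))\<^sup>2)"
  proof (rule Bochner_Integration.integrable_bound)
    show "integrable (lebesgue_on \<Omega>) (\<lambda>x. C\<^sup>2 * (norm (g x))\<^sup>2)" using g by (simp add: L2_def)
    show "(\<lambda>x. (norm (f x))\<^sup>2) \<in> borel_measurable (lebesgue_on \<Omega>)" using f by measurable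
    show "AE x in lebesgue_on \<Omega>. norm ((norm (f x))\<^sup>2) \<le> norm (C\<^sup>2 * (norm (g x))\<^sup>2)"
      using le
    proof eventually_elim
      case (elim x)
      have "(norm (f x))\<^sup>2 \<le> (C * norm (g x))\<^sup>2" by (rule power_mono[OF elim]) simp
      then show ?case by (simp add: power_mult_distrib)
    qed
  qed
  with f show ?thesis by (simp add: L2_def)
qed

lemma L2_scale: "f \<in> L2 \<Omega> \<Longrightarrow> (\<lambda>x. c *\<^sub>R f x) \<in> L2 \<Omega>"
  by (rule L2_bound[where C = "\<bar>c\<bar>"]) (auto simp: L2_def)

lemma L2_add:
  assumes "f \<in> L2 \<Omega>" "g \<in> L2 \<Omega>"
  shows "(\<lambda>x. f x + g x) \<in> L2 \<Omega>"
proof -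
  have m: "(\<lambda>x. f x + g x) \<in> borel_measurable (lebesgue_on \<Omega>)" using assms by (auto simp: L2_def)
  have "integrable (lebesgue_on \<Omega>) (\<lambda>x. (norm (f x + g x))\<^sup>2)"
  proof (rule Bochner_Integration.integrable_bound)
    show "integrable (lebesgue_on \<Omega>) (\<lambda>x. 2 * (norm (f x))\<^sup>2 + 2 * (norm (g x))\<^sup>2)"
      using assms by (simp add: L2_def)
    show "(\<lambda>x. (norm (f x + g x))\<^sup>2) \<in> borel_measurable (lebesgue_on \<Omega>)" using m by measurable
    have "(norm (f x + g x))\<^sup>2 \<le> 2 * (norm (f x))\<^sup>2 + 2 * (norm (g x))\<^sup>2" for x
    proof -
      have "(norm (f x + g x))\<^sup>2 \<le> (norm (f x) + norm (g x))\<^sup>2"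
        by (rule power_mono[OF norm_triangle_ineq]) simp
      also have "\<dots> \<le> 2 * (norm (f x))\<^sup>2 + 2 * (norm (g x))\<^sup>2" using sum_squares_bound[of "norm (f x)" "norm (g x)"] by (simp add: power2_sum)
      finally show ?thesis .
    qed
    then show "AE x in lebesgue_on \<Omega>. norm ((norm (f x + g x))\<^sup>2) \<le> norm (2 * (norm (f x))\<^sup>2 + 2 * (norm (g x))\<^sup>2)"
      by auto
  qed
  with m show ?thesis by (simp add: L2_def)
qed

lemma L2_diff:
  assumes "f \<in> L2 \<Omega>" "g \<in> L2 \<Omega>" shows "(\<lambda>x. f x - g x) \<in> L2 \<Omega>"
  using L2_add[OF assms(1) L2_scale[OF assms(2), of "-1"]] by simp

lemma L2_sum:
  assumes "\<And>j. j \<in> J \<Longrightarrow> f j \<in> L2 \<Omega>"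
  shows "(\<lambda>x. \<Sum>j\<in>J. f j x) \<in> L2 \<Omega>"
  using assms by (induction J rule: infinite_finite_induct) (auto intro: L2_add)

lemma L2_lincomb:
  assumes "\<And>j. j \<in> J \<Longrightarrow> f j \<in> L2 \<Omega>"
  shows "(\<lambda>x. \<Sum>j\<in>J. c j *\<^sub>R f j x) \<in> L2 \<Omega>"
  using assms by (intro L2_sum L2_scale)

lemma L2_integrable_inner:
  fixes f g :: "real^'d::finite \<Rightarrow> 'b::euclidean_space"
  assumes "f \<in> L2 \<Omega>" "g \<in> L2 \<Omega>"
  shows "integrable (lebesgue_on \<Omega>) (\<lambda>x. f x \<bullet> g x)"
proof (rule Bochner_Integration.integrable_bound)
  show "integrable (lebesgue_on \<Omega>) (\<lambda>x. (norm (f x))\<^sup>2 + (norm (g x))\<^sup>2)"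
    using assms by (simp add: L2_def)
  show "(\<lambda>x. f x \<bullet> g x) \<in> borel_measurable (lebesgue_on \<Omega>)"
    using assms by (auto simp: L2_def intro!: borel_measurable_inner)
  have "\<bar>f x \<bullet> g x\<bar> \<le> (norm (f x))\<^sup>2 + (norm (g x))\<^sup>2" for x
  proof -
    have "2 * (norm (f x) * norm (g x)) \<le> (norm (f x))\<^sup>2 + (norm (g x))\<^sup>2"
      using sum_squares_bound[of "norm (f x)" "norm (g x)"] by simp
    moreover have "\<bar>f x \<bullet> g x\<bar> \<le> norm (f x) * norm (g x)" by (rule Cauchy_Schwarz_ineq2)
    ultimately show ?thesis using zero_le_mult_iff[of "norm (f x)" "norm (g x)"] by auto
  qed
  then show "AE x in lebesgue_on \<Omega>. norm (f x \<bullet> g x) \<le> norm ((norm (f x))\<^sup>2 + (norm (g x))\<^sup>2)" by auto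
qed

lemma l2_inner_commute: "l2_inner \<Omega> f g = l2_inner \<Omega> g f"
  by (simp add: l2_inner_def inner_commute)

lemma l2_inner_add_left:
  "f \<in> L2 \<Omega> \<Longrightarrow> g \<in> L2 \<Omega> \<Longrightarrow> h \<in> L2 \<Omega> \<Longrightarrow>
    l2_inner \<Omega> (\<lambda>x. f x + g x) h = l2_inner \<Omega> f h + l2_inner \<Omega> g h"
  by (simp add: l2_inner_def inner_add_left L2_integrable_inner)

lemma l2_inner_scale_left: "l2_inner \<Omega> (\<lambda>x. c *\<^sub>R f x) h = c * l2_inner \<Omega> f h"
  by (simp add: l2_inner_def)

lemma l2_inner_scale_right: "l2_inner \<Omega> h (\<lambda>x. c *\<^sub>R f x) = c * l2_inner \<Omega> h f"
  by (simp add: l2_inner_def)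

lemma l2_inner_diff_left:
  "f \<in> L2 \<Omega> \<Longrightarrow> g \<in> L2 \<Omega> \<Longrightarrow> h \<in> L2 \<Omega> \<Longrightarrow>
    l2_inner \<Omega> (\<lambda>x. f x - g x) h = l2_inner \<Omega> f h - l2_inner \<Omega> g h"
  by (simp add: l2_inner_def inner_diff_left L2_integrable_inner)

lemma l2_inner_zero [simp]: "l2_inner \<Omega> (\<lambda>x. 0) h = 0" "l2_inner \<Omega> h (\<lambda>x. 0) = 0"
  by (simp_all add: l2_inner_def)

lemma l2_inner_lincomb_left:
  assumes "\<And>j. j \<in> J \<Longrightarrow> f j \<in> L2 \<Omega>" "h \<in> L2 \<Omega>"
  shows "l2_inner \<Omega> (\<lambda>x. \<Sum>j\<in>J. c j *\<^sub>R f j x) h = (\<Sum>j\<in>J. c j * l2_inner \<Omega> (f j) h)"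
  using assms
proof (induction J rule: infinite_finite_induct)
  case (insert j J)
  then show ?case
    by (simp add: l2_inner_add_left L2_scale L2_lincomb l2_inner_scale_left)
qed auto

lemma l2_inner_lincomb_right:
  assumes "\<And>j. j \<in> J \<Longrightarrow> f j \<in> L2 \<Omega>" "h \<in> L2 \<Omega>"
  shows "l2_inner \<Omega> h (\<lambda>x. \<Sum>j\<in>J. c j *\<^sub>R f j x) = (\<Sum>j\<in>J. c j * l2_inner \<Omega> h (f j))"
  using l2_inner_lincomb_left[OF assms] by (simp add: l2_inner_commute)

lemma l2_inner_self_nonneg: "l2_inner \<Omega> f f \<ge> 0"
  unfolding l2_inner_def by (rule integral_nonneg_AE) simp

lemma l2_norm_nonneg [simp]: "l2_norm \<Omega> f \<ge> 0"
  by (simp add: l2_norm_def l2_inner_self_nonneg)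

lemma l2_norm_squared: "(l2_norm \<Omega> f)\<^sup>2 = l2_inner \<Omega> f f"
  by (simp add: l2_norm_def l2_inner_self_nonneg)

lemma l2_norm_scale: "l2_norm \<Omega> (\<lambda>x. c *\<^sub>R f x) = \<bar>c\<bar> * l2_norm \<Omega> f"
  by (simp add: l2_norm_def l2_inner_scale_left l2_inner_scale_right real_sqrt_mult flip: mult.assoc)

text \<open>One expansion serves three purposes: the discriminant argument for Cauchy-Schwarz, the
  triangle inequality with \<open>b = -1\<close>, and the squares in the contraction
  estimate.\<close>

lemma l2_inner_diff_diff:
  assumes "f \<in> L2 \<Omega>" "g \<in> L2 \<Omega>"
  shows "l2_inner \<Omega> (\<lambda>x. a *\<^sub>R f x - b *\<^sub>R g x) (\<lambda>x. a *\<^sub>R f x - b *\<^sub>R g x)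
       = a\<^sup>2 * l2_inner \<Omega> f f - 2 * a * b * l2_inner \<Omega> f g + b\<^sup>2 * l2_inner \<Omega> g g"
proof -
  let ?h = "\<lambda>x. a *\<^sub>R f x - b *\<^sub>R g x"
  have h: "?h \<in> L2 \<Omega>" using assms by (intro L2_diff L2_scale)
  have "l2_inner \<Omega> ?h ?h = a * l2_inner \<Omega> ?h f - b * l2_inner \<Omega> ?h g"
    using l2_inner_diff_left[OF L2_scale[OF assms(1)] L2_scale[OF assms(2)] h, of a b]
    by (simp add: l2_inner_scale_left l2_inner_commute)
  also have "l2_inner \<Omega> ?h f = a * l2_inner \<Omega> f f - b * l2_inner \<Omega> g f"
    using assms by (simp add: l2_inner_diff_left L2_scale l2_inner_scale_left)
  also have "l2_inner \<Omega> ?h g = a * l2_inner \<Omega> f g - b * l2_inner \<Omega> g g"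
    using assms by (simp add: l2_inner_diff_left L2_scale l2_inner_scale_left)
  finally show ?thesis
    by (simp add: algebra_simps power2_eq_square l2_inner_commute[of \<Omega> g f])
qed

text \<open>A nonnegative quadratic form in \<open>a\<close> and \<open>b\<close> has a nonpositive
  discriminant. The form may degenerate, so \<open>G = 0\<close> needs its own choice of
  \<open>a\<close> and \<open>b\<close>.\<close>

lemma l2_Cauchy_Schwarz:
  assumes "f \<in> L2 \<Omega>" "g \<in> L2 \<Omega>"
  shows "\<bar>l2_inner \<Omega> f g\<bar> \<le> l2_norm \<Omega> f * l2_norm \<Omega> g"
proof -
  define F G H where "F = l2_inner \<Omega> f f" and "G = l2_inner \<Omega> g g" and "H = l2_inner \<Omega> f g"
  have q: "0 \<le> a\<^sup>2 * F - 2 * a * b * H + b\<^sup>2 * G" for a b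
    using l2_inner_self_nonneg[of \<Omega> "\<lambda>x. a *\<^sub>R f x - b *\<^sub>R g x"] l2_inner_diff_diff[OF assms, of a b]
    by (simp add: F_def G_def H_def)
  have FG: "F \<ge> 0" "G \<ge> 0" by (simp_all add: F_def G_def l2_inner_self_nonneg)
  have "H\<^sup>2 \<le> F * G"
  proof (cases "G = 0")
    case True
    have "H = 0"
    proof (rule ccontr)
      assume "H \<noteq> 0"
      \<comment> \<open>With \<open>G = 0\<close> these values of \<open>a\<close> and
        \<open>b\<close> turn the quadratic form into -H^2.\<close>
      then show False using q[of H "(F + 1) / 2"] True
        by (simp add: power2_eq_square algebra_simps) (smt (verit) mult_pos_pos not_real_square_gt_zero)
    qed
    then show ?thesis using True by simp
  next
    case False
    then have "G > 0" using FG by simp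
    have "G\<^sup>2 * F - 2 * G * H * H + H\<^sup>2 * G = G * (F * G - H\<^sup>2)" by (simp add: power2_eq_square algebra_simps)
    then have "0 \<le> G * (F * G - H\<^sup>2)" using q[of G H] by simp
    then show ?thesis using \<open>G > 0\<close> by (simp add: zero_le_mult_iff)
  qed
  then have "sqrt (H\<^sup>2) \<le> sqrt (F * G)" by (rule real_sqrt_le_mono)
  then show ?thesis by (simp add: l2_norm_def F_def G_def H_def real_sqrt_mult)
qed

lemma l2_norm_triangle:
  assumes "f \<in> L2 \<Omega>" "g \<in> L2 \<Omega>"
  shows "l2_norm \<Omega> (\<lambda>x. f x + g x) \<le> l2_norm \<Omega> f + l2_norm \<Omega> g"
proof (rule power2_le_imp_le)
  have "(l2_norm \<Omega> (\<lambda>x. f x + g x))\<^sup>2 = (l2_norm \<Omega> f)\<^sup>2 + 2 * l2_inner \<Omega> f g + (l2_norm \<Omega> g)\<^sup>2"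
    using l2_inner_diff_diff[OF assms, of 1 "-1"] by (simp add: l2_norm_squared)
  also have "\<dots> \<le> (l2_norm \<Omega> f + l2_norm \<Omega> g)\<^sup>2"
    using l2_Cauchy_Schwarz[OF assms] by (simp add: power2_sum)
  finally show "(l2_norm \<Omega> (\<lambda>x. f x + g x))\<^sup>2 \<le> (l2_norm \<Omega> f + l2_norm \<Omega> g)\<^sup>2" .
qed simp

lemma l2_norm_zero [simp]: "l2_norm \<Omega> (\<lambda>x. 0) = 0"
  by (simp add: l2_norm_def)

lemma l2_norm_lincomb_le:
  assumes "\<And>j. j \<in> J \<Longrightarrow> f j \<in> L2 \<Omega>"
  shows "l2_norm \<Omega> (\<lambda>x. \<Sum>j\<in>J. c j *\<^sub>R f j x) \<le> (\<Sum>j\<in>J. \<bar>c j\<bar> * l2_norm \<Omega> (f j))"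
  using assms
proof (induction J rule: infinite_finite_induct)
  case (insert j J)
  have "l2_norm \<Omega> (\<lambda>x. c j *\<^sub>R f j x + (\<Sum>j\<in>J. c j *\<^sub>R f j x))
      \<le> l2_norm \<Omega> (\<lambda>x. c j *\<^sub>R f j x) + l2_norm \<Omega> (\<lambda>x. \<Sum>j\<in>J. c j *\<^sub>R f j x)"
    using insert by (intro l2_norm_triangle L2_scale L2_lincomb) auto
  then show ?case using insert by (simp add: l2_norm_scale)
qed auto

lemma l2_norm_eq_0D:
  fixes f :: "real^'d::finite \<Rightarrow> 'b::euclidean_space"
  assumes "f \<in> L2 \<Omega>" "l2_norm \<Omega> f = 0"
  shows "eq_ae \<Omega> f (\<lambda>x. 0)"
proof -
  have "integrable (lebesgue_on \<Omega>) (\<lambda>x. f x \<bullet> f x)" using L2_integrable_inner[OF assms(1,1)] .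
  moreover have "(\<integral>x. f x \<bullet> f x \<partial>(lebesgue_on \<Omega>)) = 0" using assms(2) by (simp add: l2_norm_def l2_inner_def)
  ultimately have "AE x in lebesgue_on \<Omega>. f x \<bullet> f x = 0"
    by (subst (asm) integral_nonneg_eq_0_iff_AE) auto
  then show ?thesis by (simp add: eq_ae_def)
qed

section \<open>The inverse permeability\<close>

lemma matrix_mult_matrix_inv:
  fixes A :: "real^'n::finite^'n"
  assumes "invertible A"
  shows "A ** matrix_inv A = mat 1"
  using assms someI_ex[of "\<lambda>A'. A ** A' = mat 1 \<and> A' ** A = mat 1"]
  by (auto simp: matrix_inv_def invertible_def)

text \<open>Cramer's rule exhibits the inverse as a rational function of the entries, which is how
  its measurable dependence on the matrix is obtained.\<close>

lemma matrix_inv_component: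
  fixes A :: "real^'n::finite^'n"
  assumes "det A \<noteq> 0"
  shows "(matrix_inv A *v b) $ k = det (\<chi> i j. if j = k then b $ i else A $ i $ j) / det A"
proof -
  have "A *v (matrix_inv A *v b) = b"
    using assms by (simp add: matrix_vector_mul_assoc matrix_mult_matrix_inv invertible_det_nz)
  then show ?thesis using cramer[OF assms] by simp
qed

text \<open>For a singular matrix \<open>matrix_inv\<close> is a choice from an empty set, hence always the same junk value.\<close>

lemma matrix_inv_not_invertible:
  fixes A B :: "real^'n::finite^'n"
  assumes "det A = 0" "det B = 0"
  shows "matrix_inv A = matrix_inv B"
proof -
  have "\<not> invertible A" "\<not> invertible B" using assms by (simp_all add: invertible_det_nz)
  then have "(\<lambda>X. A ** X = mat 1 \<and> X ** A = mat 1) = (\<lambda>X. B ** X = mat 1 \<and> X ** B = mat 1)"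
    by (auto simp: invertible_def)
  then show ?thesis by (simp add: matrix_inv_def)
qed

lemma borel_measurable_det:
  fixes F :: "'a \<Rightarrow> real^'n::finite^'n"
  assumes "\<And>i j. (\<lambda>x. F x $ i $ j) \<in> borel_measurable N"
  shows "(\<lambda>x. det (F x)) \<in> borel_measurable N"
  unfolding det_def using assms by measurable

lemma borel_measurable_vec_nth:
  fixes f :: "'a \<Rightarrow> 'b::euclidean_space^'n::finite"
  assumes "f \<in> borel_measurable N"
  shows "(\<lambda>x. f x $ i) \<in> borel_measurable N"
  using assms by (rule borel_measurable_continuous_on[rotated]) (intro continuous_intros)

lemma borel_measurable_vec_lambda:
  fixes f :: "'a \<Rightarrow> real^'n::finite"
  assumes "\<And>i. (\<lambda>x. f x $ i) \<in> borel_measurable N"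
  shows "f \<in> borel_measurable N"
proof (subst borel_measurable_euclidean_space, rule ballI)
  fix b :: "real^'n" assume "b \<in> Basis"
  then obtain i where "b = axis i 1" by (auto simp: Basis_vec_def)
  then show "(\<lambda>x. f x \<bullet> b) \<in> borel_measurable N" using assms by (simp add: inner_axis)
qed

text \<open>Where the determinant is nonzero Cramer's rule applies; where it vanishes the inverse is
  one fixed junk matrix, represented by \<open>matrix_inv 0\<close>. Both pieces are
  measurable.\<close>

lemma borel_measurable_matrix_inv_mult:
  fixes F :: "'a \<Rightarrow> real^'n::finite^'n" and v :: "'a \<Rightarrow> real^'n"
  assumes F: "F \<in> borel_measurable N" and v: "v \<in> borel_measurable N"
  shows "(\<lambda>x. matrix_inv (F x) *v v x) \<in> borel_measurable N"
proof (rule borel_measurable_vec_lambda)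
  fix k
  have Fij: "(\<lambda>x. F x $ i $ j) \<in> borel_measurable N" for i j
    by (intro borel_measurable_vec_nth F)
  have vi: "(\<lambda>x. v x $ i) \<in> borel_measurable N" for i by (intro borel_measurable_vec_nth v)
  have det0: "det (0 :: real^'n^'n) = 0" by (simp add: det_def power_0_left)
  have eq: "(\<lambda>x. (matrix_inv (F x) *v v x) $ k) =
    (\<lambda>x. if det (F x) = 0 then (\<Sum>j\<in>UNIV. matrix_inv (0::real^'n^'n) $ k $ j * v x $ j)
         else det (\<chi> i j. if j = k then v x $ i else F x $ i $ j) / det (F x))"
  proof (rule ext)
    fix x
    show "(matrix_inv (F x) *v v x) $ k =
      (if det (F x) = 0 then (\<Sum>j\<in>UNIV. matrix_inv (0::real^'n^'n) $ k $ j * v x $ j)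
         else det (\<chi> i j. if j = k then v x $ i else F x $ i $ j) / det (F x))"
      using matrix_inv_not_invertible[of "F x" 0] det0 matrix_inv_component[of "F x" "v x" k]
      by (auto simp: matrix_vector_mult_def)
  qed
  have d1: "(\<lambda>x. det (F x)) \<in> borel_measurable N" by (rule borel_measurable_det) (rule Fij)
  have d2: "(\<lambda>x. det (\<chi> i j. if j = k then v x $ i else F x $ i $ j)) \<in> borel_measurable N"
    by (rule borel_measurable_det) (use Fij vi in auto)
  show "(\<lambda>x. (matrix_inv (F x) *v v x) $ k) \<in> borel_measurable N"
    unfolding eq using d1 d2 vi by measurable
qed

lemma norm_matrix_vector_mult_le:
  fixes A :: "real^'n::finite^'m::finite"
  shows "norm (A *v x) \<le> norm A * norm x"
proof -
  have "norm (A *v x) = L2_set (\<lambda>i. norm ((A *v x) $ i)) UNIV" by (simp add: norm_vec_def)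
  also have "\<dots> \<le> L2_set (\<lambda>i. norm (A $ i) * norm x) UNIV"
  proof (rule L2_set_mono)
    fix i
    have "(A *v x) $ i = A $ i \<bullet> x" by (simp add: matrix_vector_mult_def inner_vec_def)
    then show "norm ((A *v x) $ i) \<le> norm (A $ i) * norm x"
      using Cauchy_Schwarz_ineq2[of "A $ i" x] by simp
  qed simp
  also have "\<dots> = norm A * norm x"
    by (simp add: L2_set_left_distrib[symmetric] norm_vec_def[of A])
  finally show ?thesis .
qed

text \<open>All three facts come from substituting y, the inverse of A applied to \<xi>. Coercivity
  at y bounds y from above; together with |\<xi>| \<le> C |y| it gives the lower bound, whence the
  constant \<open>\<kappa> / C\<^sup>2\<close>.\<close>

lemma matrix_inv_spd:
  fixes A :: "real^'n::finite^'n"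
  assumes sym: "transpose A = A" and \<kappa>: "\<kappa> > 0" and pos: "\<And>\<xi>. \<kappa> * (\<xi> \<bullet> \<xi>) \<le> \<xi> \<bullet> (A *v \<xi>)"
    and C: "norm A \<le> C" "C > 0"
  shows "(matrix_inv A *v \<xi>) \<bullet> \<eta> = \<xi> \<bullet> (matrix_inv A *v \<eta>)"
    and "norm (matrix_inv A *v \<xi>) \<le> 1 / \<kappa> * norm \<xi>"
    and "\<kappa> / C\<^sup>2 * (\<xi> \<bullet> \<xi>) \<le> (matrix_inv A *v \<xi>) \<bullet> \<xi>"
proof -
  have "x = 0" if "A *v x = 0" for x
    using pos[of x] that \<kappa> by (simp add: mult_le_0_iff) (metis inner_ge_zero inner_eq_zero_iff order_antisym)
  then have "invertible A"
    by (metis invertible_left_inverse matrix_left_invertible_ker)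
  then have inv: "A *v (matrix_inv A *v x) = x" for x
    by (simp add: matrix_vector_mul_assoc matrix_mult_matrix_inv)
  have symA: "(A *v x) \<bullet> y = x \<bullet> (A *v y)" for x y
    by (metis dot_lmul_matrix sym transpose_matrix_vector vector_transpose_matrix)
  show "(matrix_inv A *v \<xi>) \<bullet> \<eta> = \<xi> \<bullet> (matrix_inv A *v \<eta>)"
    using symA[of "matrix_inv A *v \<xi>" "matrix_inv A *v \<eta>"] inv by simp
  let ?y = "matrix_inv A *v \<xi>"
  have lower: "\<kappa> * (?y \<bullet> ?y) \<le> ?y \<bullet> \<xi>" using pos[of ?y] inv by simp
  also have "?y \<bullet> \<xi> \<le> norm ?y * norm \<xi>" by (rule norm_cauchy_schwarz)
  finally have "\<kappa> * norm ?y * norm ?y \<le> norm \<xi> * norm ?y"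
    by (simp add: power2_norm_eq_inner[symmetric] power2_eq_square mult_ac)
  then have "\<kappa> * norm ?y \<le> norm \<xi>"
    by (cases "?y = 0") (auto simp: mult_le_cancel_right)
  then show "norm ?y \<le> 1 / \<kappa> * norm \<xi>" using \<kappa> by (simp add: field_simps)
  have "norm \<xi> \<le> norm A * norm ?y" using norm_matrix_vector_mult_le[of A ?y] inv by simp
  also have "\<dots> \<le> C * norm ?y" by (rule mult_right_mono[OF C(1)]) simp
  finally have "(norm \<xi>)\<^sup>2 \<le> (C * norm ?y)\<^sup>2" by (rule power_mono) simp
  then have "(\<xi> \<bullet> \<xi>) / C\<^sup>2 \<le> ?y \<bullet> ?y"
    using C by (simp add: power2_norm_eq_inner power_mult_distrib field_simps)
  then have "\<kappa> * ((\<xi> \<bullet> \<xi>) / C\<^sup>2) \<le> \<kappa> * (?y \<bullet> ?y)" using \<kappa> by (intro mult_left_mono) auto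
  with lower show "\<kappa> / C\<^sup>2 * (\<xi> \<bullet> \<xi>) \<le> ?y \<bullet> \<xi>" by simp
qed

lemma permeability_inverse:
  fixes Kp :: "real^'d::finite \<Rightarrow> real^'d^'d"
  assumes perm: "permeability \<Omega> Kp"
  obtains c where "c > 0"
    and "\<And>v. v \<in> L2 \<Omega> \<Longrightarrow> (\<lambda>x. matrix_inv (Kp x) *v v x) \<in> L2 \<Omega>"
    and "\<And>v w. v \<in> L2 \<Omega> \<Longrightarrow> w \<in> L2 \<Omega> \<Longrightarrow> \<Omega> \<in> sets lebesgue \<Longrightarrow>
      l2_inner \<Omega> (\<lambda>x. matrix_inv (Kp x) *v v x) w = l2_inner \<Omega> (\<lambda>x. matrix_inv (Kp x) *v w x) v"
    and "\<And>v. v \<in> L2 \<Omega> \<Longrightarrow> c * l2_inner \<Omega> v v \<le> l2_inner \<Omega> (\<lambda>x. matrix_inv (Kp x) *v v x) v"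
proof -
  from perm obtain C0 \<kappa> where meas: "Kp \<in> borel_measurable (lebesgue_on \<Omega>)"
    and bd: "AE x in lebesgue_on \<Omega>. norm (Kp x) \<le> C0"
    and sym: "AE x in lebesgue_on \<Omega>. transpose (Kp x) = Kp x"
    and \<kappa>: "\<kappa> > 0" and pos: "AE x in lebesgue_on \<Omega>. \<forall>\<xi>. \<kappa> * (\<xi> \<bullet> \<xi>) \<le> \<xi> \<bullet> (Kp x *v \<xi>)"
    by (auto simp: permeability_def)
  \<comment> \<open>\<open>C0\<close> is not known to be positive, and the lower bound divides by
    the square of the bound.\<close>
  define C where "C = max C0 1"
  have C: "C > 0" by (simp add: C_def)
  have ae: "AE x in lebesgue_on \<Omega>.
      (\<forall>\<xi> \<eta>. (matrix_inv (Kp x) *v \<xi>) \<bullet> \<eta> = \<xi> \<bullet> (matrix_inv (Kp x) *v \<eta>)) \<and>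
      (\<forall>\<xi>. norm (matrix_inv (Kp x) *v \<xi>) \<le> 1 / \<kappa> * norm \<xi>) \<and>
      (\<forall>\<xi>. \<kappa> / C\<^sup>2 * (\<xi> \<bullet> \<xi>) \<le> (matrix_inv (Kp x) *v \<xi>) \<bullet> \<xi>)"
    using bd sym pos
  proof eventually_elim
    case (elim x)
    have "norm (Kp x) \<le> C" using elim(1) by (simp add: C_def)
    note * = matrix_inv_spd[OF elim(2) \<kappa> elim(3)[rule_format] this C]
    show ?case using * by blast
  qed
  have L2: "(\<lambda>x. matrix_inv (Kp x) *v v x) \<in> L2 \<Omega>" if v: "v \<in> L2 \<Omega>" for v
  proof (rule L2_bound[OF v])
    show "(\<lambda>x. matrix_inv (Kp x) *v v x) \<in> borel_measurable (lebesgue_on \<Omega>)"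
      using v meas by (intro borel_measurable_matrix_inv_mult) (auto simp: L2_def)
    show "AE x in lebesgue_on \<Omega>. norm (matrix_inv (Kp x) *v v x) \<le> 1 / \<kappa> * norm (v x)"
      using ae by eventually_elim blast
  qed
  show ?thesis
  proof (rule that[of "\<kappa> / C\<^sup>2"])
    show "\<kappa> / C\<^sup>2 > 0" using \<kappa> C by simp
    show "(\<lambda>x. matrix_inv (Kp x) *v v x) \<in> L2 \<Omega>" if "v \<in> L2 \<Omega>" for v by (rule L2[OF that])
    show "l2_inner \<Omega> (\<lambda>x. matrix_inv (Kp x) *v v x) w = l2_inner \<Omega> (\<lambda>x. matrix_inv (Kp x) *v w x) v"
      if "v \<in> L2 \<Omega>" "w \<in> L2 \<Omega>" "\<Omega> \<in> sets lebesgue" for v w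
      unfolding l2_inner_def
    proof (rule integral_AE_cong[OF that(3)])
      show "eq_ae \<Omega> (\<lambda>x. (matrix_inv (Kp x) *v v x) \<bullet> w x) (\<lambda>x. (matrix_inv (Kp x) *v w x) \<bullet> v x)"
        unfolding eq_ae_def using ae by eventually_elim (metis inner_commute)
    qed
    show "\<kappa> / C\<^sup>2 * l2_inner \<Omega> v v \<le> l2_inner \<Omega> (\<lambda>x. matrix_inv (Kp x) *v v x) v" if v: "v \<in> L2 \<Omega>" for v
    proof -
      have "(\<integral>x. \<kappa> / C\<^sup>2 * (v x \<bullet> v x) \<partial>(lebesgue_on \<Omega>))
        \<le> (\<integral>x. (matrix_inv (Kp x) *v v x) \<bullet> v x \<partial>(lebesgue_on \<Omega>))"
      proof (rule integral_mono_AE)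
        show "integrable (lebesgue_on \<Omega>) (\<lambda>x. \<kappa> / C\<^sup>2 * (v x \<bullet> v x))"
          using L2_integrable_inner[OF v v] by simp
        show "integrable (lebesgue_on \<Omega>) (\<lambda>x. (matrix_inv (Kp x) *v v x) \<bullet> v x)"
          by (rule L2_integrable_inner[OF L2[OF v] v])
        show "AE x in lebesgue_on \<Omega>. \<kappa> / C\<^sup>2 * (v x \<bullet> v x) \<le> (matrix_inv (Kp x) *v v x) \<bullet> v x"
          using ae by eventually_elim blast
      qed
      then show ?thesis by (simp add: l2_inner_def)
    qed
  qed
qed

section \<open>The fundamental lemma of the calculus of variations\<close>

definition flat :: "real poly \<Rightarrow> real \<Rightarrow> real" where
  "flat p t = (if t > 0 then poly p (1 / t) * exp (- (1 / t)) else 0)"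

lemma tendsto_poly_exp_neg: "((\<lambda>y. poly p y * exp (- y)) \<longlongrightarrow> (0::real)) at_top"
proof -
  have "((\<lambda>y. \<Sum>k\<le>degree p. coeff p k * (y ^ k / exp y)) \<longlongrightarrow> (\<Sum>k\<le>degree p. coeff p k * 0)) at_top"
    by (intro tendsto_sum tendsto_mult tendsto_const tendsto_power_div_exp_0)
  moreover have "(\<Sum>k\<le>degree p. coeff p k * (y ^ k / exp y)) = poly p y * exp (- y)" for y
    by (simp add: poly_altdef sum_distrib_right exp_minus divide_inverse mult.assoc)
  ultimately show ?thesis by simp
qed

text \<open>This is differentiability at 0: with y = 1/t the quotient from the right is y p(y)
  exp(-y), again a polynomial times a decaying exponential, which is where \<open>pCons 0 p\<close>
  comes from.\<close>

lemma flat_quotient_tendsto_0: "((\<lambda>t. flat p t / t) \<longlongrightarrow> 0) (at 0)"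
proof (rule filterlim_split_at)
  have "((\<lambda>t. poly (pCons 0 p) (inverse t) * exp (- inverse t)) \<longlongrightarrow> 0) (at_right 0)"
    by (rule filterlim_compose[OF tendsto_poly_exp_neg filterlim_inverse_at_top_right])
  then show "((\<lambda>t. flat p t / t) \<longlongrightarrow> 0) (at_right 0)"
    by (rule Lim_transform_eventually)
       (auto simp: flat_def eventually_at_right_field inverse_eq_divide intro!: exI[of _ 1])
  show "((\<lambda>t. flat p t / t) \<longlongrightarrow> 0) (at_left 0)"
    by (rule tendsto_eventually) (auto simp: flat_def eventually_at_left_field intro!: exI[of _ "-1"])
qed

text \<open>The polynomial parameter makes the family closed under differentiation: for t > 0 the
  derivative of p(1/t) exp(-1/t) is (p - p')(1/t) exp(-1/t) / t^2, and \<open>[:0, 0, 1:]\<close>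
  supplies the factor 1/t^2.\<close>

lemma flat_has_derivative:
  "(flat p has_real_derivative flat ([:0, 0, 1:] * (p - pderiv p)) t) (at t)"
proof -
  consider "t > 0" | "t < 0" | "t = 0" by linarith
  then show ?thesis
  proof cases
    case 1
    have "((\<lambda>t. poly p (1 / t) * exp (- (1 / t))) has_real_derivative
        flat ([:0, 0, 1:] * (p - pderiv p)) t) (at t)"
      using 1 by (auto intro!: derivative_eq_intros DERIV_chain'[OF _ poly_DERIV]
          simp: flat_def field_simps power2_eq_square)
    then show ?thesis
      by (rule has_field_derivative_transform_within_open[of _ _ _ "{0<..}"])
         (use 1 in \<open>auto simp: flat_def\<close>)
  next
    case 2
    have "((\<lambda>t. 0) has_real_derivative flat ([:0, 0, 1:] * (p - pderiv p)) t) (at t)"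
      using 2 by (simp add: flat_def)
    then show ?thesis
      by (rule has_field_derivative_transform_within_open[of _ _ _ "{..<0}"])
         (use 2 in \<open>auto simp: flat_def\<close>)
  next
    case 3
    then show ?thesis using flat_quotient_tendsto_0[of p]
      by (simp add: DERIV_def flat_def[of _ 0])
  qed
qed

text \<open>An invariant for the coinductive smoothness predicate: an algebra of functions that
  contains all partial derivatives of its members. The affine argument in one coordinate is what the
  faces of a box require.\<close>

inductive_set flat_algebra :: "(real^'d::finite \<Rightarrow> real) set" where
  const: "(\<lambda>x. c) \<in> flat_algebra"
| flat: "(\<lambda>x. flat p (c * x $ i + d)) \<in> flat_algebra"
| add: "f \<in> flat_algebra \<Longrightarrow> g \<in> flat_algebra \<Longrightarrow> (\<lambda>x. f x + g x) \<in> flat_algebra"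
| mult: "f \<in> flat_algebra \<Longrightarrow> g \<in> flat_algebra \<Longrightarrow> (\<lambda>x. f x * g x) \<in> flat_algebra"

lemma flat_algebra_prod:
  "finite A \<Longrightarrow> (\<And>i. i \<in> A \<Longrightarrow> f i \<in> flat_algebra) \<Longrightarrow> (\<lambda>x. \<Prod>i\<in>A. f i x) \<in> flat_algebra"
  by (induction A rule: finite_induct) (auto intro: flat_algebra.intros)

lemma flat_algebra_derivative:
  assumes "f \<in> flat_algebra"
  shows "\<exists>f'. (\<forall>x. (f has_derivative f' x) (at x)) \<and> (\<forall>j. (\<lambda>x. f' x (axis j 1)) \<in> flat_algebra)"
  using assms
proof induction
  case (const c)
  show ?case by (rule exI[of _ "\<lambda>x h. 0"]) (auto intro: flat_algebra.const)
next
  case (flat p c i d)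
  let ?q = "[:0, 0, 1:] * (p - pderiv p)"
  have "((\<lambda>x. flat p (c * x $ i + d)) has_derivative (\<lambda>h. flat ?q (c * x $ i + d) * (c * h $ i))) (at x)" for x
  proof -
    have *: "(flat p has_derivative (\<lambda>h. flat ?q (c * x $ i + d) * h)) (at (c * x $ i + d))"
      using flat_has_derivative[of p] by (simp add: has_field_derivative_def)
    have "((\<lambda>x. c * x $ i + d) has_derivative (\<lambda>h. c * h $ i)) (at x)"
      by (auto intro!: derivative_eq_intros bounded_linear.has_derivative[OF bounded_linear_vec_nth])
    from has_derivative_compose[OF this *] show ?thesis by simp
  qed
  then show ?case
    by (intro exI[of _ "\<lambda>x h. flat ?q (c * x $ i + d) * (c * h $ i)"])
       (auto simp del: mult_pCons_left intro: flat_algebra.intros)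
next
  case (add f g)
  then obtain f' g' where "\<forall>x. (f has_derivative f' x) (at x)" "\<forall>j. (\<lambda>x. f' x (axis j 1)) \<in> flat_algebra"
    "\<forall>x. (g has_derivative g' x) (at x)" "\<forall>j. (\<lambda>x. g' x (axis j 1)) \<in> flat_algebra" by blast
  then show ?case
    by (intro exI[of _ "\<lambda>x h. f' x h + g' x h"]) (auto intro: flat_algebra.intros has_derivative_add)
next
  case (mult f g)
  then obtain f' g' where "\<forall>x. (f has_derivative f' x) (at x)" "\<forall>j. (\<lambda>x. f' x (axis j 1)) \<in> flat_algebra"
    "\<forall>x. (g has_derivative g' x) (at x)" "\<forall>j. (\<lambda>x. g' x (axis j 1)) \<in> flat_algebra" by blast
  with mult.hyps show ?case
    by (intro exI[of _ "\<lambda>x h. f x * g' x h + f' x h * g x"]) (auto intro!: flat_algebra.add flat_algebra.mult intro: has_derivative_mult)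
qed

lemma flat_algebra_smooth:
  assumes "f \<in> flat_algebra"
  shows "smooth_fun f"
  using assms
proof (coinduction arbitrary: f rule: smooth_fun.coinduct)
  case (smooth_fun f)
  then obtain f' where f': "\<And>x. (f has_derivative f' x) (at x)" "\<And>j. (\<lambda>x. f' x (axis j 1)) \<in> flat_algebra"
    using flat_algebra_derivative by blast
  have "partial j f = (\<lambda>x. f' x (axis j 1))" for j
    using frechet_derivative_at[OF f'(1)] by (auto simp: partial_def)
  then show ?case using f' by (auto simp: differentiable_def)
qed

section \<open>Bumps converging to the indicator of a box\<close>

definition box_bump :: "real^'d::finite \<Rightarrow> real^'d \<Rightarrow> nat \<Rightarrow> real^'d \<Rightarrow> real" where
  "box_bump a b m x = (\<Prod>i\<in>UNIV. flat 1 (real m * x $ i + (- real m * a $ i)) * flat 1 (- real m * x $ i + real m * b $ i))"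

lemma flat_1_bounds: "0 \<le> flat 1 t" "flat 1 t \<le> 1"
  by (auto simp: flat_def)

lemma box_bump_bounds: "0 \<le> box_bump a b m x" "box_bump a b m x \<le> 1"
  unfolding box_bump_def
  by (auto intro!: prod_nonneg prod_le_1 mult_nonneg_nonneg mult_le_one simp: flat_1_bounds)

lemma box_bump_outside:
  assumes "x \<notin> box a b"
  shows "box_bump a b m x = 0"
proof -
  obtain i where i: "x $ i \<le> a $ i \<or> b $ i \<le> x $ i"
    using assms by (auto simp: mem_box_cart not_less)
  have "flat 1 (real m * x $ i + (- real m * a $ i)) * flat 1 (- real m * x $ i + real m * b $ i) = 0"
  proof (cases "x $ i \<le> a $ i")
    case True
    then have "real m * x $ i + (- real m * a $ i) \<le> 0" by (simp add: mult_left_mono)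
    then show ?thesis by (simp add: flat_def)
  next
    case False
    then have "- real m * x $ i + real m * b $ i \<le> 0" using i by (simp add: mult_left_mono)
    then show ?thesis by (simp add: flat_def)
  qed
  then show ?thesis unfolding box_bump_def by (intro prod_zero) auto
qed

text \<open>The factor m stands inside \<open>flat\<close>: for t > 0 the value exp(-1/(m t)) tends
  to 1, while every bump vanishes outside the same open box.\<close>

lemma box_bump_tendsto: "(\<lambda>m. box_bump a b m x) \<longlonglongrightarrow> indicator (box a b) x"
proof (cases "x \<in> box a b")
  case True
  have lim: "(\<lambda>m. flat 1 (real m * t)) \<longlonglongrightarrow> 1" if "t > 0" for t
  proof -
    have "(\<lambda>m. exp (- (inverse (real m) * inverse t))) \<longlonglongrightarrow> exp (- (0 * inverse t))"
      by (intro tendsto_intros lim_inverse_n)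
    moreover have "\<forall>\<^sub>F m in sequentially. exp (- (inverse (real m) * inverse t)) = flat 1 (real m * t)"
      using eventually_gt_at_top[of 0] by eventually_elim (use that in \<open>auto simp: flat_def field_simps\<close>)
    ultimately show ?thesis by (auto intro: Lim_transform_eventually)
  qed
  have "(\<lambda>m. \<Prod>i\<in>UNIV. flat 1 (real m * (x $ i - a $ i)) * flat 1 (real m * (b $ i - x $ i))) \<longlonglongrightarrow> (\<Prod>i\<in>(UNIV::'a set). 1 * 1)"
    by (intro tendsto_prod tendsto_mult lim) (use True in \<open>auto simp: mem_box_cart\<close>)
  then show ?thesis using True by (simp add: box_bump_def algebra_simps)
next
  case False
  then show ?thesis by (simp add: box_bump_outside)
qed

lemma box_bump_test_function:
  assumes "cbox a b \<subseteq> \<Omega>"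
  shows "box_bump a b m \<in> test_functions \<Omega>"
proof -
  have "box_bump a b m \<in> flat_algebra"
    unfolding box_bump_def[abs_def]
    by (intro flat_algebra_prod flat_algebra.mult flat_algebra.flat) simp
  then have "smooth_fun (box_bump a b m)" by (rule flat_algebra_smooth)
  moreover have "{x. box_bump a b m x \<noteq> 0} \<subseteq> cbox a b"
    using box_bump_outside box_subset_cbox by blast
  then have sub: "closure {x. box_bump a b m x \<noteq> 0} \<subseteq> cbox a b"
    by (rule closure_minimal) (rule closed_cbox)
  moreover have "compact (closure {x. box_bump a b m x \<noteq> 0})"
    using bounded_subset[OF bounded_cbox sub] by (simp add: compact_eq_bounded_closed)
  ultimately show ?thesis using assms by (auto simp: test_functions_def)
qed

section \<open>From vanishing box integrals to vanishing almost everywhere\<close>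

lemma box_integrals_zero_imp_AE_zero:
  fixes h :: "real^'d::finite \<Rightarrow> real"
  assumes int: "integrable lborel h"
    and zero: "\<And>c d. (\<integral>x. indicator (box c d) x * h x \<partial>lborel) = 0"
  shows "AE x in lborel. h x = 0"
proof (rule sigma_finite_measure.density_zero[OF sigma_finite_lborel int])
  have indint: "integrable lborel (\<lambda>x. indicator A x * h x)" if "A \<in> sets lborel" for A
    using integrable_mult_indicator[OF that int] by simp
  \<comment> \<open>The value on the whole space, a limit over growing boxes, is what the complement
    step of the Dynkin argument needs.\<close>
  have UNIV0: "(\<integral>x. h x \<partial>lborel) = 0"
  proof -
    have "(\<lambda>n::nat. \<integral>x. indicator (box (- (real n *\<^sub>R One)) (real n *\<^sub>R One)) x * h x \<partial>lborel) \<longlonglongrightarrow> (\<integral>x. h x \<partial>lborel)"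
    proof (rule integral_dominated_convergence[where w = "\<lambda>x. norm (h x)"])
      show "h \<in> borel_measurable lborel" using int by simp
      show "(\<lambda>x. indicator (box (- (real n *\<^sub>R One)) (real n *\<^sub>R One)) x * h x) \<in> borel_measurable lborel" for n
        using indint[of "box (- (real n *\<^sub>R One)) (real n *\<^sub>R One)"] by auto
      show "integrable lborel (\<lambda>x. norm (h x))" using int by simp
      show "AE x in lborel. (\<lambda>n. indicator (box (- (real n *\<^sub>R One)) (real n *\<^sub>R One)) x * h x) \<longlonglongrightarrow> h x"
      proof (rule AE_I2)
        fix x :: "real^'d"
        have "x \<in> (\<Union>i::nat. box (- (real i *\<^sub>R One)) (real i *\<^sub>R One))" by (simp only: UN_box_eq_UNIV UNIV_I)
        then obtain i where i: "x \<in> box (- (real i *\<^sub>R One)) (real i *\<^sub>R One)" by blast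
        have "\<forall>\<^sub>F n in sequentially. indicator (box (- (real n *\<^sub>R One)) (real n *\<^sub>R One)) x * h x = h x"
          using eventually_ge_at_top[of i]
        proof eventually_elim
          case (elim n)
          have "x \<in> box (- (real n *\<^sub>R One)) (real n *\<^sub>R One)"
          proof (unfold mem_box, rule ballI)
            fix b :: "real^'d" assume b: "b \<in> Basis"
            have "- real i < x \<bullet> b \<and> x \<bullet> b < real i" using i b by (simp add: mem_box)
            moreover have "real i \<le> real n" using elim by simp
            ultimately show "(- (real n *\<^sub>R One)) \<bullet> b < x \<bullet> b \<and> x \<bullet> b < (real n *\<^sub>R One) \<bullet> b"
              using b by simp
          qed
          then show ?case by simp
        qed
        then show "(\<lambda>n. indicator (box (- (real n *\<^sub>R One)) (real n *\<^sub>R One)) x * h x) \<longlonglongrightarrow> h x"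
          by (rule tendsto_eventually)
      qed
      show "AE x in lborel. norm (indicator (box (- (real n *\<^sub>R One)) (real n *\<^sub>R One)) x * h x) \<le> norm (h x)" for n
        by (auto simp: indicator_def)
    qed
    then show ?thesis using zero by (simp add: LIMSEQ_const_iff)
  qed
  \<comment> \<open>Open boxes are an intersection-stable generator of the Borel sets, so it is
    enough that the sets with vanishing integral form a Dynkin system.\<close>
  have borel0: "(\<integral>x. indicator A x * h x \<partial>lborel) = 0" if "A \<in> sets borel" for A
  proof -
    have A: "A \<in> sigma_sets UNIV (range (\<lambda>(a, b). box a b))" using that by (simp add: borel_eq_box)
    have stable: "Int_stable (range (\<lambda>(a, b). box a b :: (real^'d) set))"
      by (auto simp: Int_stable_def box_Int_box)
    have sub: "range (\<lambda>(a, b). box a b :: (real^'d) set) \<subseteq> Pow UNIV" by simp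
    show ?thesis using stable sub A
    proof (induction rule: sigma_sets_induct_disjoint)
      case (basic A)
      then show ?case using zero by auto
    next
      case empty
      then show ?case by simp
    next
      case (compl A)
      have "A \<in> sets borel" using compl(1) by (simp add: borel_eq_box)
      then have A: "A \<in> sets lborel" by simp
      have "(\<integral>x. indicator (UNIV - A) x * h x \<partial>lborel) = (\<integral>x. h x - indicator A x * h x \<partial>lborel)"
        by (rule Bochner_Integration.integral_cong) (auto simp: indicator_def)
      also have "\<dots> = 0" using int indint[OF A] UNIV0 compl by simp
      finally show ?case .
    next
      case (union A)
      have "A i \<in> sets borel" for i using union(2) by (auto simp: borel_eq_box)
      then have A: "A i \<in> sets lborel" for i by simp
      have "(LINT x:(\<Union>i. A i)|lborel. h x) = (\<Sum>i. (LINT x:(A i)|lborel. h x))"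
        by (rule lebesgue_integral_countable_add)
           (use A union(1) indint[of "\<Union>i. A i"] in \<open>auto simp: disjoint_family_on_def set_integrable_def\<close>)
      then show ?case using union(3) by (simp add: set_lebesgue_integral_def)
    qed
  qed
  fix A :: "(real^'d) set" assume "A \<in> sets lborel"
  then show "set_lebesgue_integral lborel A h = 0"
    using borel0[of A] by (simp add: set_lebesgue_integral_def)
qed

text \<open>Testing with bumps gives zero integrals over all boxes whose closure lies in the domain.
  The domain is a countable union of closed boxes, so it suffices to argue within one of
  them.\<close>

theorem fundamental_lemma:
  fixes g :: "real^'d::finite \<Rightarrow> real"
  assumes op: "open \<Omega>" and int: "integrable (lebesgue_on \<Omega>) g"
    and zero: "\<And>\<phi>. \<phi> \<in> test_functions \<Omega> \<Longrightarrow> (\<integral>x. g x * \<phi> x \<partial>(lebesgue_on \<Omega>)) = 0"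
  shows "AE x in lebesgue_on \<Omega>. g x = 0"
proof -
  have \<Omega>: "\<Omega> \<in> sets lebesgue" using op by simp
  define g0 where "g0 x = indicator \<Omega> x * g x" for x
  have g0: "integrable lebesgue g0"
    using int \<Omega> by (simp add: g0_def[abs_def] integrable_restrict_space)
  have box0: "(\<integral>x. indicator (box a b) x * g0 x \<partial>lebesgue) = 0" if ab: "cbox a b \<subseteq> \<Omega>" for a b
  proof -
    have "(\<lambda>m. \<integral>x. box_bump a b m x * g0 x \<partial>lebesgue) \<longlonglongrightarrow> (\<integral>x. indicator (box a b) x * g0 x \<partial>lebesgue)"
    proof (rule integral_dominated_convergence[where w = "\<lambda>x. norm (g0 x)"])
      show "(\<lambda>x. indicator (box a b) x * g0 x) \<in> borel_measurable lebesgue"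
        using integrable_mult_indicator[of "box a b" lebesgue g0] g0 by auto
      have "continuous_on UNIV (box_bump a b m)" for m
      proof -
        have "smooth_fun (box_bump a b m)"
          using box_bump_test_function[OF ab, of m] by (simp add: test_functions_def)
        then have "\<forall>x. box_bump a b m differentiable (at x)" by (cases rule: smooth_fun.cases) auto
        then show ?thesis
          by (auto simp: continuous_on_eq_continuous_at intro: differentiable_imp_continuous_within)
      qed
      then have bm: "box_bump a b m \<in> borel_measurable lebesgue" for m
        by (intro measurable_completion) (simp add: borel_measurable_continuous_onI)
      show "(\<lambda>x. box_bump a b m x * g0 x) \<in> borel_measurable lebesgue" for m
        using bm[of m] g0 by (intro borel_measurable_times) auto
      show "integrable lebesgue (\<lambda>x. norm (g0 x))" using g0 by simp
      show "AE x in lebesgue. (\<lambda>m. box_bump a b m x * g0 x) \<longlonglongrightarrow> indicator (box a b) x * g0 x"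
        by (intro AE_I2 tendsto_mult box_bump_tendsto tendsto_const)
      show "AE x in lebesgue. norm (box_bump a b m x * g0 x) \<le> norm (g0 x)" for m
        using box_bump_bounds[of a b m] by (auto simp: abs_mult intro!: mult_left_le_one_le)
    qed
    moreover have "(\<integral>x. box_bump a b m x * g0 x \<partial>lebesgue) = 0" for m
      using zero[OF box_bump_test_function[OF ab, of m]] \<Omega>
      by (simp add: integral_restrict_space g0_def mult_ac)
    ultimately show ?thesis by (simp add: LIMSEQ_const_iff)
  qed
  \<comment> \<open>The Dynkin argument lives on Borel sets, so \<open>g0\<close> is exchanged for a
    Borel representative.\<close>
  obtain g1 where g1: "g1 \<in> borel_measurable lborel" "AE x in lebesgue. g0 x = g1 x" "integrable lborel g1"
  proof -
    have "g0 \<in> borel_measurable lebesgue" using g0 by simp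
    then obtain g1 where g1: "g1 \<in> borel_measurable lborel" "AE x in lborel. g0 x = g1 x"
      using completion_ex_borel_measurable_real by blast
    then have ae: "AE x in lebesgue. g0 x = g1 x" by (intro AE_completion)
    have "integrable lebesgue g1"
      by (rule integrable_cong_AE_imp[OF g0 measurable_completion[OF g1(1)] ae])
    then have "integrable lborel g1" using g1(1) by (simp add: integrable_completion)
    with g1(1) ae show ?thesis by (rule that)
  qed
  have cell: "AE x in lebesgue. x \<in> cbox a b \<longrightarrow> g0 x = 0" if ab: "cbox a b \<subseteq> \<Omega>" for a b
  proof -
    have "AE x in lborel. indicator (box a b) x * g1 x = 0"
    proof (rule box_integrals_zero_imp_AE_zero)
      show "integrable lborel (\<lambda>x. indicator (box a b) x * g1 x)"
        using integrable_mult_indicator[of "box a b" lborel g1] g1(3) by simp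
      fix c d :: "real^'d"
      \<comment> \<open>Intersecting with \<open>box a b\<close> yields a box again; if it is
        nonempty, its closure stays inside \<open>cbox a b\<close> and hence inside the
        domain.\<close>
      obtain a' b' where ab': "box c d \<inter> box a b = box a' b'" using box_Int_box by blast
      have "(\<integral>x. indicator (box a' b') x * g0 x \<partial>lebesgue) = 0"
      proof (cases "box a' b' = {}")
        case False
        have "box a' b' \<subseteq> cbox a b" using ab' box_subset_cbox by blast
        then have "cbox a' b' \<subseteq> cbox a b"
          using closure_box[OF False] closure_minimal[of "box a' b'" "cbox a b"] by auto
        then show ?thesis using ab by (intro box0) blast
      qed simp
      moreover have "(\<integral>x. indicator (box a' b') x * g0 x \<partial>lebesgue) = (\<integral>x. indicator (box a' b') x * g1 x \<partial>lebesgue)"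
      proof (rule integral_cong_AE)
        show "(\<lambda>x. indicator (box a' b') x * g0 x) \<in> borel_measurable lebesgue"
          using integrable_mult_indicator[of "box a' b'" lebesgue g0] g0 by auto
        show "(\<lambda>x. indicator (box a' b') x * g1 x) \<in> borel_measurable lebesgue"
          using g1(1) by (intro measurable_completion) (auto intro: borel_measurable_times)
        show "AE x in lebesgue. indicator (box a' b') x * g0 x = indicator (box a' b') x * g1 x"
          using g1(2) by eventually_elim simp
      qed
      moreover have "(\<integral>x. indicator (box a' b') x * g1 x \<partial>lebesgue) = (\<integral>x. indicator (box a' b') x * g1 x \<partial>lborel)"
        using g1(1) by (intro integral_completion) (auto intro: borel_measurable_times)
      moreover have "indicator (box a' b') x * g1 x = indicator (box c d) x * (indicator (box a b) x * g1 x)" for x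
        using ab' by (auto simp: indicator_def)
      ultimately show "(\<integral>x. indicator (box c d) x * (indicator (box a b) x * g1 x) \<partial>lborel) = 0" by simp
    qed
    then have "AE x in lebesgue. indicator (box a b) x * g1 x = 0" by (rule AE_completion)
    then have "AE x in lebesgue. indicator (box a b) x * g0 x = 0"
      using g1(2) by eventually_elim simp
    \<comment> \<open>The bumps see only the open box; its faces are a null set.\<close>
    moreover have "AE x in lebesgue. x \<notin> cbox a b - box a b"
      using negligible_frontier_interval[of a b] by (intro AE_not_in) (simp add: negligible_iff_null_sets)
    ultimately show ?thesis by eventually_elim (auto simp: indicator_def)
  qed
  obtain \<D> where \<D>: "countable \<D>" "\<D> \<subseteq> Pow \<Omega>" "\<And>X. X \<in> \<D> \<Longrightarrow> \<exists>a b. X = cbox a b" "\<Union>\<D> = \<Omega>"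
    using open_countable_Union_open_cbox[OF op] by metis
  have "AE x in lebesgue. \<forall>X\<in>\<D>. x \<in> X \<longrightarrow> g0 x = 0"
  proof (subst AE_ball_countable[OF \<D>(1)], rule ballI)
    fix X assume "X \<in> \<D>"
    then obtain a b where "X = cbox a b" "X \<subseteq> \<Omega>" using \<D> by blast
    then show "AE x in lebesgue. x \<in> X \<longrightarrow> g0 x = 0" using cell by simp
  qed
  then have "AE x in lebesgue. x \<in> \<Omega> \<longrightarrow> g x = 0"
    by eventually_elim (use \<D>(4) in \<open>auto simp: g0_def indicator_def split: if_splits\<close>)
  then show ?thesis using \<Omega> by (simp add: AE_restrict_space_iff)
qed

section \<open>Weak divergence and weak gradient\<close>

lemma L2_const:
  fixes \<Omega> :: "(real^'d::finite) set"
  assumes "open \<Omega>" "bounded \<Omega>"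
  shows "(\<lambda>x. c) \<in> L2 \<Omega>"
proof -
  have "emeasure lebesgue \<Omega> < \<infinity>" using fmeasurableD2[OF lmeasurable_open[OF assms(2,1)]] by (simp add: top.not_eq_extremum)
  then have "emeasure (lebesgue_on \<Omega>) (space (lebesgue_on \<Omega>)) < \<infinity>"
    using assms by (simp add: emeasure_restrict_space)
  then have "finite_measure (lebesgue_on \<Omega>)" by (intro finite_measureI) auto
  then show ?thesis by (simp add: L2_def finite_measure.integrable_const)
qed

lemma continuous_imp_measurable_lebesgue_on:
  fixes f :: "real^'d::finite \<Rightarrow> 'b::euclidean_space"
  assumes "continuous_on UNIV f"
  shows "f \<in> borel_measurable (lebesgue_on \<Omega>)"
  using assms by (intro measurable_restrict_space1 measurable_completion) (simp add: borel_measurable_continuous_onI)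

lemma L2_bounded:
  fixes \<Omega> :: "(real^'d::finite) set" and f :: "real^'d \<Rightarrow> 'b::euclidean_space"
  assumes "open \<Omega>" "bounded \<Omega>" "f \<in> borel_measurable (lebesgue_on \<Omega>)"
    and "AE x in lebesgue_on \<Omega>. norm (f x) \<le> C"
  shows "f \<in> L2 \<Omega>"
  by (rule L2_bound[OF L2_const[OF assms(1,2), of "1::real"] assms(3)]) (use assms(4) in simp)

lemma smooth_fun_differentiable: "smooth_fun f \<Longrightarrow> f differentiable (at x)"
  by (cases rule: smooth_fun.cases) auto

lemma smooth_fun_partial: "smooth_fun f \<Longrightarrow> smooth_fun (partial i f)"
  by (cases rule: smooth_fun.cases) auto

lemma smooth_fun_continuous: "smooth_fun f \<Longrightarrow> continuous_on S f"
  by (meson continuous_at_imp_continuous_on differentiable_imp_continuous_within smooth_fun_differentiable)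

lemma partial_eq_0_outside:
  assumes "x \<notin> closure {x. f x \<noteq> 0}"
  shows "partial i f x = 0"
proof -
  have "(f has_derivative (\<lambda>h. 0)) (at x)"
  proof (rule has_derivative_transform_within_open[OF _ _ _, of "\<lambda>x. 0"])
    show "open (- closure {x. f x \<noteq> 0})" by (simp add: open_Compl)
    show "x \<in> - closure {x. f x \<noteq> 0}" using assms by simp
    show "0 = f y" if "y \<in> - closure {x. f x \<noteq> 0}" for y
      using that closure_subset[of "{x. f x \<noteq> 0}"] by auto
  qed auto
  then show ?thesis using frechet_derivative_at[of f "\<lambda>h. 0" x] by (metis partial_def)
qed

lemma continuous_compact_support_bounded:
  fixes f :: "real^'d::finite \<Rightarrow> 'b::real_normed_vector"
  assumes "continuous_on UNIV f" "compact S" "\<And>x. x \<notin> S \<Longrightarrow> f x = 0"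
  obtains C where "C > 0" "\<And>x. norm (f x) \<le> C"
proof -
  have "compact (f ` S)" using assms(1,2) compact_continuous_image continuous_on_subset by blast
  then obtain C where C: "C > 0" "\<And>y. y \<in> f ` S \<Longrightarrow> norm y \<le> C"
    using compact_imp_bounded bounded_pos by metis
  have "norm (f x) \<le> C" for x using C assms(3)[of x] by (cases "x \<in> S") auto
  then show ?thesis using C that by blast
qed

lemma test_functionD:
  assumes "\<phi> \<in> test_functions \<Omega>"
  shows "smooth_fun \<phi>" "compact (closure {x. \<phi> x \<noteq> 0})" "closure {x. \<phi> x \<noteq> 0} \<subseteq> \<Omega>"
    "x \<notin> closure {x. \<phi> x \<noteq> 0} \<Longrightarrow> \<phi> x = 0"
  using assms closure_subset[of "{x. \<phi> x \<noteq> 0}"] by (auto simp: test_functions_def)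

lemma test_function_L2:
  assumes \<Omega>: "open \<Omega>" "bounded \<Omega>" and \<phi>: "\<phi> \<in> test_functions \<Omega>"
  shows "\<phi> \<in> L2 \<Omega>" "partial i \<phi> \<in> L2 \<Omega>"
proof -
  note t = test_functionD[OF \<phi>]
  have *: "f \<in> L2 \<Omega>" if c: "continuous_on UNIV f" and z: "\<And>x. x \<notin> closure {x. \<phi> x \<noteq> 0} \<Longrightarrow> f x = 0" for f :: "real^'a \<Rightarrow> real"
  proof -
    obtain C where "\<And>x. norm (f x) \<le> C" using continuous_compact_support_bounded[OF c t(2) z] by blast
    then show ?thesis using c by (intro L2_bounded[OF \<Omega>, where C = C] continuous_imp_measurable_lebesgue_on) auto
  qed
  show "\<phi> \<in> L2 \<Omega>" by (rule *[OF smooth_fun_continuous[OF t(1)] t(4)])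
  show "partial i \<phi> \<in> L2 \<Omega>"
    by (rule *[OF smooth_fun_continuous[OF smooth_fun_partial[OF t(1)]] partial_eq_0_outside])
qed

lemma borel_measurable_axis:
  fixes f :: "'a \<Rightarrow> 'b::euclidean_space"
  assumes "f \<in> borel_measurable N"
  shows "(\<lambda>x. axis i (f x) :: 'b^'n::finite) \<in> borel_measurable N"
proof (rule borel_measurable_continuous_on[OF _ assms])
  have "continuous_on UNIV (\<lambda>y::'b. if k = i then y else 0)" for k by (cases "k = i") (auto intro: continuous_intros)
  then show "continuous_on UNIV (axis i :: 'b \<Rightarrow> 'b^'n)"
    unfolding axis_def by (intro continuous_on_vec_lambda)
qed

lemma L2_vec_components:
  fixes f :: "real^'d::finite \<Rightarrow> 'b::euclidean_space^'n::finite"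
  assumes "\<And>i. (\<lambda>x. f x $ i) \<in> L2 \<Omega>"
  shows "f \<in> L2 \<Omega>"
proof -
  have "(\<lambda>x. \<Sum>i\<in>UNIV. axis i (f x $ i) :: 'b^'n) \<in> L2 \<Omega>"
  proof (rule L2_sum)
    fix i show "(\<lambda>x. axis i (f x $ i) :: 'b^'n) \<in> L2 \<Omega>"
      by (rule L2_bound[OF assms[of i], where C = 1])
         (use assms[of i] in \<open>auto simp: L2_def norm_eq_sqrt_inner inner_axis_axis intro!: borel_measurable_axis\<close>)
  qed
  moreover have "(\<Sum>i\<in>UNIV. axis i (f x $ i)) = f x" for x
    by (simp add: vec_eq_iff axis_def if_distrib cong: if_cong)
  ultimately show ?thesis by simp
qed

lemma norm_matrix_entry_le:
  fixes A :: "real^'n::finite^'m::finite"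
  shows "norm (A $ i $ j) \<le> norm A"
  by (rule order_trans[OF Finite_Cartesian_Product.norm_nth_le Finite_Cartesian_Product.norm_nth_le])

definition grad :: "(real^'d::finite \<Rightarrow> real) \<Rightarrow> real^'d \<Rightarrow> real^'d" where
  "grad \<phi> x = (\<chi> i. partial i \<phi> x)"

text \<open>Rewritten as inner products with fixed fields, the weak identity is open to the inner
  product lemmas: congruence, linearity and uniqueness all follow from them.\<close>

lemma has_weak_div_alt:
  "has_weak_div \<Omega> v g \<longleftrightarrow> (\<forall>\<phi>\<in>test_functions \<Omega>. l2_inner \<Omega> v (grad \<phi>) = - l2_inner \<Omega> g \<phi>)"
  by (simp add: has_weak_div_def l2_inner_def grad_def inner_vec_def)

lemma has_weak_grad_alt:
  "has_weak_grad \<Omega> u G \<longleftrightarrow> (\<forall>\<phi>\<in>test_functions \<Omega>. \<forall>i j.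
     l2_inner \<Omega> u (\<lambda>x. partial j \<phi> x *\<^sub>R axis i 1) = - l2_inner \<Omega> G (\<lambda>x. \<phi> x *\<^sub>R axis i (axis j 1)))"
  by (simp add: has_weak_grad_def l2_inner_def inner_axis mult.commute)

text \<open>Openness serves the fundamental lemma; boundedness makes square-integrable functions
  integrable and bounded measurable functions square-integrable.\<close>

locale bounded_open =
  fixes \<Omega> :: "(real^'d::finite) set"
  assumes open_\<Omega>: "open \<Omega>" and bounded_\<Omega>: "bounded \<Omega>"
begin

lemma sets_\<Omega> [simp]: "\<Omega> \<in> sets lebesgue" using open_\<Omega> by simp

lemma test_L2:
  assumes "\<phi> \<in> test_functions \<Omega>"
  shows "\<phi> \<in> L2 \<Omega>" "grad \<phi> \<in> L2 \<Omega>"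
    "(\<lambda>x. partial j \<phi> x *\<^sub>R (axis i 1 :: real^'d)) \<in> L2 \<Omega>"
    "(\<lambda>x. \<phi> x *\<^sub>R (axis i (axis j 1) :: real^'d^'d)) \<in> L2 \<Omega>"
proof -
  note t = test_function_L2[OF open_\<Omega> bounded_\<Omega> assms]
  show "\<phi> \<in> L2 \<Omega>" by (rule t)
  show "grad \<phi> \<in> L2 \<Omega>" by (rule L2_vec_components) (simp add: grad_def t)
  show "(\<lambda>x. partial j \<phi> x *\<^sub>R (axis i 1 :: real^'d)) \<in> L2 \<Omega>"
    by (rule L2_bound[OF t(2)[of j], where C = 1])
       (use t(2)[of j] in \<open>auto simp: L2_def intro!: borel_measurable_scaleR\<close>)
  show "(\<lambda>x. \<phi> x *\<^sub>R (axis i (axis j 1) :: real^'d^'d)) \<in> L2 \<Omega>"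
    by (rule L2_bound[OF t(1), where C = 1])
       (use t(1) in \<open>auto simp: L2_def intro!: borel_measurable_scaleR\<close>)
qed

lemma L2_orthogonal_test_functions:
  assumes g: "g \<in> L2 \<Omega>" and 0: "\<And>\<phi>. \<phi> \<in> test_functions \<Omega> \<Longrightarrow> l2_inner \<Omega> g \<phi> = 0"
  shows "eq_ae \<Omega> g (\<lambda>x. 0)"
  unfolding eq_ae_def
proof (rule fundamental_lemma[OF open_\<Omega>])
  show "integrable (lebesgue_on \<Omega>) g"
    using L2_integrable_inner[OF g L2_const[OF open_\<Omega> bounded_\<Omega>, of 1]] by simp
  show "(\<integral>x. g x * \<phi> x \<partial>(lebesgue_on \<Omega>)) = 0" if "\<phi> \<in> test_functions \<Omega>" for \<phi>
    using 0[OF that] by (simp add: l2_inner_def)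
qed

lemma has_weak_div_unique:
  assumes "g \<in> L2 \<Omega>" "h \<in> L2 \<Omega>" "has_weak_div \<Omega> v g" "has_weak_div \<Omega> v h"
  shows "eq_ae \<Omega> g h"
proof -
  have "eq_ae \<Omega> (\<lambda>x. g x - h x) (\<lambda>x. 0)"
  proof (rule L2_orthogonal_test_functions)
    show "(\<lambda>x. g x - h x) \<in> L2 \<Omega>" using assms by (intro L2_diff)
    fix \<phi> assume \<phi>: "\<phi> \<in> test_functions \<Omega>"
    have "l2_inner \<Omega> v (grad \<phi>) = - l2_inner \<Omega> g \<phi>" "l2_inner \<Omega> v (grad \<phi>) = - l2_inner \<Omega> h \<phi>"
      using assms \<phi> by (auto simp: has_weak_div_alt)
    then show "l2_inner \<Omega> (\<lambda>x. g x - h x) \<phi> = 0"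
      using assms test_L2(1)[OF \<phi>] by (simp add: l2_inner_diff_left)
  qed
  then show ?thesis by (simp add: eq_ae_def)
qed

text \<open>Each entry of the difference is orthogonal to all test functions, and the exceptional
  null sets of the finitely many entries can be united.\<close>

lemma has_weak_grad_unique:
  assumes "G \<in> L2 \<Omega>" "H \<in> L2 \<Omega>" "has_weak_grad \<Omega> u G" "has_weak_grad \<Omega> u H"
  shows "eq_ae \<Omega> G H"
proof -
  have comp: "l2_inner \<Omega> (\<lambda>x. G x - H x) (\<lambda>x. \<phi> x *\<^sub>R axis i (axis j 1)) = 0" if \<phi>: "\<phi> \<in> test_functions \<Omega>" for \<phi> i j
  proof -
    have "l2_inner \<Omega> u (\<lambda>x. partial j \<phi> x *\<^sub>R axis i 1) = - l2_inner \<Omega> G (\<lambda>x. \<phi> x *\<^sub>R axis i (axis j 1))"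
      "l2_inner \<Omega> u (\<lambda>x. partial j \<phi> x *\<^sub>R axis i 1) = - l2_inner \<Omega> H (\<lambda>x. \<phi> x *\<^sub>R axis i (axis j 1))"
      using assms \<phi> by (auto simp: has_weak_grad_alt)
    then show ?thesis
      using assms test_L2(4)[OF \<phi>] by (simp add: l2_inner_diff_left)
  qed
  have "eq_ae \<Omega> (\<lambda>x. (G x - H x) $ i $ j) (\<lambda>x. 0)" for i j
  proof (rule L2_orthogonal_test_functions)
    have GH: "(\<lambda>x. G x - H x) \<in> L2 \<Omega>" using assms by (intro L2_diff)
    have m: "(\<lambda>x. (G x - H x) $ i $ j) \<in> borel_measurable (lebesgue_on \<Omega>)"
      using GH by (intro borel_measurable_vec_nth) (simp add: L2_def)
    have "norm ((G x - H x) $ i $ j) \<le> 1 * norm (G x - H x)" for x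
      using norm_matrix_entry_le[of "G x - H x" i j] by simp
    then show "(\<lambda>x. (G x - H x) $ i $ j) \<in> L2 \<Omega>"
      by (intro L2_bound[OF GH m, where C = 1] AE_I2)
    show "l2_inner \<Omega> (\<lambda>x. (G x - H x) $ i $ j) \<phi> = 0" if "\<phi> \<in> test_functions \<Omega>" for \<phi>
      using comp[OF that, of i j] by (simp add: l2_inner_def inner_axis mult.commute)
  qed
  then have "AE x in lebesgue_on \<Omega>. \<forall>i j. (G x - H x) $ i $ j = 0"
    by (simp add: eq_ae_def AE_all_countable)
  then show ?thesis unfolding eq_ae_def by eventually_elim (simp add: vec_eq_iff)
qed

lemma has_weak_div_lincomb:
  assumes "\<And>j. j \<in> J \<Longrightarrow> v j \<in> L2 \<Omega> \<and> g j \<in> L2 \<Omega> \<and> has_weak_div \<Omega> (v j) (g j)"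
  shows "has_weak_div \<Omega> (\<lambda>x. \<Sum>j\<in>J. c j *\<^sub>R v j x) (\<lambda>x. \<Sum>j\<in>J. c j *\<^sub>R g j x)"
  unfolding has_weak_div_alt
proof (rule ballI)
  fix \<phi> assume \<phi>: "\<phi> \<in> test_functions \<Omega>"
  have "l2_inner \<Omega> (\<lambda>x. \<Sum>j\<in>J. c j *\<^sub>R v j x) (grad \<phi>) = (\<Sum>j\<in>J. c j * l2_inner \<Omega> (v j) (grad \<phi>))"
    using assms test_L2(2)[OF \<phi>] by (intro l2_inner_lincomb_left) auto
  also have "\<dots> = (\<Sum>j\<in>J. c j * (- l2_inner \<Omega> (g j) \<phi>))"
    using assms \<phi> by (intro sum.cong refl) (auto simp: has_weak_div_alt)
  also have "\<dots> = - (\<Sum>j\<in>J. c j * l2_inner \<Omega> (g j) \<phi>)" by (simp add: sum_negf)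
  also have "(\<Sum>j\<in>J. c j * l2_inner \<Omega> (g j) \<phi>) = l2_inner \<Omega> (\<lambda>x. \<Sum>j\<in>J. c j *\<^sub>R g j x) \<phi>"
    using assms test_L2(1)[OF \<phi>] by (intro l2_inner_lincomb_left[symmetric]) auto
  finally show "l2_inner \<Omega> (\<lambda>x. \<Sum>j\<in>J. c j *\<^sub>R v j x) (grad \<phi>) = - l2_inner \<Omega> (\<lambda>x. \<Sum>j\<in>J. c j *\<^sub>R g j x) \<phi>" .
qed

lemma has_weak_grad_lincomb:
  assumes "\<And>j. j \<in> J \<Longrightarrow> u j \<in> L2 \<Omega> \<and> G j \<in> L2 \<Omega> \<and> has_weak_grad \<Omega> (u j) (G j)"
  shows "has_weak_grad \<Omega> (\<lambda>x. \<Sum>j\<in>J. c j *\<^sub>R u j x) (\<lambda>x. \<Sum>j\<in>J. c j *\<^sub>R G j x)"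
  unfolding has_weak_grad_alt
proof (intro ballI allI)
  fix \<phi> i k assume \<phi>: "\<phi> \<in> test_functions \<Omega>"
  let ?p = "\<lambda>x. partial k \<phi> x *\<^sub>R (axis i 1 :: real^'d)"
  let ?q = "\<lambda>x. \<phi> x *\<^sub>R (axis i (axis k 1) :: real^'d^'d)"
  have "l2_inner \<Omega> (\<lambda>x. \<Sum>j\<in>J. c j *\<^sub>R u j x) ?p = (\<Sum>j\<in>J. c j * l2_inner \<Omega> (u j) ?p)"
    using assms test_L2(3)[OF \<phi>] by (intro l2_inner_lincomb_left) auto
  also have "\<dots> = (\<Sum>j\<in>J. c j * (- l2_inner \<Omega> (G j) ?q))"
    using assms \<phi> by (intro sum.cong refl) (auto simp: has_weak_grad_alt)
  also have "\<dots> = - (\<Sum>j\<in>J. c j * l2_inner \<Omega> (G j) ?q)" by (simp add: sum_negf)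
  also have "(\<Sum>j\<in>J. c j * l2_inner \<Omega> (G j) ?q) = l2_inner \<Omega> (\<lambda>x. \<Sum>j\<in>J. c j *\<^sub>R G j x) ?q"
    using assms test_L2(4)[OF \<phi>] by (intro l2_inner_lincomb_left[symmetric]) auto
  finally show "l2_inner \<Omega> (\<lambda>x. \<Sum>j\<in>J. c j *\<^sub>R u j x) ?p = - l2_inner \<Omega> (\<lambda>x. \<Sum>j\<in>J. c j *\<^sub>R G j x) ?q" .
qed

lemma wdiv_Hdiv:
  assumes "v \<in> Hdiv \<Omega>"
  shows "wdiv \<Omega> v \<in> L2 \<Omega>" "has_weak_div \<Omega> v (wdiv \<Omega> v)"
proof -
  have "\<exists>g. g \<in> L2 \<Omega> \<and> has_weak_div \<Omega> v g" using assms by (auto simp: Hdiv_def)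
  then have "wdiv \<Omega> v \<in> L2 \<Omega> \<and> has_weak_div \<Omega> v (wdiv \<Omega> v)" unfolding wdiv_def by (rule someI_ex)
  then show "wdiv \<Omega> v \<in> L2 \<Omega>" "has_weak_div \<Omega> v (wdiv \<Omega> v)" by auto
qed

lemma wgrad_H1:
  assumes "u \<in> H1 \<Omega>"
  shows "wgrad \<Omega> u \<in> L2 \<Omega>" "has_weak_grad \<Omega> u (wgrad \<Omega> u)"
proof -
  have "\<exists>g. g \<in> L2 \<Omega> \<and> has_weak_grad \<Omega> u g" using assms by (auto simp: H1_def)
  then have "wgrad \<Omega> u \<in> L2 \<Omega> \<and> has_weak_grad \<Omega> u (wgrad \<Omega> u)" unfolding wgrad_def by (rule someI_ex)
  then show "wgrad \<Omega> u \<in> L2 \<Omega>" "has_weak_grad \<Omega> u (wgrad \<Omega> u)" by auto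
qed

lemma Hdiv_L2: "v \<in> Hdiv \<Omega> \<Longrightarrow> v \<in> L2 \<Omega>" by (simp add: Hdiv_def)
lemma H1_L2: "v \<in> H1 \<Omega> \<Longrightarrow> v \<in> L2 \<Omega>" by (simp add: H1_def)

text \<open>\<open>wdiv\<close> picks an arbitrary representative, so it is linear only modulo null
  sets. The combination of the divergences is a second candidate for the divergence of the
  combination, and uniqueness identifies the two.\<close>

lemma Hdiv_lincomb:
  assumes "\<And>j. j \<in> J \<Longrightarrow> v j \<in> Hdiv \<Omega>"
  shows "(\<lambda>x. \<Sum>j\<in>J. c j *\<^sub>R v j x) \<in> Hdiv \<Omega>"
    and "eq_ae \<Omega> (wdiv \<Omega> (\<lambda>x. \<Sum>j\<in>J. c j *\<^sub>R v j x)) (\<lambda>x. \<Sum>j\<in>J. c j *\<^sub>R wdiv \<Omega> (v j) x)"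
proof -
  have d: "has_weak_div \<Omega> (\<lambda>x. \<Sum>j\<in>J. c j *\<^sub>R v j x) (\<lambda>x. \<Sum>j\<in>J. c j *\<^sub>R wdiv \<Omega> (v j) x)"
    using assms by (intro has_weak_div_lincomb) (auto simp: wdiv_Hdiv Hdiv_L2)
  have L: "(\<lambda>x. \<Sum>j\<in>J. c j *\<^sub>R wdiv \<Omega> (v j) x) \<in> L2 \<Omega>"
    using assms by (intro L2_lincomb) (auto simp: wdiv_Hdiv)
  have "(\<lambda>x. \<Sum>j\<in>J. c j *\<^sub>R v j x) \<in> L2 \<Omega>" using assms by (intro L2_lincomb) (auto simp: Hdiv_L2)
  then show H: "(\<lambda>x. \<Sum>j\<in>J. c j *\<^sub>R v j x) \<in> Hdiv \<Omega>" using d L by (auto simp: Hdiv_def)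
  show "eq_ae \<Omega> (wdiv \<Omega> (\<lambda>x. \<Sum>j\<in>J. c j *\<^sub>R v j x)) (\<lambda>x. \<Sum>j\<in>J. c j *\<^sub>R wdiv \<Omega> (v j) x)"
    by (rule has_weak_div_unique[OF wdiv_Hdiv(1)[OF H] L wdiv_Hdiv(2)[OF H] d])
qed

lemma H1_lincomb:
  assumes "\<And>j. j \<in> J \<Longrightarrow> u j \<in> H1 \<Omega>"
  shows "(\<lambda>x. \<Sum>j\<in>J. c j *\<^sub>R u j x) \<in> H1 \<Omega>"
    and "eq_ae \<Omega> (wgrad \<Omega> (\<lambda>x. \<Sum>j\<in>J. c j *\<^sub>R u j x)) (\<lambda>x. \<Sum>j\<in>J. c j *\<^sub>R wgrad \<Omega> (u j) x)"
proof -
  have d: "has_weak_grad \<Omega> (\<lambda>x. \<Sum>j\<in>J. c j *\<^sub>R u j x) (\<lambda>x. \<Sum>j\<in>J. c j *\<^sub>R wgrad \<Omega> (u j) x)"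
    using assms by (intro has_weak_grad_lincomb) (auto simp: wgrad_H1 H1_L2)
  have L: "(\<lambda>x. \<Sum>j\<in>J. c j *\<^sub>R wgrad \<Omega> (u j) x) \<in> L2 \<Omega>"
    using assms by (intro L2_lincomb) (auto simp: wgrad_H1)
  have "(\<lambda>x. \<Sum>j\<in>J. c j *\<^sub>R u j x) \<in> L2 \<Omega>" using assms by (intro L2_lincomb) (auto simp: H1_L2)
  then show H: "(\<lambda>x. \<Sum>j\<in>J. c j *\<^sub>R u j x) \<in> H1 \<Omega>" using d L by (auto simp: H1_def)
  show "eq_ae \<Omega> (wgrad \<Omega> (\<lambda>x. \<Sum>j\<in>J. c j *\<^sub>R u j x)) (\<lambda>x. \<Sum>j\<in>J. c j *\<^sub>R wgrad \<Omega> (u j) x)"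
    by (rule has_weak_grad_unique[OF wgrad_H1(1)[OF H] L wgrad_H1(2)[OF H] d])
qed

text \<open>A true equality and not only one almost everywhere: the property from which the
  representative is chosen is the same for both arguments.\<close>

lemma wdiv_cong:
  assumes "eq_ae \<Omega> v v'"
  shows "wdiv \<Omega> v = wdiv \<Omega> v'"
proof -
  have "has_weak_div \<Omega> v g = has_weak_div \<Omega> v' g" for g
    unfolding has_weak_div_alt using l2_inner_cong[OF sets_\<Omega> assms eq_ae_refl] by simp
  then show ?thesis by (simp add: wdiv_def)
qed

lemma wgrad_cong:
  assumes "eq_ae \<Omega> u u'"
  shows "wgrad \<Omega> u = wgrad \<Omega> u'"
proof -
  have "has_weak_grad \<Omega> u g = has_weak_grad \<Omega> u' g" for g
    unfolding has_weak_grad_alt using l2_inner_cong[OF sets_\<Omega> assms eq_ae_refl] by simp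
  then show ?thesis by (simp add: wgrad_def)
qed

lemma strain_cong: "eq_ae \<Omega> u u' \<Longrightarrow> strain \<Omega> u = strain \<Omega> u'"
  using wgrad_cong by (auto simp: strain_def)

lemma h1_norm_cong: "eq_ae \<Omega> u u' \<Longrightarrow> h1_norm \<Omega> u = h1_norm \<Omega> u'"
  by (simp add: h1_norm_def wgrad_cong l2_norm_cong)

lemma hdiv_norm_cong: "eq_ae \<Omega> u u' \<Longrightarrow> hdiv_norm \<Omega> u = hdiv_norm \<Omega> u'"
  by (simp add: hdiv_norm_def wdiv_cong l2_norm_cong)

text \<open>Makes \<open>wdiv\<close> meaningful on displacements: they are shown to lie in
  \<open>H1\<close>, and the trace of a weak gradient is a weak divergence.\<close>

lemma has_weak_div_trace:
  assumes u: "u \<in> L2 \<Omega>" and G: "G \<in> L2 \<Omega>" "has_weak_grad \<Omega> u G"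
  shows "(\<lambda>x. trace (G x)) \<in> L2 \<Omega>" "has_weak_div \<Omega> u (\<lambda>x. trace (G x))"
proof -
  have Gii: "(\<lambda>x. G x $ i $ i) \<in> L2 \<Omega>" for i
  proof (rule L2_bound[OF G(1), where C = 1])
    show "(\<lambda>x. G x $ i $ i) \<in> borel_measurable (lebesgue_on \<Omega>)"
      using G by (intro borel_measurable_vec_nth) (simp add: L2_def)
    have "norm (G x $ i $ i) \<le> 1 * norm (G x)" for x
      using norm_matrix_entry_le[of "G x" i i] by simp
    then show "AE x in lebesgue_on \<Omega>. norm (G x $ i $ i) \<le> 1 * norm (G x)" by (intro AE_I2)
  qed
  show "(\<lambda>x. trace (G x)) \<in> L2 \<Omega>" unfolding trace_def by (intro L2_sum Gii)
  show "has_weak_div \<Omega> u (\<lambda>x. trace (G x))"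
    unfolding has_weak_div_def
  proof (rule ballI)
    fix \<phi> assume \<phi>: "\<phi> \<in> test_functions \<Omega>"
    have "integrable (lebesgue_on \<Omega>) (\<lambda>x. u x $ i * partial i \<phi> x)" for i
      using L2_integrable_inner[OF u test_L2(3)[OF \<phi>, of i i]] by (simp add: inner_axis mult.commute)
    then have "(\<integral>x. (\<Sum>i\<in>UNIV. u x $ i * partial i \<phi> x) \<partial>(lebesgue_on \<Omega>))
      = (\<Sum>i\<in>UNIV. \<integral>x. u x $ i * partial i \<phi> x \<partial>(lebesgue_on \<Omega>))"
      by simp
    also have "\<dots> = (\<Sum>i\<in>UNIV. - (\<integral>x. G x $ i $ i * \<phi> x \<partial>(lebesgue_on \<Omega>)))"
      using G(2) \<phi> by (simp add: has_weak_grad_def)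
    also have "\<dots> = - (\<integral>x. (\<Sum>i\<in>UNIV. G x $ i $ i * \<phi> x) \<partial>(lebesgue_on \<Omega>))"
      using L2_integrable_inner[OF Gii test_L2(1)[OF \<phi>]] by (simp add: sum_negf)
    finally show "(\<integral>x. (\<Sum>i\<in>UNIV. u x $ i * partial i \<phi> x) \<partial>(lebesgue_on \<Omega>))
        = - (\<integral>x. trace (G x) * \<phi> x \<partial>(lebesgue_on \<Omega>))"
      by (simp add: trace_def sum_distrib_right)
  qed
qed

lemma H1_Hdiv: "u \<in> H1 \<Omega> \<Longrightarrow> u \<in> Hdiv \<Omega>"
  using has_weak_div_trace by (force simp: H1_def Hdiv_def)

lemma L2_transpose:
  fixes G :: "real^'d \<Rightarrow> real^'d^'d"
  assumes "G \<in> L2 \<Omega>"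
  shows "(\<lambda>x. transpose (G x)) \<in> L2 \<Omega>"
proof (rule L2_bound[OF assms, where C = 1])
  have "continuous_on UNIV (transpose :: real^'d^'d \<Rightarrow> real^'d^'d)"
    unfolding transpose_def by (intro continuous_intros)
  then show "(\<lambda>x. transpose (G x)) \<in> borel_measurable (lebesgue_on \<Omega>)"
    using assms by (intro borel_measurable_continuous_on[where f = transpose]) (auto simp: L2_def)
  have "norm (transpose A) = norm A" for A :: "real^'d^'d"
  proof -
    have "(\<Sum>i\<in>UNIV. \<Sum>j\<in>UNIV. (A $ j $ i)\<^sup>2) = (\<Sum>i\<in>UNIV. \<Sum>j\<in>UNIV. (A $ i $ j)\<^sup>2)"
      by (rule sum.swap)
    then show ?thesis
      by (simp add: norm_eq_sqrt_inner inner_vec_def transpose_def power2_eq_square)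
  qed
  then show "AE x in lebesgue_on \<Omega>. norm (transpose (G x)) \<le> 1 * norm (G x)" by simp
qed

lemma strain_L2: "u \<in> H1 \<Omega> \<Longrightarrow> strain \<Omega> u \<in> L2 \<Omega>"
  unfolding strain_def[abs_def] by (intro L2_scale L2_add L2_transpose wgrad_H1)

lemma strain_lincomb:
  assumes "\<And>j. j \<in> J \<Longrightarrow> u j \<in> H1 \<Omega>"
  shows "eq_ae \<Omega> (strain \<Omega> (\<lambda>x. \<Sum>j\<in>J. c j *\<^sub>R u j x)) (\<lambda>x. \<Sum>j\<in>J. c j *\<^sub>R strain \<Omega> (u j) x)"
proof -
  have "eq_ae \<Omega> (wgrad \<Omega> (\<lambda>x. \<Sum>j\<in>J. c j *\<^sub>R u j x)) (\<lambda>x. \<Sum>j\<in>J. c j *\<^sub>R wgrad \<Omega> (u j) x)"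
    by (rule H1_lincomb(2)) (rule assms)
  then show ?thesis unfolding eq_ae_def
  proof eventually_elim
  case (elim x)
  have "transpose (\<Sum>j\<in>J. c j *\<^sub>R wgrad \<Omega> (u j) x) = (\<Sum>j\<in>J. c j *\<^sub>R transpose (wgrad \<Omega> (u j) x))"
    by (simp add: transpose_def vec_eq_iff)
  then show ?case
    by (simp add: strain_def elim scaleR_sum_right sum.distrib scaleR_add_right mult.commute)
  qed
qed

end

section \<open>Lipschitz functions with compact support\<close>

definition lipc :: "(real^'d::finite \<Rightarrow> real) \<Rightarrow> bool" where
  "lipc f \<longleftrightarrow> (\<exists>L\<ge>0. \<forall>x y. \<bar>f x - f y\<bar> \<le> L * norm (x - y)) \<and> (\<exists>R>0. \<forall>x. norm x > R \<longrightarrow> f x = 0)"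

lemma lipcE:
  assumes "lipc f"
  obtains L R C where "L \<ge> 0" "\<And>x y. \<bar>f x - f y\<bar> \<le> L * norm (x - y)" "R > 0" "\<And>x. norm x > R \<Longrightarrow> f x = 0"
    "C \<ge> 0" "\<And>x. \<bar>f x\<bar> \<le> C"
proof -
  from assms obtain L R where L: "L \<ge> 0" "\<And>x y. \<bar>f x - f y\<bar> \<le> L * norm (x - y)" and R: "R > 0" "\<And>x. norm x > R \<Longrightarrow> f x = 0"
    by (auto simp: lipc_def)
  have "\<bar>f x\<bar> \<le> \<bar>f 0\<bar> + L * R" for x
  proof (cases "norm x > R")
    case True
    then show ?thesis using R L by simp
  next
    case False
    have "\<bar>f x - f 0\<bar> \<le> L * norm x" using L(2)[of x 0] by simp
    also have "\<dots> \<le> L * R" using False L by (intro mult_left_mono) auto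
    finally show ?thesis by linarith
  qed
  then show ?thesis using that[OF L R, of "\<bar>f 0\<bar> + L * R"] L R by auto
qed

lemma lipc_bounds:
  assumes "lipc f"
  obtains R C where "\<And>x. norm x > R \<Longrightarrow> f x = 0" "C \<ge> 0" "\<And>x. \<bar>f x\<bar> \<le> C"
  by (rule lipcE[OF assms]) (rule that)

lemma lipc_continuous: "lipc f \<Longrightarrow> continuous_on S f"
proof -
  assume "lipc f"
  then obtain L where "L \<ge> 0" "\<And>x y. \<bar>f x - f y\<bar> \<le> L * norm (x - y)" by (rule lipcE) blast
  then have "L-lipschitz_on S f" by (auto simp: lipschitz_on_def dist_norm)
  then show ?thesis by (rule lipschitz_on_continuous_on)
qed

text \<open>\<open>g\<close> may be unbounded, as the coordinate function in the Poincare estimate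
  is: only its values on the ball that carries \<open>f\<close> matter. With one point in that ball,
  split into (g x - g y) f x + g y (f x - f y); two points outside contribute nothing.\<close>

lemma lipc_mult:
  assumes f: "lipc f" and g: "M \<ge> 0" "\<And>x y. \<bar>g x - g y\<bar> \<le> M * norm (x - y)"
  shows "lipc (\<lambda>x. g x * f x)"
proof -
  from f obtain L R C where L: "L \<ge> 0" "\<And>x y. \<bar>f x - f y\<bar> \<le> L * norm (x - y)"
    and R: "R > 0" "\<And>x. norm x > R \<Longrightarrow> f x = 0" and C: "C \<ge> 0" "\<And>x. \<bar>f x\<bar> \<le> C"
    by (rule lipcE) blast
  define D where "D = \<bar>g 0\<bar> + M * R"
  have D: "D \<ge> 0" using g R by (simp add: D_def)
  have gD: "\<bar>g x\<bar> \<le> D" if "norm x \<le> R" for x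
  proof -
    have "\<bar>g x - g 0\<bar> \<le> M * norm x" using g(2)[of x 0] by simp
    also have "\<dots> \<le> M * R" using that g by (intro mult_left_mono) auto
    finally show ?thesis by (simp add: D_def)
  qed
  have main: "\<bar>g x * f x - g y * f y\<bar> \<le> (M * C + D * L) * norm (x - y)" if "norm y \<le> R" for x y
  proof -
    have "g x * f x - g y * f y = (g x - g y) * f x + g y * (f x - f y)" by (simp add: algebra_simps)
    then have "\<bar>g x * f x - g y * f y\<bar> \<le> \<bar>g x - g y\<bar> * \<bar>f x\<bar> + \<bar>g y\<bar> * \<bar>f x - f y\<bar>"
      by (metis abs_mult abs_triangle_ineq)
    also have "\<dots> \<le> (M * norm (x - y)) * C + D * (L * norm (x - y))"
      using g C D L gD[OF that] by (intro add_mono mult_mono) auto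
    finally show ?thesis by (simp add: algebra_simps)
  qed
  have "\<bar>g x * f x - g y * f y\<bar> \<le> (M * C + D * L) * norm (x - y)" for x y
  proof -
    consider "norm y \<le> R" | "norm x \<le> R" | "norm x > R" "norm y > R" by linarith
    then show ?thesis
    proof cases
      case 1
      then show ?thesis by (rule main)
    next
      case 2
      then show ?thesis using main[of x y] by (simp add: abs_minus_commute norm_minus_commute)
    next
      case 3
      then show ?thesis using R g C D L by simp
    qed
  qed
  moreover have "M * C + D * L \<ge> 0" using g C D L by simp
  ultimately show ?thesis using R unfolding lipc_def by (metis mult_zero_right)
qed

lemma lipc_mult_lipc: "lipc f \<Longrightarrow> lipc g \<Longrightarrow> lipc (\<lambda>x. g x * f x)"
  by (metis lipcE lipc_mult)

text \<open>The partial derivatives are continuous and vanish off the support, hence bounded; their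
  bounds add up to a Lipschitz constant.\<close>

lemma lipc_smooth_compact_support:
  fixes \<phi> :: "real^'d::finite \<Rightarrow> real"
  assumes sm: "smooth_fun \<phi>" and cs: "compact (closure {x. \<phi> x \<noteq> 0})"
  shows "lipc \<phi>"
proof -
  have "\<exists>C>0. \<forall>x. norm (partial i \<phi> x) \<le> C" for i
    using continuous_compact_support_bounded[OF smooth_fun_continuous[OF smooth_fun_partial[OF sm]] cs partial_eq_0_outside]
    by metis
  then obtain C where C: "\<And>i. C i > 0" "\<And>i x. norm (partial i \<phi> x) \<le> C i" by metis
  have der: "(\<phi> has_derivative frechet_derivative \<phi> (at x)) (at x)" for x
    using smooth_fun_differentiable[OF sm] by (simp add: frechet_derivative_works)
  have on: "onorm (frechet_derivative \<phi> (at x)) \<le> (\<Sum>i\<in>UNIV. C i)" for x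
  proof (rule onorm_le)
    fix h :: "real^'d"
    interpret bounded_linear "frechet_derivative \<phi> (at x)" using der by (rule has_derivative_bounded_linear)
    have "frechet_derivative \<phi> (at x) h = frechet_derivative \<phi> (at x) (\<Sum>i\<in>UNIV. h $ i *\<^sub>R axis i 1)"
      using basis_expansion[of h] by (simp add: scalar_mult_eq_scaleR)
    also have "\<dots> = (\<Sum>i\<in>UNIV. h $ i * partial i \<phi> x)" by (simp add: sum scaleR partial_def)
    finally have "norm (frechet_derivative \<phi> (at x) h) \<le> (\<Sum>i\<in>UNIV. norm (h $ i * partial i \<phi> x))"
      by (simp add: norm_sum)
    also have "\<dots> \<le> (\<Sum>i\<in>UNIV. C i * norm h)"
    proof (rule sum_mono)
      fix i
      have "norm (h $ i) * norm (partial i \<phi> x) \<le> norm h * C i"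
        using C by (intro mult_mono Finite_Cartesian_Product.norm_nth_le) auto
      then show "norm (h $ i * partial i \<phi> x) \<le> C i * norm h" by (simp add: abs_mult mult.commute)
    qed
    finally show "norm (frechet_derivative \<phi> (at x) h) \<le> (\<Sum>i\<in>UNIV. C i) * norm h" by (simp add: sum_distrib_right)
  qed
  have "\<bar>\<phi> x - \<phi> y\<bar> \<le> (\<Sum>i\<in>UNIV. C i) * norm (x - y)" for x y
    using differentiable_bound[of UNIV \<phi> "\<lambda>x. frechet_derivative \<phi> (at x)", OF _ _ on] der by auto
  moreover have "(\<Sum>i\<in>UNIV. C i) \<ge> 0" using C(1) by (intro sum_nonneg) (simp add: less_imp_le)
  moreover obtain R where "R > 0" "\<And>x. x \<in> closure {x. \<phi> x \<noteq> 0} \<Longrightarrow> norm x \<le> R"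
    using compact_imp_bounded[OF cs] bounded_pos by metis
  then have "\<exists>R>0. \<forall>x. norm x > R \<longrightarrow> \<phi> x = 0"
    using closure_subset[of "{x. \<phi> x \<noteq> 0}"] by (intro exI[of _ R]) fastforce
  ultimately show ?thesis unfolding lipc_def by blast
qed

lemma bounded_support_integrable:
  fixes f :: "real^'d::finite \<Rightarrow> real"
  assumes "f \<in> borel_measurable lebesgue" "AE x in lebesgue. \<bar>f x\<bar> \<le> C" "AE x in lebesgue. norm x > R \<longrightarrow> f x = 0"
  shows "integrable lebesgue f"
proof (rule Bochner_Integration.integrable_bound)
  show "integrable lebesgue (\<lambda>x. C * indicator (cball 0 R) x :: real)" using lmeasurable_cball lmeasurable_iff_integrable by (blast intro: integrable_mult_right)
  show "AE x in lebesgue. norm (f x) \<le> norm (C * indicator (cball 0 R) x :: real)"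
    using assms(2,3) by eventually_elim (auto simp: indicator_def)
qed fact

lemma bounded_support_convergence:
  fixes f :: "real^'d::finite \<Rightarrow> real"
  assumes f: "f \<in> borel_measurable lebesgue" and s: "\<And>n. s n \<in> borel_measurable lebesgue"
    and lim: "AE x in lebesgue. (\<lambda>n. s n x) \<longlonglongrightarrow> f x"
    and bd: "\<And>n x. \<bar>s n x\<bar> \<le> C" and sup: "\<And>n x. norm x > R \<Longrightarrow> s n x = 0"
  shows "(\<lambda>n. integral\<^sup>L lebesgue (s n)) \<longlonglongrightarrow> integral\<^sup>L lebesgue f"
proof (rule integral_dominated_convergence[OF f s _ lim])
  show "integrable lebesgue (\<lambda>x. C * indicator (cball 0 R) x :: real)" using lmeasurable_cball lmeasurable_iff_integrable by (blast intro: integrable_mult_right)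
  show "AE x in lebesgue. norm (s n x) \<le> C * indicator (cball 0 R) x" for n
    using bd[of n] sup[of _ n] by (auto simp: indicator_def not_le)
qed

lemma integral_translate:
  fixes f :: "real^'d::finite \<Rightarrow> real"
  assumes "continuous_on UNIV f"
  shows "(\<integral>x. f (x + a) \<partial>lebesgue) = (\<integral>x. f x \<partial>lebesgue)"
proof -
  have m: "f \<in> borel_measurable borel" using assms by (rule borel_measurable_continuous_onI)
  have "(\<integral>x. f (x + a) \<partial>lborel) = (\<integral>x. f x \<partial>(distr lborel borel (\<lambda>x. a + x)))"
    using m by (subst integral_distr) (auto simp: add.commute)
  also have "\<dots> = (\<integral>x. f x \<partial>lborel)" by (simp add: lborel_distr_plus)
  finally show ?thesis using m by (simp add: integral_completion)
qed

section \<open>Difference quotients of Lipschitz functions\<close>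

definition hstep :: "nat \<Rightarrow> real" where "hstep n = 1 / (real n + 1)"

lemma hstep: "0 < hstep n" "hstep n \<le> 1" "hstep \<longlonglongrightarrow> 0"
proof -
  show "0 < hstep n" "hstep n \<le> 1" by (auto simp: hstep_def)
  show "hstep \<longlonglongrightarrow> 0" unfolding hstep_def using LIMSEQ_inverse_real_of_nat
    by (simp add: inverse_eq_divide add.commute)
qed

definition dquot :: "real^'d::finite \<Rightarrow> (real^'d \<Rightarrow> real) \<Rightarrow> nat \<Rightarrow> real^'d \<Rightarrow> real" where
  "dquot v f n x = (f (x + hstep n *\<^sub>R v) - f x) / hstep n"

lemma dquot_tendsto:
  assumes "f differentiable (at x)"
  shows "(\<lambda>n. dquot v f n x) \<longlonglongrightarrow> frechet_derivative f (at x) v"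
proof -
  let ?D = "frechet_derivative f (at x)"
  have D: "(f has_derivative ?D) (at x)" using assms by (simp add: frechet_derivative_works)
  then have D': "(f has_derivative ?D) (at (x + 0 *\<^sub>R v))" by simp
  interpret bounded_linear ?D using D by (rule has_derivative_bounded_linear)
  have "((\<lambda>t. x + t *\<^sub>R v) has_derivative (\<lambda>t. t *\<^sub>R v)) (at (0::real))"
    by (auto intro!: derivative_eq_intros)
  from has_derivative_compose[OF this D'] have "((\<lambda>t. f (x + t *\<^sub>R v)) has_derivative (\<lambda>t. ?D v * t)) (at 0)"
    by (simp add: scaleR mult.commute)
  then have "((\<lambda>t. f (x + t *\<^sub>R v)) has_real_derivative ?D v) (at 0)"
    by (simp add: has_field_derivative_def)
  then have "((\<lambda>h. (f (x + h *\<^sub>R v) - f x) / h) \<longlongrightarrow> ?D v) (at 0)" by (simp add: DERIV_def)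
  moreover have "filterlim hstep (at 0) sequentially"
    using hstep by (auto simp: filterlim_at less_imp_neq[symmetric] intro!: always_eventually)
  ultimately show ?thesis unfolding dquot_def by (rule filterlim_compose)
qed

text \<open>The bounds are uniform in \<open>n\<close>, as dominated convergence requires: the
  Lipschitz constant of \<open>f\<close> bounds every quotient, and steps of length at most 1
  enlarge the support by at most 1.\<close>

lemma dquot_lipc:
  assumes f: "lipc f" and v: "norm v \<le> 1"
  obtains C R where "C \<ge> 0" "\<And>n x. \<bar>dquot v f n x\<bar> \<le> C" "\<And>n x. norm x > R \<Longrightarrow> dquot v f n x = 0"
    "\<And>n. continuous_on UNIV (dquot v f n)"
proof -
  from f obtain L R where L: "L \<ge> 0" "\<And>x y. \<bar>f x - f y\<bar> \<le> L * norm (x - y)" and R: "R > 0" "\<And>x. norm x > R \<Longrightarrow> f x = 0"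
    by (rule lipcE) blast
  have "\<bar>dquot v f n x\<bar> \<le> L" for n x
  proof -
    have "\<bar>f (x + hstep n *\<^sub>R v) - f x\<bar> \<le> L * (hstep n * norm v)" using L(2)[of "x + hstep n *\<^sub>R v" x] hstep(1)[of n] by simp
    also have "\<dots> \<le> L * hstep n" using L v hstep(1)[of n] by (intro mult_left_mono mult_left_le) auto
    finally show ?thesis using hstep(1)[of n] by (simp add: dquot_def field_simps)
  qed
  moreover have "dquot v f n x = 0" if "norm x > R + 1" for n x
  proof -
    have "norm (hstep n *\<^sub>R v) \<le> 1" using hstep(1,2)[of n] v by (simp add: mult_le_one)
    then have "norm (x + hstep n *\<^sub>R v) > R" using that norm_triangle_ineq2[of x "- hstep n *\<^sub>R v"] by simp
    then show ?thesis using R(2)[of x] R(2)[of "x + hstep n *\<^sub>R v"] that by (simp add: dquot_def)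
  qed
  moreover have "continuous_on UNIV (dquot v f n)" for n
  proof -
    have "continuous_on UNIV (\<lambda>x. f (x + hstep n *\<^sub>R v))"
      by (rule continuous_on_compose2[OF lipc_continuous[OF f, of UNIV]]) (auto intro!: continuous_intros)
    then show ?thesis using lipc_continuous[OF f] hstep(1)[of n] unfolding dquot_def
      by (intro continuous_intros) auto
  qed
  ultimately show ?thesis using that L(1) by blast
qed

text \<open>Rademacher's theorem would supply such an \<open>N\<close> for every Lipschitz function.
  For finite element functions differentiability off the mesh skeleton is visible directly, so it is
  made an assumption.\<close>

locale lipc_diff =
  fixes f :: "real^'d::finite \<Rightarrow> real" and N :: "(real^'d) set"
  assumes lipc: "lipc f" and null: "negligible N" and diff: "\<And>x. x \<notin> N \<Longrightarrow> f differentiable (at x)"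
begin

lemma AE_N: "AE x in lebesgue. x \<notin> N"
  using null by (intro AE_not_in) (simp add: negligible_iff_null_sets)

lemma partial_AE_tendsto: "AE x in lebesgue. (\<lambda>n. dquot (axis j 1) f n x) \<longlonglongrightarrow> partial j f x"
  using AE_N by eventually_elim (auto simp: partial_def intro!: dquot_tendsto diff)

lemma partial_AE_tendsto_minus: "AE x in lebesgue. (\<lambda>n. - dquot (- axis j 1) f n x) \<longlonglongrightarrow> partial j f x"
  using AE_N
proof eventually_elim
  case (elim x)
  have d: "f differentiable (at x)" by (rule diff[OF elim])
  then interpret bounded_linear "frechet_derivative f (at x)"
    by (simp add: frechet_derivative_works has_derivative_bounded_linear)
  have "(\<lambda>n. - dquot (- axis j 1) f n x) \<longlonglongrightarrow> - frechet_derivative f (at x) (- axis j 1)"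
    by (intro tendsto_minus dquot_tendsto d)
  then show ?case by (simp add: neg partial_def)
qed

lemma dquot_measurable: "norm v \<le> 1 \<Longrightarrow> dquot v f n \<in> borel_measurable lebesgue"
  by (rule dquot_lipc[OF lipc, of v])
     (auto intro!: measurable_completion simp: borel_measurable_continuous_onI)

lemma partial_measurable: "partial j f \<in> borel_measurable lebesgue"
proof -
  \<comment> \<open>Set to 0 on \<open>N\<close>, the derivative is an everywhere limit of
    measurable functions.\<close>
  let ?G = "\<lambda>x. if x \<in> N then 0 else partial j f x"
  have N: "N \<in> sets lebesgue" using null by (simp add: negligible_iff_null_sets null_sets_def)
  have "?G \<in> borel_measurable lebesgue"
  proof (rule borel_measurable_LIMSEQ_real)
    show "(\<lambda>n. if x \<in> N then 0 else dquot (axis j 1) f n x) \<longlonglongrightarrow> ?G x" for x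
      by (auto simp: partial_def intro!: dquot_tendsto diff)
    show "(\<lambda>x. if x \<in> N then 0 else dquot (axis j 1) f n x) \<in> borel_measurable lebesgue" for n
      using N by (intro measurable_If_set dquot_measurable) auto
  qed
  moreover have "AE x in lebesgue. ?G x = partial j f x" using AE_N by eventually_elim simp
  ultimately show ?thesis by (rule borel_measurable_AE)
qed

lemma partial_bounded:
  obtains C R where "C \<ge> 0" "AE x in lebesgue. \<bar>partial j f x\<bar> \<le> C" "AE x in lebesgue. norm x > R \<longrightarrow> partial j f x = 0"
proof -
  obtain C R where C: "C \<ge> 0" "\<And>n x. \<bar>dquot (axis j 1) f n x\<bar> \<le> C" and R: "\<And>n x. norm x > R \<Longrightarrow> dquot (axis j 1) f n x = 0"
    by (rule dquot_lipc[OF lipc, of "axis j 1"]) auto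
  have "AE x in lebesgue. \<bar>partial j f x\<bar> \<le> C"
    using partial_AE_tendsto[of j]
  proof eventually_elim
    case (elim x)
    show ?case by (rule LIMSEQ_le_const2[OF tendsto_rabs[OF elim]]) (use C in auto)
  qed
  moreover have "AE x in lebesgue. norm x > R \<longrightarrow> partial j f x = 0"
    using partial_AE_tendsto[of j]
  proof eventually_elim
    case (elim x)
    then show ?case using R[of x] by (auto simp: LIMSEQ_const_iff)
  qed
  ultimately show ?thesis using that C by blast
qed

text \<open>Each difference quotient integrates to 0 by translation invariance, and dominated
  convergence passes this to the limit.\<close>

lemma integral_partial_eq_0: "(\<integral>x. partial j f x \<partial>lebesgue) = 0"
proof -
  obtain C R where C: "\<And>n x. \<bar>dquot (axis j 1) f n x\<bar> \<le> C" and R: "\<And>n x. norm x > R \<Longrightarrow> dquot (axis j 1) f n x = 0"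
    by (rule dquot_lipc[OF lipc, of "axis j 1"]) auto
  have "(\<lambda>n. integral\<^sup>L lebesgue (dquot (axis j 1) f n)) \<longlonglongrightarrow> integral\<^sup>L lebesgue (partial j f)"
    by (rule bounded_support_convergence[OF partial_measurable dquot_measurable partial_AE_tendsto C R]) auto
  moreover have "integral\<^sup>L lebesgue (dquot (axis j 1) f n) = 0" for n
  proof -
    obtain R C where fR: "\<And>x. norm x > R \<Longrightarrow> f x = 0" and fC: "\<And>x. \<bar>f x\<bar> \<le> C"
      by (rule lipc_bounds[OF lipc]) (rule that)
    have int: "integrable lebesgue (\<lambda>x. f (x + a))" for a
    proof (rule bounded_support_integrable[where C = C and R = "R + norm a"])
      have "continuous_on UNIV (\<lambda>x. f (x + a))"
        by (rule continuous_on_compose2[OF lipc_continuous[OF lipc, of UNIV]]) (auto intro!: continuous_intros)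
      then show "(\<lambda>x. f (x + a)) \<in> borel_measurable lebesgue"
        by (intro measurable_completion) (simp add: borel_measurable_continuous_onI)
      have "f (x + a) = 0" if "norm x > R + norm a" for x
        using that norm_triangle_ineq2[of x "- a"] by (intro fR) simp
      then show "AE x in lebesgue. norm x > R + norm a \<longrightarrow> f (x + a) = 0" by simp
    qed (simp add: fC)
    have "integral\<^sup>L lebesgue (dquot (axis j 1) f n)
        = ((\<integral>x. f (x + hstep n *\<^sub>R axis j 1) \<partial>lebesgue) - (\<integral>x. f x \<partial>lebesgue)) / hstep n"
      unfolding dquot_def using int[of "hstep n *\<^sub>R axis j 1"] int[of 0] by simp
    also have "\<dots> = 0" by (simp add: integral_translate lipc_continuous[OF lipc])
    finally show ?thesis .
  qed
  ultimately show ?thesis by (simp add: LIMSEQ_const_iff)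
qed

end

lemma partial_mult:
  assumes "f differentiable (at x)" "g differentiable (at x)"
  shows "partial j (\<lambda>x. f x * g x) x = f x * partial j g x + partial j f x * g x"
proof -
  have "((\<lambda>x. f x * g x) has_derivative (\<lambda>h. f x * frechet_derivative g (at x) h + frechet_derivative f (at x) h * g x)) (at x)"
    using assms by (intro has_derivative_mult) (simp_all add: frechet_derivative_works)
  from frechet_derivative_at[OF this] show ?thesis unfolding partial_def by metis
qed

lemma partial_coordinate: "partial j (\<lambda>x. x $ k) x = (if j = k then 1 else 0)"
proof -
  have "((\<lambda>x::real^'a. x $ k) has_derivative (\<lambda>h. h $ k)) (at x)"
    by (rule bounded_linear.has_derivative[OF bounded_linear_vec_nth]) (rule has_derivative_ident)
  from frechet_derivative_at[OF this, symmetric] show ?thesis by (simp add: partial_def axis_def)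
qed

text \<open>The product of the two functions is again Lipschitz with bounded support and
  differentiable off \<open>N\<close>, so the integral of its partial derivative vanishes; the
  product rule does the rest.\<close>

lemma integral_by_parts_lipc:
  assumes f: "lipc_diff f N" and g: "lipc_diff g N"
  shows "(\<integral>x. f x * partial j g x \<partial>lebesgue) = - (\<integral>x. partial j f x * g x \<partial>lebesgue)"
proof -
  interpret f: lipc_diff f N by fact
  interpret g: lipc_diff g N by fact
  interpret fg: lipc_diff "\<lambda>x. f x * g x" N
  proof
    show "lipc (\<lambda>x. f x * g x)" by (rule lipc_mult_lipc[OF g.lipc f.lipc])
    show "(\<lambda>x. f x * g x) differentiable (at x)" if "x \<notin> N" for x
      by (intro differentiable_mult f.diff g.diff that)
  qed (rule f.null)
  have int: "integrable lebesgue (\<lambda>x. u x * partial j w x)" if u: "lipc u" and w: "lipc_diff w N" for u w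
  proof -
    interpret w: lipc_diff w N by fact
    obtain C R where C: "C \<ge> 0" "AE x in lebesgue. \<bar>partial j w x\<bar> \<le> C"
      and R: "AE x in lebesgue. norm x > R \<longrightarrow> partial j w x = 0" by (rule w.partial_bounded)
    obtain B where B: "B \<ge> 0" "\<And>x. \<bar>u x\<bar> \<le> B" using u by (rule lipcE) blast
    show ?thesis
    proof (rule bounded_support_integrable)
      show "(\<lambda>x. u x * partial j w x) \<in> borel_measurable lebesgue"
        by (intro borel_measurable_times w.partial_measurable measurable_completion)
           (simp add: borel_measurable_continuous_onI lipc_continuous[OF u])
      show "AE x in lebesgue. \<bar>u x * partial j w x\<bar> \<le> B * C"
        using C(2) by eventually_elim (use B in \<open>auto simp: abs_mult intro!: mult_mono\<close>)
      show "AE x in lebesgue. norm x > R \<longrightarrow> u x * partial j w x = 0"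
        using R by eventually_elim auto
    qed
  qed
  have "0 = (\<integral>x. partial j (\<lambda>x. f x * g x) x \<partial>lebesgue)" by (simp add: fg.integral_partial_eq_0)
  also have "\<dots> = (\<integral>x. f x * partial j g x + g x * partial j f x \<partial>lebesgue)"
  proof (rule integral_cong_AE)
    show "AE x in lebesgue. partial j (\<lambda>x. f x * g x) x = f x * partial j g x + g x * partial j f x"
      using f.AE_N by eventually_elim (auto simp: partial_mult f.diff g.diff)
  qed (use int[OF f.lipc g] int[OF g.lipc f] fg.partial_measurable in auto)
  also have "\<dots> = (\<integral>x. f x * partial j g x \<partial>lebesgue) + (\<integral>x. g x * partial j f x \<partial>lebesgue)"
    using int[OF f.lipc g] int[OF g.lipc f] by simp
  finally show ?thesis by (simp add: mult.commute)
qed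

text \<open>
  Forward quotients on one side and backward quotients on the other have equal integrals by
  translation invariance, so no second derivatives are needed.
\<close>

lemma Korn_identity:
  assumes u: "lipc_diff u N" and w: "lipc_diff w N"
  shows "(\<integral>x. partial i u x * partial j w x \<partial>lebesgue) = (\<integral>x. partial j u x * partial i w x \<partial>lebesgue)"
proof -
  interpret u: lipc_diff u N by fact
  interpret w: lipc_diff w N by fact
  \<comment> \<open>The sign \<open>s\<close> treats forward and backward quotients at once:
    \<open>s = -1\<close> reverses both the direction and the sign of the quotient, so the limit is
    the same partial derivative.\<close>
  have lim: "(\<lambda>n. \<integral>x. (s * dquot (s *\<^sub>R axis i 1) u n x) * (s * dquot (s *\<^sub>R axis j 1) w n x) \<partial>lebesgue)
      \<longlonglongrightarrow> (\<integral>x. partial i u x * partial j w x \<partial>lebesgue)" if s: "s = 1 \<or> s = -1" for s :: real and i j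
  proof -
    have nrm: "norm (s *\<^sub>R (axis k 1 :: real^'a)) \<le> 1" for k using s by auto
    obtain C R where C: "C \<ge> 0" "\<And>n x. \<bar>dquot (s *\<^sub>R axis i 1) u n x\<bar> \<le> C"
      and R: "\<And>n x. norm x > R \<Longrightarrow> dquot (s *\<^sub>R axis i 1) u n x = 0"
      by (rule dquot_lipc[OF u.lipc nrm]) blast
    obtain C' where C': "C' \<ge> 0" "\<And>n x. \<bar>dquot (s *\<^sub>R axis j 1) w n x\<bar> \<le> C'"
      by (rule dquot_lipc[OF w.lipc nrm]) blast
    show ?thesis
    proof (rule bounded_support_convergence[where C = "C * C'" and R = R])
      show "(\<lambda>x. partial i u x * partial j w x) \<in> borel_measurable lebesgue"
        by (intro borel_measurable_times u.partial_measurable w.partial_measurable)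
      show "(\<lambda>x. (s * dquot (s *\<^sub>R axis i 1) u n x) * (s * dquot (s *\<^sub>R axis j 1) w n x)) \<in> borel_measurable lebesgue" for n
        by (intro borel_measurable_times borel_measurable_const u.dquot_measurable w.dquot_measurable nrm)
      show "AE x in lebesgue. (\<lambda>n. (s * dquot (s *\<^sub>R axis i 1) u n x) * (s * dquot (s *\<^sub>R axis j 1) w n x))
          \<longlonglongrightarrow> partial i u x * partial j w x"
        using u.partial_AE_tendsto[of i] u.partial_AE_tendsto_minus[of i] w.partial_AE_tendsto[of j] w.partial_AE_tendsto_minus[of j]
      proof eventually_elim
        case (elim x)
        have "(\<lambda>n. s * dquot (s *\<^sub>R axis i 1) u n x) \<longlonglongrightarrow> partial i u x"
          using s elim(1,2) by (elim disjE) simp_all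
        moreover have "(\<lambda>n. s * dquot (s *\<^sub>R axis j 1) w n x) \<longlonglongrightarrow> partial j w x"
          using s elim(3,4) by (elim disjE) simp_all
        ultimately show ?case by (rule tendsto_mult)
      qed
      show "\<bar>(s * dquot (s *\<^sub>R axis i 1) u n x) * (s * dquot (s *\<^sub>R axis j 1) w n x)\<bar> \<le> C * C'" for n x
      proof -
        have "\<bar>dquot (s *\<^sub>R axis i 1) u n x\<bar> * \<bar>dquot (s *\<^sub>R axis j 1) w n x\<bar> \<le> C * C'"
          using C C' by (intro mult_mono) auto
        then show ?thesis using s by (auto simp: abs_mult)
      qed
      show "(s * dquot (s *\<^sub>R axis i 1) u n x) * (s * dquot (s *\<^sub>R axis j 1) w n x) = 0" if "norm x > R" for n x
        using R[OF that] by simp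
    qed
  qed
  obtain R B where u_bd: "\<And>x. norm x > R \<Longrightarrow> u x = 0" "B \<ge> 0" "\<And>x. \<bar>u x\<bar> \<le> B"
    by (rule lipc_bounds[OF u.lipc]) (rule that)
  obtain B' where w_bd: "B' \<ge> 0" "\<And>x. \<bar>w x\<bar> \<le> B'"
    by (rule lipc_bounds[OF w.lipc]) (rule that)
  have cont: "continuous_on UNIV (\<lambda>x. u (x + a) * w (x + b))" for a b
    by (intro continuous_on_mult continuous_on_compose2[OF lipc_continuous[OF u.lipc, of UNIV]]
          continuous_on_compose2[OF lipc_continuous[OF w.lipc, of UNIV]] continuous_intros) auto
  have int: "integrable lebesgue (\<lambda>x. u (x + a) * w (x + b))" for a b
  proof (rule bounded_support_integrable[where C = "B * B'" and R = "R + norm a"])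
    show "(\<lambda>x. u (x + a) * w (x + b)) \<in> borel_measurable lebesgue"
      using cont by (intro measurable_completion) (simp add: borel_measurable_continuous_onI)
    show "AE x in lebesgue. \<bar>u (x + a) * w (x + b)\<bar> \<le> B * B'"
      using u_bd w_bd by (intro AE_I2) (auto simp: abs_mult intro!: mult_mono)
    have "u (x + a) = 0" if "norm x > R + norm a" for x
      using that norm_triangle_ineq2[of x "- a"] by (intro u_bd) simp
    then show "AE x in lebesgue. norm x > R + norm a \<longrightarrow> u (x + a) * w (x + b) = 0" by simp
  qed
  define I where "I a b = (\<integral>x. u (x + a) * w (x + b) \<partial>lebesgue)" for a b
  have I_shift: "I (a + c) (b + c) = I a b" for a b c
    using integral_translate[OF cont[of a b], of c] by (simp add: I_def add_ac)
  have expand: "(\<integral>x. (s * dquot v u n x) * (s * dquot v' w n x) \<partial>lebesgue)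
     = (s / hstep n)\<^sup>2 * (I (hstep n *\<^sub>R v) (hstep n *\<^sub>R v') - I (hstep n *\<^sub>R v) 0 - I 0 (hstep n *\<^sub>R v') + I 0 0)" for s n v v'
  proof -
    have "(s * dquot v u n x) * (s * dquot v' w n x) = (s / hstep n)\<^sup>2 *
      (u (x + hstep n *\<^sub>R v) * w (x + hstep n *\<^sub>R v') - u (x + hstep n *\<^sub>R v) * w (x + 0)
        - u (x + 0) * w (x + hstep n *\<^sub>R v') + u (x + 0) * w (x + 0))" for x
    proof -
      have "(s * dquot v u n x) * (s * dquot v' w n x)
        = (s / hstep n)\<^sup>2 * ((u (x + hstep n *\<^sub>R v) - u x) * (w (x + hstep n *\<^sub>R v') - w x))"
        by (simp add: dquot_def power2_eq_square)
      also have "(u (x + hstep n *\<^sub>R v) - u x) * (w (x + hstep n *\<^sub>R v') - w x)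
        = u (x + hstep n *\<^sub>R v) * w (x + hstep n *\<^sub>R v') - u (x + hstep n *\<^sub>R v) * w (x + 0)
        - u (x + 0) * w (x + hstep n *\<^sub>R v') + u (x + 0) * w (x + 0)"
        by (simp add: algebra_simps)
      finally show ?thesis .
    qed
    then show ?thesis
      using int[of "hstep n *\<^sub>R v" "hstep n *\<^sub>R v'"] int[of "hstep n *\<^sub>R v" 0] int[of 0 "hstep n *\<^sub>R v'"] int[of 0 0]
      by (simp add: I_def)
  qed
  have eq: "(\<integral>x. (1 * dquot (1 *\<^sub>R axis i 1) u n x) * (1 * dquot (1 *\<^sub>R axis j 1) w n x) \<partial>lebesgue)
     = (\<integral>x. (-1 * dquot (-1 *\<^sub>R axis j 1) u n x) * (-1 * dquot (-1 *\<^sub>R axis i 1) w n x) \<partial>lebesgue)" for n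
  proof -
    let ?a = "hstep n *\<^sub>R (axis i 1 :: real^'a)" and ?b = "hstep n *\<^sub>R (axis j 1 :: real^'a)"
    \<comment> \<open>A shift by a + b exchanges the roles of the two directions; the two mixed
      terms need only a shift by b or by a.\<close>
    have "I (- ?b) (- ?a) = I ?a ?b" using I_shift[of "- ?b" "?a + ?b" "- ?a"] by simp
    moreover have "I (- ?b) 0 = I 0 ?b" using I_shift[of "- ?b" "?b" 0] by simp
    moreover have "I 0 (- ?a) = I ?a 0" using I_shift[of 0 "?a" "- ?a"] by simp
    ultimately show ?thesis unfolding expand by (simp add: power2_eq_square)
  qed
  have "(\<lambda>n. \<integral>x. (1 * dquot (1 *\<^sub>R axis i 1) u n x) * (1 * dquot (1 *\<^sub>R axis j 1) w n x) \<partial>lebesgue)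
      \<longlonglongrightarrow> (\<integral>x. partial j u x * partial i w x \<partial>lebesgue)"
    unfolding eq by (rule lim) simp
  moreover have "(\<lambda>n. \<integral>x. (1 * dquot (1 *\<^sub>R axis i 1) u n x) * (1 * dquot (1 *\<^sub>R axis j 1) w n x) \<partial>lebesgue)
      \<longlonglongrightarrow> (\<integral>x. partial i u x * partial j w x \<partial>lebesgue)"
    by (rule lim) simp
  ultimately show ?thesis by (rule LIMSEQ_unique[symmetric])
qed

section \<open>Continuously differentiable maps and Lipschitz estimates\<close>

text \<open>Induction on the number of pieces. Follow a piece containing \<open>a\<close> to its
  last point m in the interval; beyond m it does not occur, so the others cover the half-open rest,
  and being closed they cover m as well.\<close>

lemma interval_cover_lipschitz:
  fixes g :: "real \<Rightarrow> 'b::real_normed_vector"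
  assumes "finite F" "\<And>S. S \<in> F \<Longrightarrow> closed S" "{a..b} \<subseteq> \<Union>F" "a \<le> b"
    and "\<And>S s t. S \<in> F \<Longrightarrow> s \<in> S \<Longrightarrow> t \<in> S \<Longrightarrow> norm (g s - g t) \<le> C * \<bar>s - t\<bar>"
  shows "norm (g a - g b) \<le> C * (b - a)"
  using assms
proof (induction "card F" arbitrary: F a rule: less_induct)
  case less
  from less.prems(3,4) obtain S where S: "S \<in> F" "a \<in> S" by (meson UnionE atLeastAtMost_iff order_refl subsetD)
  have cl: "closed (S \<inter> {a..b})" using less.prems(2)[OF S(1)] by (intro closed_Int) auto
  have ne: "S \<inter> {a..b} \<noteq> {}" using S less.prems(4) by auto
  define m where "m = Sup (S \<inter> {a..b})"
  have m: "m \<in> S \<inter> {a..b}"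
    unfolding m_def by (rule closed_contains_Sup[OF ne _ cl]) auto
  have ub: "t \<le> m" if "t \<in> S" "t \<in> {a..b}" for t
    unfolding m_def by (rule cSup_upper) (use that in auto)
  have am: "norm (g a - g m) \<le> C * (m - a)" using less.prems(5)[OF S(1,2), of m] m by simp
  show ?case
  proof (cases "m = b")
    case True
    then show ?thesis using am by simp
  next
    case False
    then have mb: "m < b" using m by simp
    have "{m<..b} \<subseteq> \<Union>(F - {S})"
    proof
      fix t assume t: "t \<in> {m<..b}"
      then have "t \<in> {a..b}" using m by simp
      moreover have "t \<notin> S" using ub[of t] t calculation by auto
      ultimately show "t \<in> \<Union>(F - {S})" using less.prems(3) by auto
    qed
    moreover have "closed (\<Union>(F - {S}))" using less.prems(1,2) by (intro closed_Union) auto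
    ultimately have "closure {m<..b} \<subseteq> \<Union>(F - {S})" by (intro closure_minimal)
    then have "{m..b} \<subseteq> \<Union>(F - {S})" using mb by simp
    moreover have "card (F - {S}) < card F" using less.prems(1) S by (intro card_Diff1_less)
    ultimately have "norm (g m - g b) \<le> C * (b - m)"
      using less.prems mb by (intro less.hyps[of "F - {S}"]) auto
    then have "norm (g a - g m) + norm (g m - g b) \<le> C * (b - a)" using am by (simp add: algebra_simps)
    then show ?thesis using norm_triangle_ineq[of "g a - g m" "g m - g b"] by simp
  qed
qed

text \<open>The pieces need not be convex, so the segment between two points may enter and leave
  each of them several times; pulling the cover back to the segment reduces this to an
  interval.\<close>

lemma cover_lipschitz:
  fixes f :: "'a::real_normed_vector \<Rightarrow> 'b::real_normed_vector"
  assumes "finite F" "\<And>S. S \<in> F \<Longrightarrow> closed S" "\<Union>F = UNIV" "C \<ge> 0"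
    and lip: "\<And>S x y. S \<in> F \<Longrightarrow> x \<in> S \<Longrightarrow> y \<in> S \<Longrightarrow> norm (f x - f y) \<le> C * norm (x - y)"
  shows "norm (f x - f y) \<le> C * norm (x - y)"
proof -
  define l where "l t = x + t *\<^sub>R (y - x)" for t :: real
  have cont: "continuous_on UNIV l" unfolding l_def by (intro continuous_intros)
  have "norm (f (l 0) - f (l 1)) \<le> (C * norm (x - y)) * (1 - 0)"
  proof (rule interval_cover_lipschitz[where F = "(\<lambda>S. l -` S) ` F"])
    show "finite ((\<lambda>S. l -` S) ` F)" using assms(1) by simp
    show "closed S" if "S \<in> (\<lambda>S. l -` S) ` F" for S
      using that assms(2) cont by (auto intro: continuous_closed_vimage simp: continuous_on_eq_continuous_at)
    show "{0..1} \<subseteq> \<Union>((\<lambda>S. l -` S) ` F)" using assms(3) by auto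
    show "norm (f (l s) - f (l t)) \<le> C * norm (x - y) * \<bar>s - t\<bar>"
      if st: "S \<in> (\<lambda>S. l -` S) ` F" "s \<in> S" "t \<in> S" for S s t
    proof -
      obtain S' where "S' \<in> F" "l s \<in> S'" "l t \<in> S'" using st by auto
      then have "norm (f (l s) - f (l t)) \<le> C * norm (l s - l t)" by (rule lip)
      also have "l s - l t = (s - t) *\<^sub>R (y - x)" by (simp add: l_def scaleR_diff_left)
      finally show ?thesis by (simp add: norm_minus_commute mult_ac)
    qed
  qed simp
  then show ?thesis by (simp add: l_def)
qed

text \<open>Continuity of the derivative is asked for along each fixed direction. In finite
  dimensions this controls the operator norm, by summing over a basis.\<close>

definition C1fun :: "(real^'d::finite \<Rightarrow> 'b::euclidean_space) \<Rightarrow> bool" where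
  "C1fun f \<longleftrightarrow> (\<exists>f'. (\<forall>x. (f has_derivative f' x) (at x)) \<and> (\<forall>h. continuous_on UNIV (\<lambda>x. f' x h)))"

lemma C1fun_continuous: "C1fun f \<Longrightarrow> continuous_on S f"
  unfolding C1fun_def by (meson continuous_at_imp_continuous_on has_derivative_continuous)

lemma C1fun_const: "C1fun (\<lambda>x. c)"
  unfolding C1fun_def by (intro exI[of _ "\<lambda>x h. 0"]) auto

lemma C1fun_component: "C1fun (\<lambda>x. x $ i)"
  unfolding C1fun_def
  by (intro exI[of _ "\<lambda>x h. h $ i"])
     (auto intro!: bounded_linear.has_derivative[OF bounded_linear_vec_nth] has_derivative_ident)

lemma C1fun_add: "C1fun f \<Longrightarrow> C1fun g \<Longrightarrow> C1fun (\<lambda>x. f x + g x)"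
  unfolding C1fun_def
proof (elim exE conjE)
  fix f' g' assume "\<forall>x. (f has_derivative f' x) (at x)" "\<forall>h. continuous_on UNIV (\<lambda>x. f' x h)"
    "\<forall>x. (g has_derivative g' x) (at x)" "\<forall>h. continuous_on UNIV (\<lambda>x. g' x h)"
  then show "\<exists>f'. (\<forall>x. ((\<lambda>x. f x + g x) has_derivative f' x) (at x)) \<and> (\<forall>h. continuous_on UNIV (\<lambda>x. f' x h))"
    by (intro exI[of _ "\<lambda>x h. f' x h + g' x h"]) (auto intro!: has_derivative_add continuous_intros)
qed

lemma C1fun_mult:
  fixes f g :: "real^'d::finite \<Rightarrow> real"
  shows "C1fun f \<Longrightarrow> C1fun g \<Longrightarrow> C1fun (\<lambda>x. f x * g x)"
proof -
  assume a: "C1fun f" "C1fun g"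
  then obtain f' g' where "\<forall>x. (f has_derivative f' x) (at x)" "\<forall>h. continuous_on UNIV (\<lambda>x. f' x h)"
    "\<forall>x. (g has_derivative g' x) (at x)" "\<forall>h. continuous_on UNIV (\<lambda>x. g' x h)"
    unfolding C1fun_def by auto
  then show "C1fun (\<lambda>x. f x * g x)" unfolding C1fun_def
    using C1fun_continuous[OF a(1), of UNIV] C1fun_continuous[OF a(2), of UNIV]
    by (intro exI[of _ "\<lambda>x h. f x * g' x h + f' x h * g x"]) (auto intro!: has_derivative_mult continuous_intros)
qed

lemma C1fun_sum: "(\<And>k. k \<in> A \<Longrightarrow> C1fun (f k)) \<Longrightarrow> C1fun (\<lambda>x. \<Sum>k\<in>A. f k x)"
  by (induction A rule: infinite_finite_induct) (auto intro: C1fun_const C1fun_add)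

lemma C1fun_prod:
  fixes f :: "'k \<Rightarrow> real^'d::finite \<Rightarrow> real"
  shows "(\<And>k. k \<in> A \<Longrightarrow> C1fun (f k)) \<Longrightarrow> C1fun (\<lambda>x. \<Prod>k\<in>A. f k x)"
  by (induction A rule: infinite_finite_induct) (simp_all add: C1fun_const C1fun_mult)

lemma C1fun_power:
  fixes f :: "real^'d::finite \<Rightarrow> real"
  shows "C1fun f \<Longrightarrow> C1fun (\<lambda>x. f x ^ k)"
  by (induction k) (simp_all add: C1fun_const C1fun_mult)

lemma C1fun_multi_poly: "q \<in> multi_poly m \<Longrightarrow> C1fun q"
  unfolding multi_poly_def
  by (auto intro!: C1fun_sum C1fun_mult C1fun_const C1fun_prod C1fun_power C1fun_component)

lemma C1fun_vec:
  fixes F :: "real^'d::finite \<Rightarrow> real^'n::finite"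
  assumes "\<And>i. C1fun (\<lambda>x. F x $ i)"
  shows "C1fun F"
proof -
  from assms have "\<forall>i. \<exists>f'. (\<forall>x. ((\<lambda>x. F x $ i) has_derivative f' x) (at x)) \<and> (\<forall>h. continuous_on UNIV (\<lambda>x. f' x h))"
    by (simp add: C1fun_def)
  then obtain f' where f': "\<And>i x. ((\<lambda>x. F x $ i) has_derivative f' i x) (at x)"
    "\<And>i h. continuous_on UNIV (\<lambda>x. f' i x h)" by metis
  have "(F has_derivative (\<lambda>h. \<chi> i. f' i x h)) (at x)" for x
  proof (subst has_derivative_componentwise_within, rule ballI)
    fix b :: "real^'n" assume "b \<in> Basis"
    then obtain i where b: "b = axis i 1" by (auto simp: Basis_vec_def)
    show "((\<lambda>x. F x \<bullet> b) has_derivative (\<lambda>h. (\<chi> i. f' i x h) \<bullet> b)) (at x)"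
      using f'(1)[of i x] by (simp add: b inner_axis)
  qed
  moreover have "continuous_on UNIV (\<lambda>x. \<chi> i. f' i x h)" for h
    by (intro continuous_on_vec_lambda f')
  ultimately show ?thesis unfolding C1fun_def by (intro exI[of _ "\<lambda>x h. \<chi> i. f' i x h"]) auto
qed

lemma onorm_le_sum_Basis:
  assumes "bounded_linear (D :: 'a::euclidean_space \<Rightarrow> 'b::real_normed_vector)"
  shows "onorm D \<le> (\<Sum>b\<in>Basis. norm (D b))"
proof (rule onorm_le)
  fix h
  interpret bounded_linear D by fact
  have "D h = (\<Sum>b\<in>Basis. (h \<bullet> b) *\<^sub>R D b)"
    by (subst euclidean_representation[of h, symmetric]) (simp only: sum scaleR)
  also have "norm \<dots> \<le> (\<Sum>b\<in>Basis. norm ((h \<bullet> b) *\<^sub>R D b))" by (rule norm_sum)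
  also have "\<dots> \<le> (\<Sum>b\<in>Basis. norm (D b) * norm h)"
  proof (rule sum_mono)
    fix b :: 'a assume "b \<in> Basis"
    then have "\<bar>h \<bullet> b\<bar> * norm (D b) \<le> norm h * norm (D b)" by (intro mult_right_mono Basis_le_norm) auto
    then show "norm ((h \<bullet> b) *\<^sub>R D b) \<le> norm (D b) * norm h" by (simp add: mult.commute)
  qed
  finally show "norm (D h) \<le> (\<Sum>b\<in>Basis. norm (D b)) * norm h" by (simp add: sum_distrib_right)
qed

lemma C1fun_lipschitz_compact_convex:
  fixes f :: "real^'d::finite \<Rightarrow> 'b::euclidean_space"
  assumes f: "C1fun f" and S: "compact S" "convex S"
  obtains L where "L \<ge> 0" "\<And>x y. x \<in> S \<Longrightarrow> y \<in> S \<Longrightarrow> norm (f x - f y) \<le> L * norm (x - y)"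
proof -
  from f obtain f' where f': "\<And>x. (f has_derivative f' x) (at x)" and c: "\<And>h. continuous_on UNIV (\<lambda>x. f' x h)"
    unfolding C1fun_def by auto
  have "compact ((\<lambda>x. \<Sum>b\<in>Basis. norm (f' x b)) ` S)"
    by (intro compact_continuous_image S continuous_on_sum continuous_on_norm continuous_on_subset[OF c]) auto
  then have "bounded ((\<lambda>x. \<Sum>b\<in>Basis. norm (f' x b)) ` S)" by (rule compact_imp_bounded)
  then obtain L where L1: "L > 0" "\<forall>z\<in>(\<lambda>x. \<Sum>b\<in>Basis. norm (f' x b)) ` S. norm z \<le> L"
    unfolding bounded_pos by blast
  then have L: "L > 0" "\<And>x. x \<in> S \<Longrightarrow> (\<Sum>b\<in>Basis. norm (f' x b)) \<le> L" by (simp, force)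
  have "norm (f x - f y) \<le> L * norm (x - y)" if "x \<in> S" "y \<in> S" for x y
  proof (rule differentiable_bound[OF S(2) _ _ that])
    show "(f has_derivative f' x) (at x within S)" for x using f' by (rule has_derivative_at_withinI)
    show "onorm (f' x) \<le> L" if "x \<in> S" for x
      using onorm_le_sum_Basis[OF has_derivative_bounded_linear[OF f'[of x]]] L(2)[OF that] by simp
  qed
  then show ?thesis using that[of L] L(1) by simp
qed

text \<open>Subtracting the derivative at \<open>x0\<close> leaves a map with Lipschitz constant B/2
  near \<open>x0\<close>, while the injective derivative itself expands by B; half of the expansion
  survives.\<close>

lemma C1fun_locally_expanding:
  fixes f :: "real^'d::finite \<Rightarrow> real^'d"
  assumes f: "C1fun f" and inv: "\<And>f'. (f has_derivative f') (at x0) \<Longrightarrow> inj f'"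
  obtains c d where "c > 0" "d > 0"
    "\<And>x y. x \<in> ball x0 d \<Longrightarrow> y \<in> ball x0 d \<Longrightarrow> c * norm (x - y) \<le> norm (f x - f y)"
proof -
  from f obtain f' where f': "\<And>x. (f has_derivative f' x) (at x)" and c: "\<And>h. continuous_on UNIV (\<lambda>x. f' x h)"
    unfolding C1fun_def by auto
  have lin: "linear (f' x)" for x using f' has_derivative_linear by blast
  obtain B where B: "B > 0" "\<And>x. B * norm x \<le> norm (f' x0 x)"
    using linear_inj_bounded_below_pos[OF lin inv[OF f']] by metis
  have bl: "bounded_linear (\<lambda>h. f' x h - f' x0 h)" for x
    by (intro bounded_linear_sub has_derivative_bounded_linear[OF f'])
  have "continuous_on UNIV (\<lambda>x. \<Sum>b\<in>Basis. norm (f' x b - f' x0 b))"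
    by (intro continuous_intros c)
  then have "continuous (at x0) (\<lambda>x. \<Sum>b\<in>Basis. norm (f' x b - f' x0 b))"
    by (simp add: continuous_on_eq_continuous_at)
  then have "\<exists>d>0. \<forall>x. dist x x0 < d \<longrightarrow> dist (\<Sum>b\<in>Basis. norm (f' x b - f' x0 b)) (\<Sum>b\<in>Basis. norm (f' x0 b - f' x0 b)) < B / 2"
    unfolding continuous_at_eps_delta using B(1) half_gt_zero by blast
  then obtain d where d: "d > 0" "\<And>x. norm (x - x0) < d \<Longrightarrow> \<bar>\<Sum>b\<in>Basis. norm (f' x b - f' x0 b)\<bar> < B / 2"
    by (auto simp: dist_norm)
  have "(B / 2) * norm (x - y) \<le> norm (f x - f y)" if xy: "x \<in> ball x0 d" "y \<in> ball x0 d" for x y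
  proof -
    have "norm ((f x - f' x0 x) - (f y - f' x0 y)) \<le> (B / 2) * norm (x - y)"
    proof (rule differentiable_bound[OF convex_ball _ _ xy])
      fix u assume u: "u \<in> ball x0 d"
      show "((\<lambda>x. f x - f' x0 x) has_derivative (\<lambda>h. f' u h - f' x0 h)) (at u within ball x0 d)"
        by (intro has_derivative_diff has_derivative_at_withinI[OF f'] linear_imp_has_derivative lin)
      have "onorm (\<lambda>h. f' u h - f' x0 h) \<le> (\<Sum>b\<in>Basis. norm (f' u b - f' x0 b))"
        by (rule onorm_le_sum_Basis[OF bl])
      also have "\<dots> \<le> B / 2" using d(2)[of u] u by (simp add: dist_norm norm_minus_commute)
      finally show "onorm (\<lambda>h. f' u h - f' x0 h) \<le> B / 2" .
    qed
    moreover have "(f x - f' x0 x) - (f y - f' x0 y) = (f x - f y) - f' x0 (x - y)"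
      using linear_diff[OF lin] by simp
    ultimately have "norm (f x - f y - f' x0 (x - y)) \<le> (B / 2) * norm (x - y)" by simp
    then have "norm (f' x0 (x - y)) - norm (f x - f y) \<le> (B / 2) * norm (x - y)"
      using norm_triangle_ineq2[of "f' x0 (x - y)" "f x - f y"] by (simp add: norm_minus_commute)
    then show ?thesis using B(2)[of "x - y"] by (simp add: algebra_simps)
  qed
  then show ?thesis using that[of "B / 2" d] B d by simp
qed

text \<open>Provides the Lipschitz bound for the inverse of a reference map up to the cell boundary.
  Compactness turns failure into a limit pair: if its points differ injectivity is violated, if they
  coincide local expansion is.\<close>

lemma C1fun_expanding_on_compact:
  fixes f :: "real^'d::finite \<Rightarrow> real^'d"
  assumes f: "C1fun f" and S: "compact S" and inj: "inj_on f S"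
    and inv: "\<And>x f'. x \<in> S \<Longrightarrow> (f has_derivative f') (at x) \<Longrightarrow> inj f'"
  obtains c where "c > 0" "\<And>x y. x \<in> S \<Longrightarrow> y \<in> S \<Longrightarrow> c * norm (x - y) \<le> norm (f x - f y)"
proof (rule ccontr)
  assume "\<not> thesis"
  then have "\<And>c. c > 0 \<Longrightarrow> \<exists>x y. x \<in> S \<and> y \<in> S \<and> norm (f x - f y) < c * norm (x - y)"
    using that by (meson not_le)
  then have "\<forall>n. \<exists>p. p \<in> S \<times> S \<and> norm (f (fst p) - f (snd p)) < hstep n * norm (fst p - snd p)"
    using hstep(1) by fastforce
  then obtain p where p: "\<And>n. p n \<in> S \<times> S"
    "\<And>n. norm (f (fst (p n)) - f (snd (p n))) < hstep n * norm (fst (p n) - snd (p n))" by metis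
  obtain l \<sigma> where l: "l \<in> S \<times> S" "strict_mono (\<sigma> :: nat \<Rightarrow> nat)" "(p \<circ> \<sigma>) \<longlonglongrightarrow> l"
    using compact_Times[OF S S] p(1) by (metis (no_types, lifting) compact_def seq_compact_def compact_imp_seq_compact)
  obtain x y where xy: "l = (x, y)" "x \<in> S" "y \<in> S" using l(1) by auto
  have limx: "(\<lambda>n. fst (p (\<sigma> n))) \<longlonglongrightarrow> x" and limy: "(\<lambda>n. snd (p (\<sigma> n))) \<longlonglongrightarrow> y"
    using tendsto_fst[OF l(3)] tendsto_snd[OF l(3)] xy by (simp_all add: o_def)
  have h0: "(\<lambda>n. hstep (\<sigma> n)) \<longlonglongrightarrow> 0"
    using LIMSEQ_subseq_LIMSEQ[OF hstep(3) l(2)] by (simp add: o_def)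
  have isC: "isCont f z" for z
    using C1fun_continuous[OF f, of UNIV] by (simp add: continuous_on_eq_continuous_at)
  have "(\<lambda>n. norm (f (fst (p (\<sigma> n))) - f (snd (p (\<sigma> n))))) \<longlonglongrightarrow> norm (f x - f y)"
    by (intro tendsto_norm tendsto_diff isCont_tendsto_compose[OF isC] limx limy)
  moreover have "(\<lambda>n. hstep (\<sigma> n) * norm (fst (p (\<sigma> n)) - snd (p (\<sigma> n)))) \<longlonglongrightarrow> 0 * norm (x - y)"
    by (intro tendsto_intros h0 limx limy)
  ultimately have "norm (f x - f y) \<le> 0 * norm (x - y)"
    by (rule LIMSEQ_le) (use p(2) less_imp_le in blast)
  then have "x = y" using inj xy by (auto simp: inj_on_def)
  obtain c d where c: "c > 0" and d: "d > 0" "\<And>u v. u \<in> ball x d \<Longrightarrow> v \<in> ball x d \<Longrightarrow> c * norm (u - v) \<le> norm (f u - f v)"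
    by (rule C1fun_locally_expanding[OF f inv[OF xy(2)]]) blast+
  have "\<forall>\<^sub>F n in sequentially. fst (p (\<sigma> n)) \<in> ball x d" "\<forall>\<^sub>F n in sequentially. snd (p (\<sigma> n)) \<in> ball x d"
    using limx limy d(1) \<open>x = y\<close> by (auto simp: tendsto_iff dist_commute)
  moreover have "\<forall>\<^sub>F n in sequentially. hstep (\<sigma> n) < c" using order_tendstoD(2)[OF h0 c] .
  ultimately have "\<forall>\<^sub>F n in sequentially. False"
  proof eventually_elim
    case (elim n)
    have "c * norm (fst (p (\<sigma> n)) - snd (p (\<sigma> n))) < hstep (\<sigma> n) * norm (fst (p (\<sigma> n)) - snd (p (\<sigma> n)))"
      using d(2)[OF elim(1,2)] p(2)[of "\<sigma> n"] by simp
    then show False using elim(3) by (simp add: mult_less_cancel_right)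
  qed
  then show False by simp
qed

section \<open>Meshed domains\<close>

locale meshed_domain = bounded_open \<Omega> for \<Omega> :: "(real^'d::finite) set" +
  fixes Th :: "(real^'d) set set" and TK :: "(real^'d) set \<Rightarrow> real^'d \<Rightarrow> real^'d"
  assumes domain: "polyhedral_lipschitz_domain \<Omega>" and mesh: "hex_mesh \<Omega> Th TK"
begin

lemma Th_cover: "finite Th" "\<Union>Th = closure \<Omega>"
  using mesh by (auto simp: hex_mesh_def)

lemma TK_bij: "K \<in> Th \<Longrightarrow> inj_on (TK K) ref_cell" "K \<in> Th \<Longrightarrow> TK K ` ref_cell = K"
  using mesh by (auto simp: hex_mesh_def bij_betw_def)

lemma TK_C1fun: "K \<in> Th \<Longrightarrow> C1fun (TK K)"
  using mesh by (intro C1fun_vec C1fun_multi_poly[where m = "\<lambda>_. 1"]) (auto simp: hex_mesh_def Qpoly_def)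

lemma TK_derivative_inj:
  assumes "K \<in> Th" "x \<in> ref_cell" "(TK K has_derivative f') (at x)"
  shows "inj f'"
proof -
  have "f' = frechet_derivative (TK K) (at x)" by (rule frechet_derivative_at) fact
  then have "det (matrix f') \<noteq> 0" using mesh assms by (auto simp: hex_mesh_def jacobian_def)
  then show ?thesis using det_nz_iff_inj[OF has_derivative_linear[OF assms(3)]] by simp
qed

lemma ref_cell_facts:
  "compact (ref_cell :: (real^'d) set)" "convex (ref_cell :: (real^'d) set)"
  "box 0 1 \<subseteq> (ref_cell :: (real^'d) set)" "interior ref_cell = box (0 :: real^'d) 1"
  unfolding ref_cell_def using box_subset_cbox by (auto simp: interior_cbox)

text \<open>Images of the faces of the reference cell. Off this null set every point of the closure
  lies in an open cell, where finite element functions are differentiable.\<close>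

definition skeleton :: "(real^'d) set" where
  "skeleton = (\<Union>K\<in>Th. TK K ` (cbox 0 1 - box 0 1))"

lemma TK_differentiable_on: "K \<in> Th \<Longrightarrow> TK K differentiable_on S"
proof -
  assume "K \<in> Th"
  then obtain f' where "\<And>x. (TK K has_derivative f' x) (at x)" using TK_C1fun unfolding C1fun_def by blast
  then show ?thesis
    by (intro differentiable_at_imp_differentiable_on differentiableI)
qed

lemma negligible_skeleton: "negligible skeleton"
  unfolding skeleton_def
proof (rule negligible_Union)
  show "finite ((\<lambda>K. TK K ` (cbox 0 1 - box 0 1)) ` Th)" using Th_cover by simp
  fix N assume "N \<in> (\<lambda>K. TK K ` (cbox 0 1 - box 0 1)) ` Th"
  then show "negligible N"
    by (auto intro!: negligible_differentiable_image_negligible negligible_frontier_interval TK_differentiable_on)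
qed

lemma open_cell_cover:
  assumes "x \<in> closure \<Omega>" "x \<notin> skeleton"
  obtains K where "K \<in> Th" "x \<in> TK K ` box 0 1"
proof -
  obtain K where K: "K \<in> Th" "x \<in> K" using assms Th_cover by auto
  then obtain u where u: "u \<in> cbox 0 1" "x = TK K u" using TK_bij(2)[OF K(1)] by (auto simp: ref_cell_def)
  then have "u \<in> box 0 1" using assms(2) K by (auto simp: skeleton_def)
  then show ?thesis using that K u by blast
qed

lemma open_cell: "K \<in> Th \<Longrightarrow> open (TK K ` box 0 1)"
  using TK_bij(1)[of K] ref_cell_facts(3)
  by (intro invariance_of_domain C1fun_continuous TK_C1fun open_box) (auto intro: inj_on_subset)

lemma inverse_TK_differentiable:
  assumes K: "K \<in> Th" and u: "u \<in> box 0 1"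
  shows "inv_into ref_cell (TK K) differentiable (at (TK K u))"
proof -
  obtain f' where f': "\<And>x. (TK K has_derivative f' x) (at x)" using TK_C1fun[OF K] unfolding C1fun_def by blast
  have uc: "u \<in> ref_cell" using u ref_cell_facts by auto
  obtain g' where g': "linear g'" "\<And>x. f' u (g' x) = x"
    using linear_injective_isomorphism[OF has_derivative_linear[OF f'[of u]] TK_derivative_inj[OF K uc f']] by blast
  have "(inv_into ref_cell (TK K) has_derivative g') (at (TK K u))"
  proof (rule has_derivative_inverse_strong[of "box 0 1" u "TK K"])
    show "inv_into ref_cell (TK K) (TK K x) = x" if "x \<in> box 0 1" for x
      using that ref_cell_facts(3) TK_bij(1)[OF K] by (intro inv_into_f_f) auto
    show "f' u \<circ> g' = id" using g' by auto
  qed (use u f' TK_C1fun[OF K] in \<open>auto intro: C1fun_continuous\<close>)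
  then show ?thesis by (rule differentiableI)
qed

text \<open>The boundary of an open set can have positive measure, even inside the interior of the
  closure. The Lipschitz graph excludes this: it puts exterior points next to each boundary point,
  so the boundary of the domain is part of that of its closure, which lies in the frontiers of
  finitely many polytopes.\<close>

lemma boundary_negligible: "negligible (closure \<Omega> - \<Omega>)"
proof -
  obtain F where F: "finite F" "\<And>P. P \<in> F \<Longrightarrow> polytope P" "closure \<Omega> = \<Union>F"
    using domain by (auto simp: polyhedral_lipschitz_domain_def)
  have "frontier (closure \<Omega>) \<subseteq> \<Union>(frontier ` F)"
  proof
    fix x assume x: "x \<in> frontier (closure \<Omega>)"
    then have "x \<in> closure \<Omega>" by (simp add: frontier_def)
    then obtain P where P: "P \<in> F" "x \<in> P" using F by auto
    have "x \<notin> interior P"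
      using x P(1) F(3) interior_mono[of P "closure \<Omega>"] by (auto simp: frontier_def)
    then show "x \<in> \<Union>(frontier ` F)" using P closure_subset[of P] by (auto simp: frontier_def)
  qed
  moreover have "negligible (\<Union>(frontier ` F))"
    using F by (intro negligible_Union) (auto intro: negligible_convex_frontier polytope_imp_convex)
  ultimately have neg: "negligible (frontier (closure \<Omega>))" by (rule negligible_subset[rotated])
  have "closure \<Omega> - \<Omega> \<subseteq> frontier (closure \<Omega>)"
  proof
    fix x assume x: "x \<in> closure \<Omega> - \<Omega>"
    then have xf: "x \<in> frontier \<Omega>" using open_\<Omega> by (simp add: frontier_def interior_open)
    have "lipschitz_boundary \<Omega>" using domain by (simp add: polyhedral_lipschitz_domain_def)
    then have "\<exists>e \<rho> C \<gamma>. norm e = 1 \<and> \<rho> > 0 \<and> C-lipschitz_on UNIV (\<gamma> :: real^'d \<Rightarrow> real) \<and>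
        \<Omega> \<inter> ball x \<rho> = {y \<in> ball x \<rho>. \<gamma> (y - (y \<bullet> e) *\<^sub>R e) < y \<bullet> e}"
      unfolding lipschitz_boundary_def using xf by (rule bspec)
    then obtain e \<rho> C \<gamma> where e: "norm e = 1" and \<rho>: "\<rho> > 0" and lip: "C-lipschitz_on UNIV (\<gamma> :: real^'d \<Rightarrow> real)"
      and graph: "\<Omega> \<inter> ball x \<rho> = {y \<in> ball x \<rho>. \<gamma> (y - (y \<bullet> e) *\<^sub>R e) < y \<bullet> e}"
      by (elim exE conjE) (rule that)
    \<comment> \<open>The height above the graph; inside the ball its sign tells the domain from the
      rest.\<close>
    define H where "H y = y \<bullet> e - \<gamma> (y - (y \<bullet> e) *\<^sub>R e)" for y
    have c\<gamma>: "continuous_on UNIV \<gamma>" using lip by (rule lipschitz_on_continuous_on)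
    have cH: "continuous_on UNIV H"
      unfolding H_def by (intro continuous_intros continuous_on_compose2[OF c\<gamma>]) auto
    have \<Omega>H: "y \<in> \<Omega> \<longleftrightarrow> H y > 0" if "y \<in> ball x \<rho>" for y
    proof -
      have "y \<in> \<Omega> \<longleftrightarrow> y \<in> \<Omega> \<inter> ball x \<rho>" using that by simp
      also have "\<dots> \<longleftrightarrow> H y > 0" unfolding graph using that by (simp add: H_def)
      finally show ?thesis .
    qed
    have Hx: "H x \<le> 0" using \<Omega>H[of x] x \<rho> by simp
    \<comment> \<open>A step along -e leaves the projection onto the complement of e, and with it
      the value of the graph function, unchanged.\<close>
    have below: "H (x - t *\<^sub>R e) < 0" if "t > 0" for t
    proof -
      have "e \<bullet> e = 1" using e by (simp add: norm_eq_1)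
      then have "x - t *\<^sub>R e - ((x - t *\<^sub>R e) \<bullet> e) *\<^sub>R e = x - (x \<bullet> e) *\<^sub>R e"
        by (simp add: inner_diff_left algebra_simps)
      then have "H (x - t *\<^sub>R e) = (x - t *\<^sub>R e) \<bullet> e - \<gamma> (x - (x \<bullet> e) *\<^sub>R e)" unfolding H_def by (simp only:)
      then have "H (x - t *\<^sub>R e) = H x - t" using \<open>e \<bullet> e = 1\<close> by (simp add: H_def inner_diff_left)
      then show ?thesis using Hx that by simp
    qed
    \<comment> \<open>Strictly below the graph there is a whole neighbourhood free of the
      domain.\<close>
    have out: "x - t *\<^sub>R e \<notin> closure \<Omega>" if t: "0 < t" "t < \<rho>" for t
    proof
      assume cl: "x - t *\<^sub>R e \<in> closure \<Omega>"
      have "open (ball x \<rho> \<inter> {y. H y < 0})"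
        using open_Collect_less[OF cH continuous_on_const] by (intro open_Int) auto
      moreover have "x - t *\<^sub>R e \<in> ball x \<rho> \<inter> {y. H y < 0}"
        using below[OF t(1)] t e by (simp add: dist_norm)
      ultimately have "(ball x \<rho> \<inter> {y. H y < 0}) \<inter> \<Omega> \<noteq> {}"
        using cl open_Int_closure_eq_empty[of "ball x \<rho> \<inter> {y. H y < 0}" \<Omega>] by blast
      then obtain y where "y \<in> ball x \<rho>" "H y < 0" "y \<in> \<Omega>" by blast
      then show False using \<Omega>H[of y] by simp
    qed
    have "x \<notin> interior (closure \<Omega>)"
    proof
      assume "x \<in> interior (closure \<Omega>)"
      then obtain d where d: "d > 0" "ball x d \<subseteq> closure \<Omega>" by (auto simp: mem_interior)
      define t where "t = min d \<rho> / 2"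
      have t: "0 < t" "t < \<rho>" "t < d" using d \<rho> by (auto simp: t_def)
      then have "x - t *\<^sub>R e \<in> ball x d" using e by (simp add: dist_norm)
      then show False using out[OF t(1,2)] d by blast
    qed
    then show "x \<in> frontier (closure \<Omega>)" using x by (simp add: frontier_def)
  qed
  then show ?thesis using neg negligible_subset by blast
qed

lemma AE_skeleton: "AE x in lebesgue. x \<notin> skeleton"
  using negligible_skeleton by (intro AE_not_in) (simp add: negligible_iff_null_sets)

lemma AE_boundary: "AE x in lebesgue. x \<notin> closure \<Omega> - \<Omega>"
  using boundary_negligible by (intro AE_not_in) (simp add: negligible_iff_null_sets)

text \<open>Cut off at the closure, because the values of \<open>z\<close> beyond it are
  arbitrary.\<close>

definition ext :: "(real^'d \<Rightarrow> real^'d) \<Rightarrow> real^'d \<Rightarrow> real^'d" where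
  "ext z x = (if x \<in> closure \<Omega> then z x else 0)"

text \<open>
  A segment is covered by finitely many closed pieces, its intersections with the cells and with
  the complement of the domain, and the extension by zero is Lipschitz on each of them.
\<close>

lemma ext_lipschitz:
  assumes z: "z \<in> displacement_space \<Omega> Th TK m"
  obtains C where "C \<ge> 0" "\<And>x y. norm (ext z x - ext z y) \<le> C * norm (x - y)"
proof -
  have cell: "\<exists>C\<ge>0. \<forall>x\<in>K. \<forall>y\<in>K. norm (z x - z y) \<le> C * norm (x - y)" if K: "K \<in> Th" for K
  proof -
    have "\<forall>i. \<exists>q\<in>Qpoly m. \<forall>x\<in>ref_cell. z (TK K x) $ i = q x"
      using z K by (auto simp: displacement_space_def)
    then obtain q where q: "\<And>i. q i \<in> Qpoly m" "\<And>i x. x \<in> ref_cell \<Longrightarrow> z (TK K x) $ i = q i x" by metis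
    define p where "p x = (\<chi> i. q i x)" for x
    have p: "z (TK K x) = p x" if "x \<in> ref_cell" for x using q(2)[OF that] by (simp add: p_def vec_eq_iff)
    have "C1fun p" using q(1) by (intro C1fun_vec) (auto simp: p_def Qpoly_def intro: C1fun_multi_poly)
    then obtain L where L: "L \<ge> 0" "\<And>x y. x \<in> ref_cell \<Longrightarrow> y \<in> ref_cell \<Longrightarrow> norm (p x - p y) \<le> L * norm (x - y)"
      using C1fun_lipschitz_compact_convex[OF _ ref_cell_facts(1,2)] by blast
    obtain c where c: "c > 0" "\<And>x y. x \<in> ref_cell \<Longrightarrow> y \<in> ref_cell \<Longrightarrow> c * norm (x - y) \<le> norm (TK K x - TK K y)"
    proof (rule C1fun_expanding_on_compact[OF TK_C1fun[OF K] ref_cell_facts(1) TK_bij(1)[OF K]])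
      show "inj f'" if "x \<in> ref_cell" "(TK K has_derivative f') (at x)" for x f'
        by (rule TK_derivative_inj[OF K that])
    qed (rule that)
    \<comment> \<open>\<open>L\<close> is a Lipschitz constant of the polynomial on the reference
      cell, and 1/c is one of the inverse reference map.\<close>
    have "norm (z x - z y) \<le> (L / c) * norm (x - y)" if xy: "x \<in> K" "y \<in> K" for x y
    proof -
      have "x \<in> TK K ` ref_cell" "y \<in> TK K ` ref_cell" using xy TK_bij(2)[OF K] by simp_all
      then obtain u v where uv: "u \<in> ref_cell" "v \<in> ref_cell" "x = TK K u" "y = TK K v" by blast
      have "norm (z x - z y) \<le> L * norm (u - v)" using L(2)[OF uv(1,2)] p uv by simp
      also have "\<dots> \<le> L * (norm (x - y) / c)"
        using c(2)[OF uv(1,2)] c(1) uv L(1) by (intro mult_left_mono) (simp_all add: field_simps)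
      finally show ?thesis by simp
    qed
    then show ?thesis using L c by (intro exI[of _ "L / c"]) auto
  qed
  then obtain CK where CK: "\<And>K. K \<in> Th \<Longrightarrow> CK K \<ge> 0" "\<And>K x y. K \<in> Th \<Longrightarrow> x \<in> K \<Longrightarrow> y \<in> K \<Longrightarrow> norm (z x - z y) \<le> CK K * norm (x - y)"
    by metis
  \<comment> \<open>The sum over the finite mesh serves as a common bound in place of the
    maximum.\<close>
  define C where "C = (\<Sum>K\<in>Th. CK K)"
  have C0: "C \<ge> 0" unfolding C_def by (intro sum_nonneg CK)
  have CKC: "CK K \<le> C" if "K \<in> Th" for K
    unfolding C_def by (rule member_le_sum) (use that Th_cover CK in auto)
  have "norm (ext z x - ext z y) \<le> C * norm (x - y)" for x y
  proof (rule cover_lipschitz[of "insert (- \<Omega>) Th"])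
    show "finite (insert (- \<Omega>) Th)" using Th_cover by simp
    show "closed S" if "S \<in> insert (- \<Omega>) Th" for S
    proof (cases "S = - \<Omega>")
      case False
      then have S: "S \<in> Th" using that by simp
      have "compact (TK S ` ref_cell)"
        by (intro compact_continuous_image C1fun_continuous TK_C1fun S ref_cell_facts)
      then show ?thesis using TK_bij(2)[OF S] compact_imp_closed by simp
    qed (use open_\<Omega> in auto)
    show "\<Union>(insert (- \<Omega>) Th) = UNIV" using Th_cover closure_subset[of \<Omega>] by auto
    fix S x y assume S: "S \<in> insert (- \<Omega>) Th" "x \<in> S" "y \<in> S"
    show "norm (ext z x - ext z y) \<le> C * norm (x - y)"
    proof (cases "S \<in> Th")
      case True
      then have "x \<in> closure \<Omega>" "y \<in> closure \<Omega>" using S Th_cover by auto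
      then have "norm (ext z x - ext z y) \<le> CK S * norm (x - y)" using CK(2)[OF True S(2,3)] by (simp add: ext_def)
      also have "\<dots> \<le> C * norm (x - y)" by (intro mult_right_mono CKC True) simp
      finally show ?thesis .
    next
      case False
      have "ext z w = 0" if "w \<notin> \<Omega>" for w
      proof (cases "w \<in> closure \<Omega>")
        case True
        then have "w \<in> frontier \<Omega>" using that open_\<Omega> by (simp add: frontier_def interior_open)
        then show ?thesis using z by (simp add: ext_def displacement_space_def)
      qed (simp add: ext_def)
      then show ?thesis using S False C0 by auto
    qed
  qed (rule C0)
  then show ?thesis using that C0 by blast
qed

text \<open>Off the skeleton a point of the closure has an open cell around it, where the extension
  is a polynomial composed with the differentiable inverse reference map; off the closure the
  extension vanishes near the point.\<close>

lemma ext_lipc_diff: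
  assumes z: "z \<in> displacement_space \<Omega> Th TK m"
  shows "lipc_diff (\<lambda>x. ext z x $ i) skeleton"
proof
  show "negligible skeleton" by (rule negligible_skeleton)
  obtain C where C: "C \<ge> 0" "\<And>x y. norm (ext z x - ext z y) \<le> C * norm (x - y)" by (rule ext_lipschitz[OF z]) blast
  have "\<bar>ext z x $ i - ext z y $ i\<bar> \<le> C * norm (x - y)" for x y
    using order_trans[OF Finite_Cartesian_Product.norm_nth_le[of "ext z x - ext z y" i] C(2)] by simp
  moreover obtain R where "R > 0" "\<forall>x\<in>closure \<Omega>. norm x \<le> R"
    using bounded_closure[OF bounded_\<Omega>] unfolding bounded_pos by blast
  then have "\<forall>x. norm x > R \<longrightarrow> ext z x $ i = 0" by (auto simp: ext_def)
  ultimately show "lipc (\<lambda>x. ext z x $ i)" using C(1) \<open>R > 0\<close> unfolding lipc_def by blast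
  fix x assume x: "x \<notin> skeleton"
  show "(\<lambda>x. ext z x $ i) differentiable (at x)"
  proof (cases "x \<in> closure \<Omega>")
    case True
    obtain K where K: "K \<in> Th" "x \<in> TK K ` box 0 1" by (rule open_cell_cover[OF True x])
    then obtain u where u: "u \<in> box 0 1" "x = TK K u" by blast
    have "\<exists>q\<in>Qpoly m. \<forall>x\<in>ref_cell. z (TK K x) $ i = q x"
      using z K unfolding displacement_space_def by simp
    then obtain q where q: "q \<in> Qpoly m" "\<And>x. x \<in> ref_cell \<Longrightarrow> z (TK K x) $ i = q x" by blast
    let ?g = "inv_into ref_cell (TK K)"
    obtain g' where g': "(?g has_derivative g') (at x)"
      using inverse_TK_differentiable[OF K(1) u(1)] u(2) by (auto simp: differentiable_def)
    have "C1fun q" using q(1) by (auto simp: Qpoly_def intro: C1fun_multi_poly)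
    then obtain q' where q': "(q has_derivative q') (at (?g x))" by (auto simp: C1fun_def)
    have "((\<lambda>x. q (?g x)) has_derivative (\<lambda>h. q' (g' h))) (at x)" by (rule has_derivative_compose[OF g' q'])
    then have "((\<lambda>x. ext z x $ i) has_derivative (\<lambda>h. q' (g' h))) (at x)"
    proof (rule has_derivative_transform_within_open[OF _ open_cell[OF K(1)] K(2)])
      fix y assume "y \<in> TK K ` box 0 1"
      then obtain w where w: "w \<in> box 0 1" "y = TK K w" by blast
      have wc: "w \<in> ref_cell" using w ref_cell_facts by auto
      have "y \<in> K" using wc w TK_bij(2)[OF K(1)] by blast
      then have "y \<in> closure \<Omega>" using K Th_cover by auto
      moreover have "?g y = w" using w wc TK_bij(1)[OF K(1)] by (simp add: inv_into_f_f)
      ultimately show "q (?g y) = ext z y $ i" using q(2)[OF wc] w by (simp add: ext_def)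
    qed
    then show ?thesis by (rule differentiableI)
  next
    case False
    have "((\<lambda>x. ext z x $ i) has_derivative (\<lambda>h. 0)) (at x)"
      by (rule has_derivative_transform_within_open[of "\<lambda>x. 0" _ _ UNIV "- closure \<Omega>"])
         (use False in \<open>auto simp: ext_def\<close>)
    then show ?thesis by (rule differentiableI)
  qed
qed

end

section \<open>Displacement spaces: Korn and Poincare inequalities\<close>

context meshed_domain
begin

text \<open>The classical gradient of the extension. It proves to be a weak gradient of
  \<open>z\<close>, which makes the chosen \<open>wgrad\<close> computable almost
  everywhere.\<close>

definition cgrad :: "(real^'d \<Rightarrow> real^'d) \<Rightarrow> real^'d \<Rightarrow> real^'d^'d" where
  "cgrad z x = (\<chi> i j. partial j (\<lambda>x. ext z x $ i) x)"

context
  fixes z :: "real^'d \<Rightarrow> real^'d" and m :: nat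
  assumes z: "z \<in> displacement_space \<Omega> Th TK m"
begin

lemma ext_eq_0: "x \<notin> \<Omega> \<Longrightarrow> ext z x = 0"
proof (cases "x \<in> closure \<Omega>")
  case True
  assume "x \<notin> \<Omega>"
  then have "x \<in> frontier \<Omega>" using True open_\<Omega> by (simp add: frontier_def interior_open)
  then show ?thesis using z by (simp add: ext_def displacement_space_def)
qed (simp add: ext_def)

lemma ext_eq: "x \<in> \<Omega> \<Longrightarrow> ext z x = z x"
  using closure_subset[of \<Omega>] by (auto simp: ext_def)

lemma eq_ae_ext: "eq_ae \<Omega> (ext z) z"
  using ext_eq by (auto simp: eq_ae_def AE_restrict_space_iff)

lemma partial_ext_AE_outside: "AE x in lebesgue. x \<notin> \<Omega> \<longrightarrow> partial j (\<lambda>x. ext z x $ i) x = 0"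
  using AE_boundary
proof eventually_elim
  case (elim x)
  have "partial j (\<lambda>x. ext z x $ i) x = 0" if x: "x \<notin> closure \<Omega>"
  proof (rule partial_eq_0_outside)
    have "{x. ext z x $ i \<noteq> 0} \<subseteq> \<Omega>" using ext_eq_0 by force
    then have "closure {x. ext z x $ i \<noteq> 0} \<subseteq> closure \<Omega>" by (rule closure_mono)
    then show "x \<notin> closure {x. ext z x $ i \<noteq> 0}" using x by blast
  qed
  then show ?case using elim by blast
qed

lemma partial_ext_L2: "(\<lambda>x. partial j (\<lambda>x. ext z x $ i) x) \<in> L2 \<Omega>"
proof -
  interpret lipc_diff "\<lambda>x. ext z x $ i" skeleton by (rule ext_lipc_diff[OF z])
  obtain C where "AE x in lebesgue. \<bar>partial j (\<lambda>x. ext z x $ i) x\<bar> \<le> C" by (rule partial_bounded)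
  then show ?thesis
    by (intro L2_bounded[OF open_\<Omega> bounded_\<Omega>, where C = C] measurable_restrict_space1 partial_measurable)
       (auto simp: AE_restrict_space_iff)
qed

lemma ext_L2: "(\<lambda>x. ext z x $ i) \<in> L2 \<Omega>"
proof -
  interpret lipc_diff "\<lambda>x. ext z x $ i" skeleton by (rule ext_lipc_diff[OF z])
  obtain C where "\<And>x. \<bar>ext z x $ i\<bar> \<le> C" by (rule lipc_bounds[OF lipc]) (rule that)
  then show ?thesis
    by (intro L2_bounded[OF open_\<Omega> bounded_\<Omega>, where C = C] continuous_imp_measurable_lebesgue_on lipc_continuous[OF lipc])
       auto
qed

lemma displacement_L2: "z \<in> L2 \<Omega>"
  by (rule L2_AE_cong[OF sets_\<Omega> _ eq_ae_ext]) (intro L2_vec_components ext_L2)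

lemma cgrad_L2: "cgrad z \<in> L2 \<Omega>"
  by (intro L2_vec_components) (simp add: cgrad_def partial_ext_L2)

lemma integral_restrict_\<Omega>:
  fixes h :: "real^'d \<Rightarrow> real"
  assumes "AE x in lebesgue. x \<notin> \<Omega> \<longrightarrow> h x = 0" "h \<in> borel_measurable lebesgue"
  shows "(\<integral>x. h x \<partial>(lebesgue_on \<Omega>)) = (\<integral>x. h x \<partial>lebesgue)"
proof -
  have "(\<integral>x. h x \<partial>(lebesgue_on \<Omega>)) = (\<integral>x. indicator \<Omega> x * h x \<partial>lebesgue)"
    by (simp add: integral_restrict_space)
  also have "\<dots> = (\<integral>x. h x \<partial>lebesgue)"
  proof (rule integral_cong_AE)
    show "AE x in lebesgue. indicator \<Omega> x * h x = h x"
      using assms(1) by eventually_elim (auto simp: indicator_def)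
  qed (intro borel_measurable_times borel_measurable_indicator sets_\<Omega> assms(2))+
  finally show ?thesis .
qed

text \<open>Extension by zero moves the integrals to the whole space, where integration by parts has
  no boundary term.\<close>

lemma displacement_weak_grad: "has_weak_grad \<Omega> z (cgrad z)"
  unfolding has_weak_grad_def
proof (intro ballI allI)
  fix \<phi> i j assume \<phi>: "\<phi> \<in> test_functions \<Omega>"
  note t = test_functionD[OF \<phi>]
  interpret u: lipc_diff "\<lambda>x. ext z x $ i" skeleton by (rule ext_lipc_diff[OF z])
  interpret \<phi>: lipc_diff \<phi> skeleton
    by unfold_locales (auto intro: lipc_smooth_compact_support t negligible_skeleton smooth_fun_differentiable)
  have "(\<integral>x. z x $ i * partial j \<phi> x \<partial>(lebesgue_on \<Omega>)) = (\<integral>x. ext z x $ i * partial j \<phi> x \<partial>(lebesgue_on \<Omega>))"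
    using ext_eq by (intro Bochner_Integration.integral_cong) auto
  also have "\<dots> = (\<integral>x. ext z x $ i * partial j \<phi> x \<partial>lebesgue)"
  proof (rule integral_restrict_\<Omega>)
    show "(\<lambda>x. ext z x $ i * partial j \<phi> x) \<in> borel_measurable lebesgue"
      using lipc_continuous[OF u.lipc]
      by (intro borel_measurable_times \<phi>.partial_measurable measurable_completion) (simp add: borel_measurable_continuous_onI)
  qed (simp add: ext_eq_0)
  also have "\<dots> = - (\<integral>x. partial j (\<lambda>x. ext z x $ i) x * \<phi> x \<partial>lebesgue)"
    by (rule integral_by_parts_lipc) (rule u.lipc_diff_axioms \<phi>.lipc_diff_axioms)+
  also have "(\<integral>x. partial j (\<lambda>x. ext z x $ i) x * \<phi> x \<partial>lebesgue)
      = (\<integral>x. partial j (\<lambda>x. ext z x $ i) x * \<phi> x \<partial>(lebesgue_on \<Omega>))"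
  proof (rule integral_restrict_\<Omega>[symmetric])
    show "(\<lambda>x. partial j (\<lambda>x. ext z x $ i) x * \<phi> x) \<in> borel_measurable lebesgue"
      using lipc_continuous[OF \<phi>.lipc]
      by (intro borel_measurable_times u.partial_measurable measurable_completion) (simp add: borel_measurable_continuous_onI)
    show "AE x in lebesgue. x \<notin> \<Omega> \<longrightarrow> partial j (\<lambda>x. ext z x $ i) x * \<phi> x = 0"
      using partial_ext_AE_outside[of j i] by eventually_elim auto
  qed
  finally show "(\<integral>x. z x $ i * partial j \<phi> x \<partial>(lebesgue_on \<Omega>)) = - (\<integral>x. cgrad z x $ i $ j * \<phi> x \<partial>(lebesgue_on \<Omega>))"
    by (simp add: cgrad_def)
qed

lemma displacement_H1: "z \<in> H1 \<Omega>"
  using displacement_L2 cgrad_L2 displacement_weak_grad by (auto simp: H1_def)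

lemma wgrad_displacement: "eq_ae \<Omega> (wgrad \<Omega> z) (cgrad z)"
  by (rule has_weak_grad_unique[OF wgrad_H1(1)[OF displacement_H1] cgrad_L2 wgrad_H1(2)[OF displacement_H1] displacement_weak_grad])

text \<open>The squared strain is half the squared gradient plus half the sum of g_ij g_ji, after
  integration. Exchanging derivatives turns the integral of that sum into the integral of the
  squared divergence, which is nonnegative; hence the constant 2.\<close>

lemma Korn: "(l2_norm \<Omega> (wgrad \<Omega> z))\<^sup>2 \<le> 2 * (l2_norm \<Omega> (strain \<Omega> z))\<^sup>2"
proof -
  define g where "g i j x = partial j (\<lambda>x. ext z x $ i) x" for i j x
  have gL2: "g i j \<in> L2 \<Omega>" for i j unfolding g_def[abs_def] by (rule partial_ext_L2)
  have int: "integrable (lebesgue_on \<Omega>) (\<lambda>x. g i j x * g k l x)" for i j k l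
    using L2_integrable_inner[OF gL2 gL2] by simp
  have meas: "g i j \<in> borel_measurable lebesgue" for i j
    unfolding g_def[abs_def] by (rule lipc_diff.partial_measurable[OF ext_lipc_diff[OF z]])
  have restr: "(\<integral>x. g i j x * g k l x \<partial>(lebesgue_on \<Omega>)) = (\<integral>x. g i j x * g k l x \<partial>lebesgue)" for i j k l
  proof (rule integral_restrict_\<Omega>)
    show "AE x in lebesgue. x \<notin> \<Omega> \<longrightarrow> g i j x * g k l x = 0"
      using partial_ext_AE_outside[of j i] by eventually_elim (auto simp: g_def)
  qed (intro borel_measurable_times meas)
  \<comment> \<open>The zero boundary values enter here, through the compactly supported
    extension.\<close>
  have cross: "(\<integral>x. g i j x * g j i x \<partial>(lebesgue_on \<Omega>)) = (\<integral>x. g i i x * g j j x \<partial>(lebesgue_on \<Omega>))" for i j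
    unfolding restr unfolding g_def by (rule Korn_identity[OF ext_lipc_diff[OF z] ext_lipc_diff[OF z]])
  have "(\<Sum>i\<in>UNIV. \<Sum>j\<in>UNIV. \<integral>x. g i j x * g j i x \<partial>(lebesgue_on \<Omega>))
      = (\<integral>x. (\<Sum>i\<in>UNIV. \<Sum>j\<in>UNIV. g i i x * g j j x) \<partial>(lebesgue_on \<Omega>))"
    unfolding cross using int by simp
  also have "\<dots> = (\<integral>x. (\<Sum>i\<in>UNIV. g i i x)\<^sup>2 \<partial>(lebesgue_on \<Omega>))"
    by (simp add: power2_eq_square sum_product)
  also have "\<dots> \<ge> 0" by (rule Bochner_Integration.integral_nonneg) simp
  finally have tr: "(\<Sum>i\<in>UNIV. \<Sum>j\<in>UNIV. \<integral>x. g i j x * g j i x \<partial>(lebesgue_on \<Omega>)) \<ge> 0" .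
  have G: "l2_inner \<Omega> (wgrad \<Omega> z) (wgrad \<Omega> z) = (\<Sum>i\<in>UNIV. \<Sum>j\<in>UNIV. \<integral>x. g i j x * g i j x \<partial>(lebesgue_on \<Omega>))"
  proof -
    have "l2_inner \<Omega> (wgrad \<Omega> z) (wgrad \<Omega> z) = l2_inner \<Omega> (cgrad z) (cgrad z)"
      by (rule l2_inner_cong[OF sets_\<Omega> wgrad_displacement wgrad_displacement])
    also have "\<dots> = (\<integral>x. (\<Sum>i\<in>UNIV. \<Sum>j\<in>UNIV. g i j x * g i j x) \<partial>(lebesgue_on \<Omega>))"
      by (simp add: l2_inner_def inner_vec_def cgrad_def g_def)
    also have "\<dots> = (\<Sum>i\<in>UNIV. \<Sum>j\<in>UNIV. \<integral>x. g i j x * g i j x \<partial>(lebesgue_on \<Omega>))" using int by simp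
    finally show ?thesis .
  qed
  define s where "s x = (1/2) *\<^sub>R (cgrad z x + transpose (cgrad z x))" for x
  have ss: "eq_ae \<Omega> (strain \<Omega> z) s"
    using wgrad_displacement unfolding eq_ae_def by eventually_elim (simp add: strain_def s_def)
  have "l2_inner \<Omega> (strain \<Omega> z) (strain \<Omega> z) = l2_inner \<Omega> s s" by (rule l2_inner_cong[OF sets_\<Omega> ss ss])
  also have "\<dots> = (\<integral>x. (\<Sum>i\<in>UNIV. \<Sum>j\<in>UNIV. (1/2) * (g i j x * g i j x) + (1/2) * (g i j x * g j i x)) \<partial>(lebesgue_on \<Omega>))"
    unfolding l2_inner_def
  proof (rule Bochner_Integration.integral_cong[OF refl])
    fix x
    have "s x \<bullet> s x = (\<Sum>i\<in>UNIV. \<Sum>j\<in>UNIV. (1/4) * (g i j x + g j i x)\<^sup>2)"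
      by (simp add: s_def inner_vec_def cgrad_def g_def transpose_def power2_eq_square sum_distrib_left)
    also have "\<dots> = (\<Sum>i\<in>UNIV. \<Sum>j\<in>UNIV. (1/4) * (g i j x * g i j x) + (1/2) * (g i j x * g j i x) + (1/4) * (g j i x * g j i x))"
      by (intro sum.cong refl) (simp add: power2_eq_square field_simps)
    also have "\<dots> = (\<Sum>i\<in>UNIV. \<Sum>j\<in>UNIV. (1/4) * (g i j x * g i j x) + (1/2) * (g i j x * g j i x))
        + (\<Sum>i\<in>UNIV. \<Sum>j\<in>UNIV. (1/4) * (g j i x * g j i x))"
      by (simp only: sum.distrib)
    also have "(\<Sum>i\<in>UNIV. \<Sum>j\<in>UNIV. (1/4) * (g j i x * g j i x)) = (\<Sum>i\<in>UNIV. \<Sum>j\<in>UNIV. (1/4) * (g i j x * g i j x))"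
      by (rule sum.swap)
    also have "(\<Sum>i\<in>UNIV. \<Sum>j\<in>UNIV. (1/4) * (g i j x * g i j x) + (1/2) * (g i j x * g j i x)) + \<dots>
        = (\<Sum>i\<in>UNIV. \<Sum>j\<in>UNIV. (1/2) * (g i j x * g i j x) + (1/2) * (g i j x * g j i x))"
      by (simp only: sum.distrib[symmetric]) (intro sum.cong refl, simp)
    finally show "s x \<bullet> s x = (\<Sum>i\<in>UNIV. \<Sum>j\<in>UNIV. (1/2) * (g i j x * g i j x) + (1/2) * (g i j x * g j i x))" .
  qed
  also have "\<dots> = (\<Sum>i\<in>UNIV. \<Sum>j\<in>UNIV. (1/2) * (\<integral>x. g i j x * g i j x \<partial>(lebesgue_on \<Omega>))
      + (1/2) * (\<integral>x. g i j x * g j i x \<partial>(lebesgue_on \<Omega>)))"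
    using int by simp
  also have "\<dots> = (1/2) * l2_inner \<Omega> (wgrad \<Omega> z) (wgrad \<Omega> z)
      + (1/2) * (\<Sum>i\<in>UNIV. \<Sum>j\<in>UNIV. \<integral>x. g i j x * g j i x \<partial>(lebesgue_on \<Omega>))"
    unfolding G by (simp only: sum.distrib sum_distrib_left)
  finally show ?thesis using tr by (simp add: l2_norm_squared)
qed

text \<open>Integration by parts against the coordinate x_i shows that the integral of u^2 is -2
  times that of x_i u D_i u. Young's inequality and |x_i| \<le> R let half of the left side be
  absorbed, which yields 4 R^2.\<close>

lemma Poincare:
  assumes R: "R > 0" "\<And>x. x \<in> \<Omega> \<Longrightarrow> norm x \<le> R"
  shows "(l2_norm \<Omega> z)\<^sup>2 \<le> 4 * R\<^sup>2 * (l2_norm \<Omega> (wgrad \<Omega> z))\<^sup>2"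
proof -
  have comp: "(\<integral>x. ext z x $ i * ext z x $ i \<partial>(lebesgue_on \<Omega>))
      \<le> 4 * R\<^sup>2 * (\<integral>x. partial i (\<lambda>x. ext z x $ i) x * partial i (\<lambda>x. ext z x $ i) x \<partial>(lebesgue_on \<Omega>))" for i
  proof -
    define u where "u x = ext z x $ i" for x
    interpret u: lipc_diff u skeleton unfolding u_def[abs_def] by (rule ext_lipc_diff[OF z])
    interpret xu: lipc_diff "\<lambda>x. x $ i * u x" skeleton
    proof
      show "lipc (\<lambda>x. x $ i * u x)"
      proof (rule lipc_mult[OF u.lipc, of 1])
        show "\<bar>x $ i - y $ i\<bar> \<le> 1 * norm (x - y)" for x y :: "real^'d"
          using Finite_Cartesian_Product.norm_nth_le[of "x - y" i] by simp
      qed simp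
      show "negligible skeleton" by (rule negligible_skeleton)
      show "(\<lambda>x. x $ i * u x) differentiable (at x)" if "x \<notin> skeleton" for x
        by (intro differentiable_mult u.diff that bounded_linear_imp_differentiable bounded_linear_vec_nth)
    qed
    have L: "u \<in> L2 \<Omega>" "partial i u \<in> L2 \<Omega>"
      using ext_L2[of i] partial_ext_L2[of i i] by (simp_all add: u_def[abs_def])
    have xuL: "(\<lambda>x. x $ i * u x) \<in> L2 \<Omega>"
    proof (rule L2_bound[OF L(1), where C = R])
      show "(\<lambda>x. x $ i * u x) \<in> borel_measurable (lebesgue_on \<Omega>)"
        by (rule continuous_imp_measurable_lebesgue_on) (rule lipc_continuous[OF xu.lipc])
      have "norm (x $ i * u x) \<le> R * norm (u x)" if "x \<in> \<Omega>" for x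
        using order_trans[OF Finite_Cartesian_Product.norm_nth_le R(2)[OF that], of i]
        by (simp add: abs_mult mult_right_mono)
      then show "AE x in lebesgue_on \<Omega>. norm (x $ i * u x) \<le> R * norm (u x)"
        by (simp add: AE_restrict_space_iff)
    qed
    have int: "integrable (lebesgue_on \<Omega>) (\<lambda>x. u x * u x)"
       "integrable (lebesgue_on \<Omega>) (\<lambda>x. partial i u x * partial i u x)"
       "integrable (lebesgue_on \<Omega>) (\<lambda>x. (x $ i * u x) * partial i u x)"
      using L2_integrable_inner[OF L(1,1)] L2_integrable_inner[OF L(2,2)] L2_integrable_inner[OF xuL L(2)] by simp_all
    have out: "u x = 0" if "x \<notin> \<Omega>" for x using ext_eq_0[OF that] by (simp add: u_def)
    have mu: "u \<in> borel_measurable lebesgue" "(\<lambda>x. x $ i * u x) \<in> borel_measurable lebesgue"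
      using lipc_continuous[OF u.lipc] lipc_continuous[OF xu.lipc]
      by (auto intro!: measurable_completion simp: borel_measurable_continuous_onI)
    have "(\<integral>x. (x $ i * u x) * partial i u x \<partial>(lebesgue_on \<Omega>)) = (\<integral>x. (x $ i * u x) * partial i u x \<partial>lebesgue)"
      by (rule integral_restrict_\<Omega>) (auto simp: out intro!: borel_measurable_times mu u.partial_measurable)
    also have "\<dots> = - (\<integral>x. partial i (\<lambda>x. x $ i * u x) x * u x \<partial>lebesgue)"
      by (rule integral_by_parts_lipc) (rule u.lipc_diff_axioms xu.lipc_diff_axioms)+
    also have "(\<integral>x. partial i (\<lambda>x. x $ i * u x) x * u x \<partial>lebesgue)
        = (\<integral>x. partial i (\<lambda>x. x $ i * u x) x * u x \<partial>(lebesgue_on \<Omega>))"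
      by (rule integral_restrict_\<Omega>[symmetric]) (auto simp: out intro!: borel_measurable_times mu xu.partial_measurable)
    also have "\<dots> = (\<integral>x. (x $ i * u x) * partial i u x + u x * u x \<partial>(lebesgue_on \<Omega>))"
    proof (rule integral_AE_cong[OF sets_\<Omega>])
      have "AE x in lebesgue. partial i (\<lambda>x. x $ i * u x) x * u x = (x $ i * u x) * partial i u x + u x * u x"
        using AE_skeleton
      proof eventually_elim
        case (elim x)
        have "partial i (\<lambda>x. x $ i * u x) x = x $ i * partial i u x + partial i (\<lambda>x. x $ i) x * u x"
          by (intro partial_mult u.diff elim bounded_linear_imp_differentiable bounded_linear_vec_nth)
        then show ?case by (simp add: partial_coordinate algebra_simps)
      qed
      then show "eq_ae \<Omega> (\<lambda>x. partial i (\<lambda>x. x $ i * u x) x * u x) (\<lambda>x. (x $ i * u x) * partial i u x + u x * u x)"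
        by (auto simp: eq_ae_def AE_restrict_space_iff)
    qed
    also have "\<dots> = (\<integral>x. (x $ i * u x) * partial i u x \<partial>(lebesgue_on \<Omega>)) + (\<integral>x. u x * u x \<partial>(lebesgue_on \<Omega>))"
      using int by simp
    finally have "(\<integral>x. u x * u x \<partial>(lebesgue_on \<Omega>)) = (\<integral>x. - 2 * ((x $ i * u x) * partial i u x) \<partial>(lebesgue_on \<Omega>))"
      by simp
    also have "\<dots> \<le> (\<integral>x. (1/2) * (u x * u x) + 2 * R\<^sup>2 * (partial i u x * partial i u x) \<partial>(lebesgue_on \<Omega>))"
    proof (rule integral_mono_AE)
      show "AE x in lebesgue_on \<Omega>. - 2 * ((x $ i * u x) * partial i u x) \<le> (1/2) * (u x * u x) + 2 * R\<^sup>2 * (partial i u x * partial i u x)"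
      proof -
        have "- 2 * ((x $ i * u x) * partial i u x) \<le> (1/2) * (u x * u x) + 2 * R\<^sup>2 * (partial i u x * partial i u x)" if "x \<in> \<Omega>" for x
        proof -
          define a b where "a = u x" and "b = x $ i * partial i u x"
          \<comment> \<open>Young's inequality, weighted such that a^2 gets the coefficient 1/2 and
            can be absorbed.\<close>
          have "0 \<le> (a + 2 * b)\<^sup>2" by simp
          then have "- 2 * (a * b) \<le> (1/2) * (a * a) + 2 * (b * b)"
            by (simp add: power2_eq_square algebra_simps)
          moreover have "b * b \<le> R\<^sup>2 * (partial i u x * partial i u x)"
          proof -
            have "\<bar>x $ i\<bar> \<le> R" using order_trans[OF Finite_Cartesian_Product.norm_nth_le R(2)[OF that], of i] by simp
            then have "(x $ i)\<^sup>2 \<le> R\<^sup>2" by (metis abs_ge_zero power2_abs power_mono)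
            then have "(x $ i)\<^sup>2 * (partial i u x)\<^sup>2 \<le> R\<^sup>2 * (partial i u x)\<^sup>2" by (rule mult_right_mono) simp
            then show ?thesis by (simp add: b_def power2_eq_square mult_ac)
          qed
          ultimately have "- 2 * (a * b) \<le> (1/2) * (a * a) + 2 * R\<^sup>2 * (partial i u x * partial i u x)" by simp
          moreover have "(x $ i * u x) * partial i u x = a * b" by (simp add: a_def b_def)
          ultimately show ?thesis by (simp only: a_def)
        qed
        then show ?thesis by (simp add: AE_restrict_space_iff)
      qed
    qed (use int in auto)
    also have "\<dots> = (1/2) * (\<integral>x. u x * u x \<partial>(lebesgue_on \<Omega>)) + 2 * R\<^sup>2 * (\<integral>x. partial i u x * partial i u x \<partial>(lebesgue_on \<Omega>))"
      using int by simp
    finally have "(\<integral>x. u x * u x \<partial>(lebesgue_on \<Omega>)) \<le> 4 * R\<^sup>2 * (\<integral>x. partial i u x * partial i u x \<partial>(lebesgue_on \<Omega>))"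
      by simp
    then show ?thesis by (simp add: u_def[abs_def])
  qed
  let ?g = "\<lambda>i j x. partial j (\<lambda>x. ext z x $ i) x"
  have intg: "integrable (lebesgue_on \<Omega>) (\<lambda>x. ?g i j x * ?g i j x)" for i j
    using L2_integrable_inner[OF partial_ext_L2[of j i] partial_ext_L2[of j i]] by simp
  have inte: "integrable (lebesgue_on \<Omega>) (\<lambda>x. ext z x $ i * ext z x $ i)" for i
    using L2_integrable_inner[OF ext_L2[of i] ext_L2[of i]] by simp
  have "l2_inner \<Omega> z z = l2_inner \<Omega> (ext z) (ext z)"
    by (rule l2_inner_cong[OF sets_\<Omega>]) (rule eq_ae_sym[OF eq_ae_ext])+
  also have "\<dots> = (\<Sum>i\<in>UNIV. \<integral>x. ext z x $ i * ext z x $ i \<partial>(lebesgue_on \<Omega>))"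
    using inte by (simp add: l2_inner_def inner_vec_def)
  also have "\<dots> \<le> (\<Sum>i\<in>UNIV. 4 * R\<^sup>2 * (\<integral>x. ?g i i x * ?g i i x \<partial>(lebesgue_on \<Omega>)))"
    by (rule sum_mono) (rule comp)
  \<comment> \<open>The estimate of the i-th component uses only its i-th partial derivative; the
    others are added to reach the full gradient.\<close>
  also have "\<dots> \<le> (\<Sum>i\<in>UNIV. 4 * R\<^sup>2 * (\<Sum>j\<in>UNIV. \<integral>x. ?g i j x * ?g i j x \<partial>(lebesgue_on \<Omega>)))"
  proof (intro sum_mono mult_left_mono)
    fix i
    show "(\<integral>x. ?g i i x * ?g i i x \<partial>(lebesgue_on \<Omega>)) \<le> (\<Sum>j\<in>UNIV. \<integral>x. ?g i j x * ?g i j x \<partial>(lebesgue_on \<Omega>))"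
      by (rule member_le_sum) (auto intro: Bochner_Integration.integral_nonneg)
  qed simp
  also have "\<dots> = 4 * R\<^sup>2 * l2_inner \<Omega> (cgrad z) (cgrad z)"
    using intg by (simp add: l2_inner_def inner_vec_def cgrad_def sum_distrib_left)
  also have "l2_inner \<Omega> (cgrad z) (cgrad z) = l2_inner \<Omega> (wgrad \<Omega> z) (wgrad \<Omega> z)"
    by (rule l2_inner_cong[OF sets_\<Omega>]) (rule eq_ae_sym[OF wgrad_displacement])+
  finally show ?thesis by (simp add: l2_norm_squared)
qed

end

text \<open>The factor 4 R^2 + 1 is due to Poincare and the 2 to Korn; the constant is uniform over
  all displacements and degrees.\<close>

lemma h1_norm_le_strain:
  obtains C where "C > 0"
    "\<And>z m. z \<in> displacement_space \<Omega> Th TK m \<Longrightarrow> h1_norm \<Omega> z \<le> C * l2_norm \<Omega> (strain \<Omega> z)"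
proof -
  obtain R where R: "R > 0" "\<And>x. x \<in> \<Omega> \<Longrightarrow> norm x \<le> R"
    using bounded_\<Omega> unfolding bounded_pos by blast
  define C where "C = sqrt (2 * (4 * R\<^sup>2 + 1))"
  have "h1_norm \<Omega> z \<le> C * l2_norm \<Omega> (strain \<Omega> z)" if z: "z \<in> displacement_space \<Omega> Th TK m" for z m
  proof -
    have "(l2_norm \<Omega> z)\<^sup>2 + (l2_norm \<Omega> (wgrad \<Omega> z))\<^sup>2 \<le> (4 * R\<^sup>2 + 1) * (l2_norm \<Omega> (wgrad \<Omega> z))\<^sup>2"
      using Poincare[OF z R] by (simp add: algebra_simps)
    also have "\<dots> \<le> (4 * R\<^sup>2 + 1) * (2 * (l2_norm \<Omega> (strain \<Omega> z))\<^sup>2)"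
      using Korn[OF z] by (intro mult_left_mono) auto
    finally have "h1_norm \<Omega> z \<le> sqrt ((2 * (4 * R\<^sup>2 + 1)) * (l2_norm \<Omega> (strain \<Omega> z))\<^sup>2)"
      unfolding h1_norm_def by (intro real_sqrt_le_mono) (simp add: algebra_simps)
    then show ?thesis by (simp add: C_def real_sqrt_mult)
  qed
  moreover have "C > 0" by (simp add: C_def add_nonneg_pos)
  ultimately show ?thesis using that by blast
qed

end

section \<open>Linear structure and the inverse inequality\<close>

lemma finite_multi_degrees: "finite {k. \<forall>i. k i \<le> (m :: 'd::finite \<Rightarrow> nat) i}"
proof -
  have "{k. \<forall>i. k i \<le> m i} = (\<Pi>\<^sub>E i\<in>UNIV. {..m i})" by (auto simp: PiE_iff)
  then show ?thesis by (simp add: finite_PiE)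
qed

lemma multi_poly_lincomb:
  assumes "\<And>j. j \<in> J \<Longrightarrow> q j \<in> multi_poly m"
  shows "(\<lambda>x. \<Sum>j\<in>J. a j *\<^sub>R q j x) \<in> multi_poly m"
proof -
  have "\<forall>j\<in>J. \<exists>c. q j = (\<lambda>x. \<Sum>k\<in>{k. \<forall>i. k i \<le> m i}. c k * (\<Prod>i\<in>UNIV. (x $ i) ^ k i))"
    using assms unfolding multi_poly_def by blast
  from bchoice[OF this] obtain c
    where c: "\<And>j. j \<in> J \<Longrightarrow> q j = (\<lambda>x. \<Sum>k\<in>{k. \<forall>i. k i \<le> m i}. c j k * (\<Prod>i\<in>UNIV. (x $ i) ^ k i))"
    by blast
  have "(\<Sum>j\<in>J. a j *\<^sub>R q j x) = (\<Sum>k\<in>{k. \<forall>i. k i \<le> m i}. (\<Sum>j\<in>J. a j * c j k) * (\<Prod>i\<in>UNIV. (x $ i) ^ k i))" for x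
  proof -
    have "(\<Sum>j\<in>J. a j *\<^sub>R q j x)
        = (\<Sum>j\<in>J. \<Sum>k\<in>{k. \<forall>i. k i \<le> m i}. a j * c j k * (\<Prod>i\<in>UNIV. (x $ i) ^ k i))"
      by (rule sum.cong) (simp_all add: c sum_distrib_left mult.assoc)
    also have "\<dots> = (\<Sum>k\<in>{k. \<forall>i. k i \<le> m i}. \<Sum>j\<in>J. a j * c j k * (\<Prod>i\<in>UNIV. (x $ i) ^ k i))"
      by (rule sum.swap)
    finally show ?thesis by (simp add: sum_distrib_right)
  qed
  then show ?thesis unfolding multi_poly_def by (intro CollectI exI[of _ "\<lambda>k. \<Sum>j\<in>J. a j * c j k"]) auto
qed

lemma pressure_space_L2: "pressure_space \<Omega> Th TK s \<subseteq> L2 \<Omega>"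
  by (auto simp: pressure_space_def)

lemma pressure_space_lincomb:
  assumes w: "\<And>j. j \<in> J \<Longrightarrow> w j \<in> pressure_space \<Omega> Th TK s"
  shows "(\<lambda>x. \<Sum>j\<in>J. a j *\<^sub>R w j x) \<in> pressure_space \<Omega> Th TK s"
  unfolding pressure_space_def
proof (intro CollectI conjI ballI)
  show "(\<lambda>x. \<Sum>j\<in>J. a j *\<^sub>R w j x) \<in> L2 \<Omega>" using w pressure_space_L2 by (intro L2_lincomb) blast
  fix K assume K: "K \<in> Th"
  have "\<forall>j\<in>J. \<exists>q\<in>Qpoly s. \<forall>x\<in>interior ref_cell. w j (TK K x) = q x"
    using w K unfolding pressure_space_def by blast
  then obtain q where q: "\<And>j. j \<in> J \<Longrightarrow> q j \<in> Qpoly s" "\<And>j x. j \<in> J \<Longrightarrow> x \<in> interior ref_cell \<Longrightarrow> w j (TK K x) = q j x"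
    by metis
  show "\<exists>q\<in>Qpoly s. \<forall>x\<in>interior ref_cell. (\<Sum>j\<in>J. a j *\<^sub>R w j (TK K x)) = q x"
    by (rule bexI[of _ "\<lambda>x. \<Sum>j\<in>J. a j *\<^sub>R q j x"])
       (use q in \<open>auto simp: Qpoly_def intro!: multi_poly_lincomb[unfolded real_scaleR_def]\<close>)
qed

lemma displacement_space_lincomb:
  assumes z: "\<And>j. j \<in> J \<Longrightarrow> z j \<in> displacement_space \<Omega> Th TK m"
  shows "(\<lambda>x. \<Sum>j\<in>J. a j *\<^sub>R z j x) \<in> displacement_space \<Omega> Th TK m"
  unfolding displacement_space_def
proof (intro CollectI conjI ballI allI)
  show "continuous_on (closure \<Omega>) (\<lambda>x. \<Sum>j\<in>J. a j *\<^sub>R z j x)"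
    using z by (intro continuous_intros) (auto simp: displacement_space_def)
  show "(\<Sum>j\<in>J. a j *\<^sub>R z j x) = 0" if "x \<in> frontier \<Omega>" for x
    using z that by (intro sum.neutral) (auto simp: displacement_space_def)
  fix K i assume K: "K \<in> Th"
  have "\<forall>j\<in>J. \<exists>q\<in>Qpoly m. \<forall>x\<in>ref_cell. z j (TK K x) $ i = q x"
    using z K unfolding displacement_space_def by blast
  then obtain q where q: "\<And>j. j \<in> J \<Longrightarrow> q j \<in> Qpoly m" "\<And>j x. j \<in> J \<Longrightarrow> x \<in> ref_cell \<Longrightarrow> z j (TK K x) $ i = q j x"
    by metis
  show "\<exists>q\<in>Qpoly m. \<forall>x\<in>ref_cell. (\<Sum>j\<in>J. a j *\<^sub>R z j (TK K x)) $ i = q x"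
    by (rule bexI[of _ "\<lambda>x. \<Sum>j\<in>J. a j *\<^sub>R q j x"])
       (use q in \<open>auto simp: Qpoly_def intro!: multi_poly_lincomb[unfolded real_scaleR_def]\<close>)
qed

context bounded_open
begin

text \<open>At each point of the reference cell the Piola transform is linear, so the reference
  fields combine with the same coefficients.\<close>

lemma flux_space_lincomb:
  assumes v: "\<And>j. j \<in> J \<Longrightarrow> v j \<in> flux_space \<Omega> Th TK s"
  shows "(\<lambda>x. \<Sum>j\<in>J. a j *\<^sub>R v j x) \<in> flux_space \<Omega> Th TK s"
  unfolding flux_space_def
proof (intro CollectI conjI ballI)
  show "(\<lambda>x. \<Sum>j\<in>J. a j *\<^sub>R v j x) \<in> Hdiv \<Omega>" using v by (intro Hdiv_lincomb) (auto simp: flux_space_def)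
  fix K assume K: "K \<in> Th"
  let ?P = "\<lambda>x y. (1 / det (jacobian (TK K) x)) *\<^sub>R (jacobian (TK K) x *v y)"
  have "\<forall>j\<in>J. \<exists>vr\<in>RT_ref s. \<forall>x\<in>interior ref_cell. v j (TK K x) = ?P x (vr x)"
    using v K unfolding flux_space_def by blast
  then obtain vr where vr: "\<And>j. j \<in> J \<Longrightarrow> vr j \<in> RT_ref s"
    "\<And>j x. j \<in> J \<Longrightarrow> x \<in> interior ref_cell \<Longrightarrow> v j (TK K x) = ?P x (vr j x)" by metis
  show "\<exists>vr\<in>RT_ref s. \<forall>x\<in>interior ref_cell. (\<Sum>j\<in>J. a j *\<^sub>R v j (TK K x)) = ?P x (vr x)"
  proof (rule bexI[of _ "\<lambda>x. \<Sum>j\<in>J. a j *\<^sub>R vr j x"], rule ballI)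
    fix x :: "real^'d" assume x: "x \<in> interior ref_cell"
    have "linear (?P x)" by (intro linear_compose_scale_right matrix_vector_mul_linear)
    then have "?P x (\<Sum>j\<in>J. a j *\<^sub>R vr j x) = (\<Sum>j\<in>J. a j *\<^sub>R ?P x (vr j x))"
      by (simp add: linear_sum linear_scale)
    also have "\<dots> = (\<Sum>j\<in>J. a j *\<^sub>R v j (TK K x))" using vr(2)[OF _ x] by simp
    finally show "(\<Sum>j\<in>J. a j *\<^sub>R v j (TK K x)) = ?P x (\<Sum>j\<in>J. a j *\<^sub>R vr j x)" ..
  next
    show "(\<lambda>x. \<Sum>j\<in>J. a j *\<^sub>R vr j x) \<in> RT_ref s"
      using vr(1) multi_poly_lincomb[of J "\<lambda>j x. vr j x $ i" for i] by (simp add: RT_ref_def)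
  qed
qed

text \<open>
  Gram-Schmidt by induction on the spanning family. The family \<open>e\<close> need not be orthonormal:
  the reproducing property of the earlier members already makes the new vector orthogonal to them.
\<close>

lemma reproducing_family:
  fixes \<psi> :: "'i \<Rightarrow> real^'d \<Rightarrow> 'b::euclidean_space" and V :: "(real^'d \<Rightarrow> 'b) set"
  assumes "finite I" and "V \<subseteq> L2 \<Omega>"
    and "\<And>f g a b. f \<in> V \<Longrightarrow> g \<in> V \<Longrightarrow> (\<lambda>x. a *\<^sub>R f x + b *\<^sub>R g x) \<in> V"
    and "\<And>v. v \<in> V \<Longrightarrow> \<exists>c. eq_ae \<Omega> v (\<lambda>x. \<Sum>i\<in>I. c i *\<^sub>R \<psi> i x)"
  shows "\<exists>n::nat. \<exists>e. (\<forall>k<n. e k \<in> V) \<and>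
    (\<forall>v\<in>V. eq_ae \<Omega> v (\<lambda>x. \<Sum>k<n. l2_inner \<Omega> v (e k) *\<^sub>R e k x))"
  using assms
proof (induction I arbitrary: V rule: finite_induct)
  case empty
  then show ?case by (intro exI[of _ 0]) auto
next
  case (insert i0 I)
  note V = insert.prems
  \<comment> \<open>The members that can be written without \<open>\<psi> i0\<close> form a possibly
    smaller space, which is why \<open>V\<close> is arbitrary in the induction.\<close>
  define V' where "V' = {v \<in> V. \<exists>c. eq_ae \<Omega> v (\<lambda>x. \<Sum>i\<in>I. c i *\<^sub>R \<psi> i x)}"
  have "\<exists>n::nat. \<exists>e. (\<forall>k<n. e k \<in> V') \<and>
    (\<forall>v\<in>V'. eq_ae \<Omega> v (\<lambda>x. \<Sum>k<n. l2_inner \<Omega> v (e k) *\<^sub>R e k x))"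
  proof (rule insert.IH)
    show "V' \<subseteq> L2 \<Omega>" using V by (auto simp: V'_def)
    show "\<exists>c. eq_ae \<Omega> v (\<lambda>x. \<Sum>i\<in>I. c i *\<^sub>R \<psi> i x)" if "v \<in> V'" for v using that by (simp add: V'_def)
    fix f g a b assume fg: "f \<in> V'" "g \<in> V'"
    then obtain c d where cd: "eq_ae \<Omega> f (\<lambda>x. \<Sum>i\<in>I. c i *\<^sub>R \<psi> i x)" "eq_ae \<Omega> g (\<lambda>x. \<Sum>i\<in>I. d i *\<^sub>R \<psi> i x)"
      by (auto simp: V'_def)
    have "eq_ae \<Omega> (\<lambda>x. a *\<^sub>R f x + b *\<^sub>R g x) (\<lambda>x. \<Sum>i\<in>I. (a * c i + b * d i) *\<^sub>R \<psi> i x)"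
      using cd unfolding eq_ae_def
      by eventually_elim (simp add: scaleR_sum_right scaleR_add_left sum.distrib)
    moreover have "(\<lambda>x. a *\<^sub>R f x + b *\<^sub>R g x) \<in> V" using fg by (intro V(2)) (simp_all add: V'_def)
    ultimately show "(\<lambda>x. a *\<^sub>R f x + b *\<^sub>R g x) \<in> V'" unfolding V'_def by (intro CollectI conjI exI)
  qed
  then obtain n :: nat and e where e: "\<And>k. k < n \<Longrightarrow> e k \<in> V'"
    "\<And>v. v \<in> V' \<Longrightarrow> eq_ae \<Omega> v (\<lambda>x. \<Sum>k<n. l2_inner \<Omega> v (e k) *\<^sub>R e k x)" by blast
  have eV: "e k \<in> V" if "k < n" for k using e(1)[OF that] by (simp add: V'_def)
  have eL2: "e k \<in> L2 \<Omega>" if "k < n" for k using eV[OF that] V by auto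
  show ?case
  \<comment> \<open>The functions \<open>\<psi> i\<close> may be dependent, so a member does not
    determine its coefficients; the distinction asks for some representation with a nonzero
    coefficient at \<open>i0\<close>.\<close>
  proof (cases "\<exists>v0\<in>V. \<exists>c. eq_ae \<Omega> v0 (\<lambda>x. \<Sum>i\<in>insert i0 I. c i *\<^sub>R \<psi> i x) \<and> c i0 \<noteq> 0")
    case False
    have "v \<in> V'" if v: "v \<in> V" for v
    proof -
      obtain c where c: "eq_ae \<Omega> v (\<lambda>x. \<Sum>i\<in>insert i0 I. c i *\<^sub>R \<psi> i x)" using V(3)[OF v] by blast
      then have "c i0 = 0" using False v by blast
      then show ?thesis using c v insert.hyps by (auto simp: V'_def)
    qed
    then show ?thesis using e eV by blast
  next
    case True
    then obtain v0 c0 where v0: "v0 \<in> V" "eq_ae \<Omega> v0 (\<lambda>x. \<Sum>i\<in>insert i0 I. c0 i *\<^sub>R \<psi> i x)" "c0 i0 \<noteq> 0"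
      by blast
    have v0L: "v0 \<in> L2 \<Omega>" using v0 V by auto
    \<comment> \<open>A multiple of \<open>v0\<close> removes the coefficient at \<open>i0\<close>,
      so \<open>V\<close> exceeds \<open>V'\<close> by at most one direction.\<close>
    have split: "\<exists>c. (\<lambda>x. 1 *\<^sub>R v x + (- c) *\<^sub>R v0 x) \<in> V'" if v: "v \<in> V" for v
    proof -
      obtain d where d: "eq_ae \<Omega> v (\<lambda>x. \<Sum>i\<in>insert i0 I. d i *\<^sub>R \<psi> i x)" using V(3)[OF v] by blast
      define c where "c = d i0 / c0 i0"
      have c: "d i0 = c * c0 i0" using v0(3) by (simp add: c_def)
      have "eq_ae \<Omega> (\<lambda>x. 1 *\<^sub>R v x + (- c) *\<^sub>R v0 x) (\<lambda>x. \<Sum>i\<in>I. (d i - c * c0 i) *\<^sub>R \<psi> i x)"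
        using d v0(2) unfolding eq_ae_def
        by eventually_elim (use insert.hyps in \<open>simp add: c scaleR_sum_right scaleR_add_right scaleR_diff_left sum_subtractf sum_negf\<close>)
      with V(2)[OF v v0(1), of 1 "- c"] have "(\<lambda>x. 1 *\<^sub>R v x + (- c) *\<^sub>R v0 x) \<in> V'"
        unfolding V'_def by (intro CollectI conjI exI)
      then show ?thesis by (rule exI)
    qed
    \<comment> \<open>The part of \<open>v0\<close> captured by the earlier family; the remainder
      \<open>w\<close> is the new direction.\<close>
    define P where "P x = (\<Sum>k<n. l2_inner \<Omega> v0 (e k) *\<^sub>R e k x)" for x
    define w where "w x = v0 x - P x" for x
    have PV: "(\<lambda>x. v0 x - (\<Sum>k<m. a k *\<^sub>R e k x)) \<in> V" if "m \<le> n" for m a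
      using that
    proof (induction m)
      case (Suc m)
      then have "(\<lambda>x. 1 *\<^sub>R (v0 x - (\<Sum>k<m. a k *\<^sub>R e k x)) + (- a m) *\<^sub>R e m x) \<in> V"
        using eV[of m] by (intro V(2)) auto
      then show ?case by (simp add: algebra_simps)
    qed (simp add: v0)
    have wV: "w \<in> V" using PV[of n "\<lambda>k. l2_inner \<Omega> v0 (e k)"] by (simp add: w_def[abs_def] P_def[abs_def])
    then have wL: "w \<in> L2 \<Omega>" using V by auto
    have PL: "P \<in> L2 \<Omega>" unfolding P_def[abs_def] by (intro L2_lincomb) (use eL2 in auto)
    have orth: "l2_inner \<Omega> (e k) w = 0" if k: "k < n" for k
    proof -
      have "l2_inner \<Omega> (e k) v0 = l2_inner \<Omega> (\<lambda>x. \<Sum>l<n. l2_inner \<Omega> (e k) (e l) *\<^sub>R e l x) v0"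
        by (rule l2_inner_cong[OF sets_\<Omega> e(2)[OF e(1)[OF k]] eq_ae_refl])
      also have "\<dots> = (\<Sum>l<n. l2_inner \<Omega> (e k) (e l) * l2_inner \<Omega> (e l) v0)"
        by (rule l2_inner_lincomb_left) (use eL2 v0L in auto)
      also have "\<dots> = (\<Sum>l<n. l2_inner \<Omega> v0 (e l) * l2_inner \<Omega> (e k) (e l))"
        by (simp add: l2_inner_commute[of \<Omega> v0] mult.commute)
      also have "\<dots> = l2_inner \<Omega> (e k) P"
        unfolding P_def by (rule l2_inner_lincomb_right[symmetric]) (use eL2 k in auto)
      finally have "l2_inner \<Omega> v0 (e k) - l2_inner \<Omega> P (e k) = 0" by (simp add: l2_inner_commute)
      then have "l2_inner \<Omega> w (e k) = 0"
        using l2_inner_diff_left[OF v0L PL eL2[OF k]] by (simp add: w_def[abs_def])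
      then show ?thesis by (simp add: l2_inner_commute)
    qed
    define N where "N = l2_norm \<Omega> w"
    define e' where "e' = e(n := \<lambda>x. (1 / N) *\<^sub>R w x)"
    have e'V: "e' k \<in> V" if "k < Suc n" for k
      using that eV[of k] V(2)[OF wV wV, of "1/N" 0] by (auto simp: e'_def less_Suc_eq)
    have "eq_ae \<Omega> v (\<lambda>x. \<Sum>k<Suc n. l2_inner \<Omega> v (e' k) *\<^sub>R e' k x)" if v: "v \<in> V" for v
    proof -
      have vL: "v \<in> L2 \<Omega>" using v V by auto
      obtain c where c: "(\<lambda>x. 1 *\<^sub>R v x + (- c) *\<^sub>R v0 x) \<in> V'" using split[OF v] by blast
      define v' where "v' x = v x - c *\<^sub>R v0 x" for x
      have v': "v' \<in> V'" using c by (simp add: v'_def[abs_def])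
      have inn: "l2_inner \<Omega> v' (e k) = l2_inner \<Omega> v (e k) - c * l2_inner \<Omega> v0 (e k)" if "k < n" for k
        unfolding v'_def using vL v0L eL2[OF that]
        by (simp add: l2_inner_diff_left L2_scale l2_inner_scale_left)
      have vdec: "eq_ae \<Omega> v (\<lambda>x. (\<Sum>k<n. l2_inner \<Omega> v (e k) *\<^sub>R e k x) + c *\<^sub>R w x)"
        using e(2)[OF v'] unfolding eq_ae_def
      proof eventually_elim
        case (elim x)
        have "(\<Sum>k<n. l2_inner \<Omega> v' (e k) *\<^sub>R e k x) = (\<Sum>k<n. l2_inner \<Omega> v (e k) *\<^sub>R e k x) - c *\<^sub>R P x"
          by (simp add: inn P_def scaleR_sum_right scaleR_diff_left sum_subtractf)
        then show ?case using elim by (simp add: v'_def w_def algebra_simps)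
      qed
      show ?thesis
      proof (cases "N = 0")
        case True
        \<comment> \<open>Here \<open>1 / N\<close> is 0, so the added member is the zero function;
          nothing is lost since \<open>w\<close> vanishes almost everywhere.\<close>
        then have "eq_ae \<Omega> w (\<lambda>x. 0)" using wL by (intro l2_norm_eq_0D) (auto simp: N_def)
        then show ?thesis using vdec unfolding eq_ae_def
          by eventually_elim (simp add: e'_def True)
      next
        case False
        have sumL: "(\<lambda>x. \<Sum>k<n. l2_inner \<Omega> v (e k) *\<^sub>R e k x) \<in> L2 \<Omega>"
          by (rule L2_lincomb) (use eL2 in auto)
        have "l2_inner \<Omega> v w = l2_inner \<Omega> (\<lambda>x. (\<Sum>k<n. l2_inner \<Omega> v (e k) *\<^sub>R e k x) + c *\<^sub>R w x) w"
          by (rule l2_inner_cong[OF sets_\<Omega> vdec eq_ae_refl])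
        also have "\<dots> = l2_inner \<Omega> (\<lambda>x. \<Sum>k<n. l2_inner \<Omega> v (e k) *\<^sub>R e k x) w + c * l2_inner \<Omega> w w"
          by (simp add: l2_inner_add_left[OF sumL L2_scale[OF wL] wL] l2_inner_scale_left)
        also have "l2_inner \<Omega> (\<lambda>x. \<Sum>k<n. l2_inner \<Omega> v (e k) *\<^sub>R e k x) w
            = (\<Sum>k<n. l2_inner \<Omega> v (e k) * l2_inner \<Omega> (e k) w)"
          by (rule l2_inner_lincomb_left) (use eL2 wL in auto)
        also have "(\<Sum>k<n. l2_inner \<Omega> v (e k) * l2_inner \<Omega> (e k) w) + c * l2_inner \<Omega> w w = c * N\<^sup>2" using orth by (simp add: N_def l2_norm_squared)
        finally have vw: "l2_inner \<Omega> v w = c * N\<^sup>2" .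
        have last: "l2_inner \<Omega> v (e' n) *\<^sub>R e' n x = c *\<^sub>R w x" for x
          using False by (simp add: e'_def l2_inner_scale_right vw power2_eq_square)
        have "(\<Sum>k<Suc n. l2_inner \<Omega> v (e' k) *\<^sub>R e' k x) = (\<Sum>k<n. l2_inner \<Omega> v (e k) *\<^sub>R e k x) + c *\<^sub>R w x" for x
        proof -
          have "(\<Sum>k<n. l2_inner \<Omega> v (e' k) *\<^sub>R e' k x) = (\<Sum>k<n. l2_inner \<Omega> v (e k) *\<^sub>R e k x)"
            by (rule sum.cong) (auto simp: e'_def)
          then show ?thesis by (simp only: sum.lessThan_Suc last)
        qed
        then show ?thesis using vdec by (simp only:)
      qed
    qed
    then show ?thesis using e'V by blast
  qed
qed

text \<open>Norm equivalence in finite dimensions: the coefficients of \<open>v\<close> in the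
  reproducing family are inner products, bounded by Cauchy-Schwarz, and the divergences of its
  finitely many members are fixed functions.\<close>

lemma inverse_inequality:
  fixes \<psi> :: "'i \<Rightarrow> real^'d \<Rightarrow> real^'d"
  assumes I: "finite I" and V: "V \<subseteq> Hdiv \<Omega>"
    and lin: "\<And>f g a b. f \<in> V \<Longrightarrow> g \<in> V \<Longrightarrow> (\<lambda>x. a *\<^sub>R f x + b *\<^sub>R g x) \<in> V"
    and rep: "\<And>v. v \<in> V \<Longrightarrow> \<exists>c. eq_ae \<Omega> v (\<lambda>x. \<Sum>i\<in>I. c i *\<^sub>R \<psi> i x)"
  obtains C where "C \<ge> 0" "\<And>v. v \<in> V \<Longrightarrow> l2_norm \<Omega> (wdiv \<Omega> v) \<le> C * l2_norm \<Omega> v"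
proof -
  have VL: "V \<subseteq> L2 \<Omega>" using V Hdiv_L2 by blast
  obtain n :: nat and e where e: "\<And>k. k < n \<Longrightarrow> e k \<in> V"
    "\<And>v. v \<in> V \<Longrightarrow> eq_ae \<Omega> v (\<lambda>x. \<Sum>k<n. l2_inner \<Omega> v (e k) *\<^sub>R e k x)"
    using reproducing_family[OF I VL lin rep] by blast
  define C where "C = (\<Sum>k<n. l2_norm \<Omega> (e k) * l2_norm \<Omega> (wdiv \<Omega> (e k)))"
  have "l2_norm \<Omega> (wdiv \<Omega> v) \<le> C * l2_norm \<Omega> v" if v: "v \<in> V" for v
  proof -
    have "eq_ae \<Omega> (wdiv \<Omega> v) (\<lambda>x. \<Sum>k<n. l2_inner \<Omega> v (e k) *\<^sub>R wdiv \<Omega> (e k) x)"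
      unfolding wdiv_cong[OF e(2)[OF v]] by (rule Hdiv_lincomb(2)) (use e V in auto)
    then have "l2_norm \<Omega> (wdiv \<Omega> v) = l2_norm \<Omega> (\<lambda>x. \<Sum>k<n. l2_inner \<Omega> v (e k) *\<^sub>R wdiv \<Omega> (e k) x)"
      by (rule l2_norm_cong[OF sets_\<Omega>])
    also have "\<dots> \<le> (\<Sum>k<n. \<bar>l2_inner \<Omega> v (e k)\<bar> * l2_norm \<Omega> (wdiv \<Omega> (e k)))"
      by (rule l2_norm_lincomb_le) (use e V wdiv_Hdiv in auto)
    also have "\<dots> \<le> (\<Sum>k<n. (l2_norm \<Omega> v * l2_norm \<Omega> (e k)) * l2_norm \<Omega> (wdiv \<Omega> (e k)))"
      by (intro sum_mono mult_right_mono l2_Cauchy_Schwarz) (use e v VL in auto)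
    also have "\<dots> = C * l2_norm \<Omega> v" by (simp add: C_def sum_distrib_left mult_ac)
    finally show ?thesis .
  qed
  moreover have "C \<ge> 0" unfolding C_def by (intro sum_nonneg) simp
  ultimately show ?thesis using that by blast
qed

end

context meshed_domain
begin

lemma open_cells_disjoint:
  assumes "K \<in> Th" "K' \<in> Th" "y \<in> TK K ` box 0 1" "y \<in> TK K' ` box 0 1"
  shows "K = K'"
proof (rule ccontr)
  assume "K \<noteq> K'"
  then have "interior K \<inter> interior K' = {}" using mesh assms(1,2) by (auto simp: hex_mesh_def)
  moreover have "TK K'' ` box 0 1 \<subseteq> interior K''" if "K'' \<in> Th" for K''
    using open_cell[OF that] TK_bij(2)[OF that] ref_cell_facts(3) by (intro interior_maximal) auto
  ultimately show False using assms by blast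
qed

text \<open>Supplies the finite spanning family: a cell, a component and a monomial of admissible
  degree determine one Piola-transformed field, set to 0 off the open cell. It spans off the
  skeleton, hence almost everywhere.\<close>

lemma flux_space_inverse_inequality:
  obtains C where "C \<ge> 0" "\<And>v. v \<in> flux_space \<Omega> Th TK s \<Longrightarrow> l2_norm \<Omega> (wdiv \<Omega> v) \<le> C * l2_norm \<Omega> v"
proof -
  define S :: "'d \<Rightarrow> ('d \<Rightarrow> nat) set" where "S i = {k. \<forall>j. k j \<le> (if j = i then s + 1 else s)}" for i
  have finS: "finite (S i)" for i unfolding S_def by (rule finite_multi_degrees)
  define I where "I = Th \<times> (Sigma UNIV S)"
  define mon :: "('d \<Rightarrow> nat) \<Rightarrow> real^'d \<Rightarrow> real" where "mon k x = (\<Prod>i\<in>UNIV. (x $ i) ^ k i)" for k x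
  define P where "P K x y = (1 / det (jacobian (TK K) x)) *\<^sub>R (jacobian (TK K) x *v y)" for K and x y :: "real^'d"
  define g where "g K = inv_into ref_cell (TK K)" for K
  define \<psi> where "\<psi> = (\<lambda>(K, i, k) y. if y \<in> TK K ` box 0 1 then P K (g K y) (mon k (g K y) *\<^sub>R axis i 1) else 0)"
  have linP: "linear (P K x)" for K x
    unfolding P_def by (intro linear_compose_scale_right matrix_vector_mul_linear)
  have rep: "\<exists>c. eq_ae \<Omega> v (\<lambda>x. \<Sum>i\<in>I. c i *\<^sub>R \<psi> i x)" if v: "v \<in> flux_space \<Omega> Th TK s" for v
  proof -
    have "\<forall>K\<in>Th. \<exists>vr\<in>RT_ref s. \<forall>x\<in>interior ref_cell. v (TK K x) = P K x (vr x)"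
      using v unfolding flux_space_def P_def by blast
    then obtain vr where vr: "\<And>K. K \<in> Th \<Longrightarrow> vr K \<in> RT_ref s"
      "\<And>K x. K \<in> Th \<Longrightarrow> x \<in> interior ref_cell \<Longrightarrow> v (TK K x) = P K x (vr K x)" by metis
    have "\<forall>K\<in>Th. \<forall>i. \<exists>c. (\<lambda>x. vr K x $ i) = (\<lambda>x. \<Sum>k\<in>S i. c k * mon k x)"
      using vr(1) by (auto simp: RT_ref_def multi_poly_def S_def mon_def)
    then have "\<forall>K\<in>Th. \<exists>c. \<forall>i. (\<lambda>x. vr K x $ i) = (\<lambda>x. \<Sum>k\<in>S i. c i k * mon k x)"
      by (intro ballI choice) blast
    from bchoice[OF this] obtain c
      where c: "\<And>K i. K \<in> Th \<Longrightarrow> (\<lambda>x. vr K x $ i) = (\<lambda>x. \<Sum>k\<in>S i. c K i k * mon k x)" by blast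
    have eq: "v y = (\<Sum>j\<in>I. (\<lambda>(K, i, k). c K i k) j *\<^sub>R \<psi> j y)" if y: "y \<in> \<Omega>" "y \<notin> skeleton" for y
    proof -
      obtain K where K: "K \<in> Th" "y \<in> TK K ` box 0 1"
        using open_cell_cover[of y] y closure_subset[of \<Omega>] by blast
      then obtain u where u: "u \<in> box 0 1" "y = TK K u" by blast
      have ui: "u \<in> interior ref_cell" using u ref_cell_facts(4) by simp
      have gu: "g K y = u"
        using u ref_cell_facts(3) TK_bij(1)[OF K(1)] unfolding g_def by (auto intro: inv_into_f_f)
      have "(\<Sum>j\<in>I. (\<lambda>(K, i, k). c K i k) j *\<^sub>R \<psi> j y)
          = (\<Sum>K'\<in>Th. \<Sum>(i, k)\<in>Sigma UNIV S. c K' i k *\<^sub>R \<psi> (K', i, k) y)"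
        unfolding I_def by (simp add: sum.cartesian_product split_def)
      \<comment> \<open>Open cells are disjoint, so only the cell that contains \<open>y\<close>
        contributes.\<close>
      also have "\<dots> = (\<Sum>K'\<in>Th. if K' = K then (\<Sum>(i, k)\<in>Sigma UNIV S. c K i k *\<^sub>R \<psi> (K, i, k) y) else 0)"
      proof (rule sum.cong[OF refl])
        fix K' assume K': "K' \<in> Th"
        have "y \<notin> TK K' ` box 0 1" if "K' \<noteq> K" using open_cells_disjoint[OF K' K(1) _ K(2)] that by blast
        then show "(\<Sum>(i, k)\<in>Sigma UNIV S. c K' i k *\<^sub>R \<psi> (K', i, k) y)
          = (if K' = K then (\<Sum>(i, k)\<in>Sigma UNIV S. c K i k *\<^sub>R \<psi> (K, i, k) y) else 0)"
          by (auto simp: \<psi>_def intro!: sum.neutral)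
      qed
      also have "\<dots> = (\<Sum>(i, k)\<in>Sigma UNIV S. c K i k *\<^sub>R \<psi> (K, i, k) y)"
        using K(1) Th_cover by simp
      also have "\<dots> = (\<Sum>i\<in>UNIV. \<Sum>k\<in>S i. c K i k *\<^sub>R \<psi> (K, i, k) y)"
        using finS by (subst sum.Sigma) auto
      also have "\<dots> = (\<Sum>i\<in>UNIV. \<Sum>k\<in>S i. P K u ((c K i k * mon k u) *\<^sub>R axis i 1))"
        using K(2) gu by (simp add: \<psi>_def linear_scale[OF linP])
      also have "\<dots> = P K u (\<Sum>i\<in>UNIV. (\<Sum>k\<in>S i. c K i k * mon k u) *\<^sub>R axis i 1)"
        by (simp add: linear_sum[OF linP] scaleR_sum_left)
      also have "(\<Sum>i\<in>UNIV. (\<Sum>k\<in>S i. c K i k * mon k u) *\<^sub>R axis i 1) = vr K u"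
        using basis_expansion[of "vr K u"] fun_cong[OF c[OF K(1)], of u] by (simp add: scalar_mult_eq_scaleR)
      also have "P K u (vr K u) = v y"
        using vr(2)[OF K(1) ui] u(2) by simp
      finally show ?thesis ..
    qed
    have "AE y in lebesgue. y \<in> \<Omega> \<longrightarrow> v y = (\<Sum>j\<in>I. (\<lambda>(K, i, k). c K i k) j *\<^sub>R \<psi> j y)"
      using AE_skeleton by eventually_elim (use eq in blast)
    then show ?thesis
      by (intro exI[of _ "\<lambda>(K, i, k). c K i k"]) (simp add: eq_ae_def AE_restrict_space_iff)
  qed
  have lin: "(\<lambda>x. a *\<^sub>R f x + b *\<^sub>R h x) \<in> flux_space \<Omega> Th TK s"
    if "f \<in> flux_space \<Omega> Th TK s" "h \<in> flux_space \<Omega> Th TK s" for f h a b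
    using flux_space_lincomb[of UNIV "\<lambda>t::bool. if t then f else h" Th TK s "\<lambda>t. if t then a else b"] that
    by (simp add: UNIV_bool add.commute)
  have fin: "finite I" using Th_cover finS by (auto simp: I_def)
  have sub: "flux_space \<Omega> Th TK s \<subseteq> Hdiv \<Omega>" by (auto simp: flux_space_def)
  show ?thesis by (rule inverse_inequality[OF fin sub lin rep]) (auto intro: that)
qed

end

section \<open>Gauss nodes and the time matrix\<close>

text \<open>The index set is a parameter because two sets of nodes occur: \<open>{0..r}\<close> for
  the time basis and \<open>{1..r}\<close> for interpolation at the Gauss nodes alone.\<close>

definition lagrange_poly :: "nat set \<Rightarrow> (nat \<Rightarrow> real) \<Rightarrow> nat \<Rightarrow> real poly" where
  "lagrange_poly A x j = (\<Prod>m\<in>A - {j}. smult (1 / (x j - x m)) [:- x m, 1:])"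

lemma lagrange_eq_poly: "lagrange r tg n j = poly (lagrange_poly {0..r} (tg n) j)"
  by (rule ext) (simp add: lagrange_def lagrange_poly_def poly_prod diff_divide_distrib)

lemma degree_lagrange_poly:
  assumes "finite A" "j \<in> A"
  shows "degree (lagrange_poly A x j) \<le> card A - 1"
proof -
  have "degree (smult c [:a, 1:]) \<le> 1" for c a :: real
    by (rule order_trans[OF degree_smult_le]) simp
  then have "(\<Sum>m\<in>A - {j}. degree (smult (1 / (x j - x m)) [:- x m, 1:])) \<le> (\<Sum>m\<in>A - {j}. 1)"
    by (intro sum_mono) blast
  then show ?thesis
    unfolding lagrange_poly_def using assms by (intro order_trans[OF degree_prod_sum_le]) auto
qed

lemma poly_lagrange_poly:
  assumes "finite A" "inj_on x A" "j \<in> A" "m \<in> A"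
  shows "poly (lagrange_poly A x j) (x m) = (if m = j then 1 else 0)"
proof (cases "m = j")
  case True
  have "poly (smult (1 / (x j - x k)) [:- x k, 1:]) (x m) = 1" if "k \<in> A - {j}" for k
  proof -
    have "x j - x k \<noteq> 0" using that assms by (auto simp: inj_on_def)
    then show ?thesis using True by (simp add: diff_divide_distrib[symmetric])
  qed
  then show ?thesis using True by (simp add: lagrange_poly_def poly_prod)
next
  case False
  then show ?thesis using assms
    by (auto simp: lagrange_poly_def poly_prod intro!: bexI[of _ m])
qed

lemma lagrange_interpolation:
  assumes "finite A" "inj_on x A" "degree q < card A"
  shows "q = (\<Sum>i\<in>A. smult (poly q (x i)) (lagrange_poly A x i))"
proof (rule poly_eqI_degree[of "x ` A"])
  have c: "card (x ` A) = card A" using assms by (simp add: card_image)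
  show "degree q < card (x ` A)" using assms c by simp
  have "degree (\<Sum>i\<in>A. smult (poly q (x i)) (lagrange_poly A x i)) \<le> card A - 1"
    by (rule degree_sum_le) (use assms degree_lagrange_poly in \<open>auto intro: order_trans[OF degree_smult_le]\<close>)
  then show "degree (\<Sum>i\<in>A. smult (poly q (x i)) (lagrange_poly A x i)) < card (x ` A)"
    using assms c by simp
  fix y assume "y \<in> x ` A"
  then obtain m where m: "m \<in> A" "y = x m" by auto
  have "(\<Sum>i\<in>A. poly q (x i) * poly (lagrange_poly A x i) (x m)) = (\<Sum>i\<in>A. if i = m then poly q (x i) else 0)"
    by (rule sum.cong) (use assms m in \<open>auto simp: poly_lagrange_poly\<close>)
  also have "\<dots> = poly q (x m)" using assms m by simp
  finally show "poly q y = poly (\<Sum>i\<in>A. smult (poly q (x i)) (lagrange_poly A x i)) y"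
    using m by (simp add: poly_sum)
qed

lemma integral_poly_pos:
  fixes q :: "real poly"
  assumes "a < b" "q \<noteq> 0" "\<And>t. t \<in> {a..b} \<Longrightarrow> poly q t \<ge> 0"
  shows "integral {a..b} (poly q) > 0"
proof -
  have cont: "continuous_on {a..b} (poly q)" by (intro continuous_intros)
  have ge: "integral {a..b} (poly q) \<ge> 0"
    by (rule integral_nonneg) (use assms cont in \<open>auto intro: integrable_continuous_interval\<close>)
  have "integral {a..b} (poly q) \<noteq> 0"
  proof
    assume "integral {a..b} (poly q) = 0"
    then have "(poly q has_integral 0) (cbox a b)"
      using integrable_continuous_interval[OF cont] by (auto simp: has_integral_integral)
    then have "poly q t = 0" if "t \<in> {a..b}" for t
      using has_integral_0_cbox_imp_0[of a b "poly q" t] cont assms that by auto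
    then have "{a..b} \<subseteq> {t. poly q t = 0}" by auto
    then have "finite {a..b}" using poly_roots_finite[OF \<open>q \<noteq> 0\<close>] finite_subset by blast
    then show False using \<open>a < b\<close> using infinite_Icc by blast
  qed
  with ge show ?thesis by simp
qed

lemma integral_pderiv:
  fixes q :: "real poly"
  assumes "a \<le> b"
  shows "integral {a..b} (poly (pderiv q)) = poly q b - poly q a"
  using assms
  by (intro integral_unique fundamental_theorem_of_calculus)
     (auto simp: has_real_derivative_iff_has_vector_derivative[symmetric]
       intro!: has_field_derivative_at_within[OF poly_DERIV])

text \<open>The quadrature formula only places the nodes in the closed interval. That none is the
  left end makes them distinct from \<open>tg n 0\<close>, so that the time basis is
  nondegenerate.\<close>

lemma gauss_nodes_gt:
  assumes "gauss_formula r a b x w" "a < b" "i \<in> {1..r}"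
  shows "a < x i"
proof (rule ccontr)
  assume "\<not> a < x i"
  then have xi: "x i = a" using assms by (force simp: gauss_formula_def)
  \<comment> \<open>Of degree at most 2 r - 1, nonnegative on the interval and zero at every node,
    including \<open>x i = a\<close>: the formula would give it integral 0.\<close>
  define q where "q = [:-a, 1:] * (\<Prod>m\<in>{1..r} - {i}. [:- x m, 1:])^2"
  have "degree (\<Prod>m\<in>{1..r} - {i}. [:- x m, 1:]) \<le> sum (\<lambda>m. 1) ({1..r} - {i})"
    by (rule order_trans[OF degree_prod_sum_le]) auto
  then have d: "degree (\<Prod>m\<in>{1..r} - {i}. [:- x m, 1:]) \<le> r - 1" using assms by simp
  have "degree ((\<Prod>m\<in>{1..r} - {i}. [:- x m, 1:])^2) \<le> (r - 1) * 2"
    using d by (meson degree_power_le mult_le_mono1 order_trans)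
  then have "degree q \<le> 1 + (r - 1) * 2"
    unfolding q_def by (intro order_trans[OF degree_mult_le] add_mono) auto
  moreover have "1 + (r - 1) * 2 = 2 * r - 1" using assms(3) by (cases r) auto
  ultimately have "degree q \<le> 2 * r - 1" by simp
  then have "integral {a..b} (poly q) = (\<Sum>m=1..r. w m * poly q (x m))"
    using assms by (simp add: gauss_formula_def)
  also have "\<dots> = 0"
  proof (rule sum.neutral, rule ballI)
    fix m assume "m \<in> {1..r}"
    then show "w m * poly q (x m) = 0"
      by (cases "m = i") (auto simp: q_def xi poly_prod intro!: bexI[of _ m])
  qed
  finally have "integral {a..b} (poly q) = 0" .
  moreover have "integral {a..b} (poly q) > 0"
  proof (rule integral_poly_pos[OF \<open>a < b\<close>])
    show "q \<noteq> 0" unfolding q_def by (auto simp del: mult_pCons_left)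
    fix t assume "t \<in> {a..b}"
    then show "poly q t \<ge> 0" unfolding q_def by (auto simp del: mult_pCons_left)
  qed
  ultimately show False by simp
qed

text \<open>The formula is exact for the square of a Lagrange polynomial at the Gauss nodes, of
  degree at most 2 r - 2, and evaluates it to the weight alone.\<close>

lemma gauss_weight_pos:
  assumes "gauss_formula r a b x w" "a < b" "i \<in> {1..r}"
  shows "w i > 0"
proof -
  have inj: "inj_on x {1..r}"
    using assms strict_mono_on_imp_inj_on by (auto simp: gauss_formula_def)
  define l where "l = lagrange_poly {1..r} x i"
  have "degree l \<le> r - 1" unfolding l_def using degree_lagrange_poly[of "{1..r}" i x] assms by simp
  then have "degree (l^2) \<le> (r - 1) * 2" by (meson degree_power_le mult_le_mono1 order_trans)
  then have "degree (l^2) \<le> 2 * r - 1" by simp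
  then have "integral {a..b} (poly (l^2)) = (\<Sum>m=1..r. w m * poly (l^2) (x m))"
    using assms unfolding gauss_formula_def by blast
  also have "\<dots> = (\<Sum>m=1..r. if m = i then w m else 0)"
    by (rule sum.cong) (use inj assms in \<open>auto simp: l_def poly_lagrange_poly\<close>)
  also have "\<dots> = w i" using assms by simp
  finally have *: "integral {a..b} (poly (l^2)) = w i" .
  have "poly l (x i) = 1" using inj assms by (simp add: l_def poly_lagrange_poly)
  then have "l \<noteq> 0" by auto
  then have "integral {a..b} (poly (l^2)) > 0"
    by (intro integral_poly_pos) (use assms in auto)
  with * show ?thesis by simp
qed

context
  fixes T :: real and r N :: nat and tt :: "nat \<Rightarrow> real" and tg gw :: "nat \<Rightarrow> nat \<Rightarrow> real"
    and n :: nat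
  assumes grid: "time_grid T r N tt tg gw" and n: "n \<in> {1..N}"
begin

lemma grid_step: "tt (n - 1) < tt n"
proof -
  have "strict_mono_on {0..N} tt" using grid by (simp add: time_grid_def)
  then show ?thesis using n by (auto simp: strict_mono_on_def)
qed

lemma grid_gauss: "gauss_formula r (tt (n - 1)) (tt n) (tg n) (gw n)" "tg n 0 = tt (n - 1)"
  using grid n by (auto simp: time_grid_def)

lemma grid_nodes_inj: "inj_on (tg n) {0..r}"
proof (rule linorder_inj_onI')
  fix i j assume ij: "i \<in> {0..r}" "j \<in> {0..r}" "i < j"
  have "tg n i < tg n j"
  proof (cases "i = 0")
    case True
    then show ?thesis using gauss_nodes_gt[OF grid_gauss(1) grid_step, of j] ij grid_gauss by auto
  next
    case False
    then show ?thesis using grid_gauss(1) ij by (auto simp: gauss_formula_def strict_mono_on_def)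
  qed
  then show "tg n i \<noteq> tg n j" by simp
qed

lemma lagrange_node:
  "j \<in> {0..r} \<Longrightarrow> m \<in> {0..r} \<Longrightarrow> lagrange r tg n j (tg n m) = (if m = j then 1 else 0)"
  by (simp add: lagrange_eq_poly poly_lagrange_poly grid_nodes_inj)

lemma lagrange_start:
  "j \<in> {0..r} \<Longrightarrow> lagrange r tg n j (tt (n - 1)) = (if j = 0 then 1 else 0)"
  using lagrange_node[of j 0] grid_gauss by auto

lemma \<tau>\<beta>_eq_weight:
  assumes "i \<in> {1..r}"
  shows "\<tau>\<beta> r tg gw n i = gw n i"
proof -
  have "\<tau>\<beta> r tg gw n i = (\<Sum>m=1..r. if m = i then gw n m else 0)"
    unfolding \<tau>\<beta>_def by (rule sum.cong) (use assms in \<open>auto simp: lagrange_node\<close>)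
  then show ?thesis using assms by simp
qed

lemma \<tau>\<beta>_pos: "i \<in> {1..r} \<Longrightarrow> \<tau>\<beta> r tg gw n i > 0"
  using gauss_weight_pos[OF grid_gauss(1) grid_step] \<tau>\<beta>_eq_weight by simp

lemma \<alpha>c_eq_poly:
  "\<alpha>c r tt tg n i j = integral {tt (n - 1)..tt n}
     (poly (pderiv (lagrange_poly {0..r} (tg n) j) * lagrange_poly {0..r} (tg n) i))"
proof -
  have d: "deriv (poly p) t = poly (pderiv p) t" for p :: "real poly" and t
    by (rule DERIV_imp_deriv) (rule poly_DERIV)
  show ?thesis unfolding \<alpha>c_def lagrange_eq_poly poly_mult d ..
qed

lemma \<alpha>c_symmetric_part:
  assumes "i \<in> {1..r}" "j \<in> {1..r}"
  shows "\<alpha>c r tt tg n i j + \<alpha>c r tt tg n j i = lagrange r tg n i (tt n) * lagrange r tg n j (tt n)"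
proof -
  let ?l = "lagrange_poly {0..r} (tg n)"
  have int: "poly q integrable_on {a..b}" for q :: "real poly" and a b
    by (intro integrable_continuous_interval continuous_intros)
  have "\<alpha>c r tt tg n i j + \<alpha>c r tt tg n j i
        = integral {tt (n - 1)..tt n} (\<lambda>t. poly (pderiv (?l j) * ?l i) t + poly (pderiv (?l i) * ?l j) t)"
    unfolding \<alpha>c_eq_poly by (rule integral_add[symmetric]) (rule int)+
  also have "(\<lambda>t. poly (pderiv (?l j) * ?l i) t + poly (pderiv (?l i) * ?l j) t) = poly (pderiv (?l i * ?l j))"
    by (rule ext) (simp add: pderiv_mult algebra_simps)
  also have "integral {tt (n - 1)..tt n} \<dots> = poly (?l i * ?l j) (tt n) - poly (?l i * ?l j) (tt (n - 1))"
    by (rule integral_pderiv) (use grid_step in simp)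
  \<comment> \<open>At the left end only the basis polynomial of index 0 is nonzero, and here
    \<open>i \<ge> 1\<close>.\<close>
  also have "poly (?l i * ?l j) (tt (n - 1)) = 0"
    using lagrange_start[of i] assms by (simp add: lagrange_eq_poly)
  finally show ?thesis by (simp add: lagrange_eq_poly)
qed

text \<open>The derivative of a time basis polynomial has degree at most r - 1, so it is recovered
  from its Gauss values \<alpha>_ij / w_i. Integrating it from the left end to t_m returns the
  Kronecker symbol.\<close>

lemma \<alpha>c_left_inverse:
  "\<exists>d. \<forall>m\<in>{1..r}. \<forall>j\<in>{1..r}. (\<Sum>i=1..r. d m i * \<alpha>c r tt tg n i j) = (if m = j then 1 else (0::real))"
proof -
  let ?l = "lagrange_poly {0..r} (tg n)"
  let ?g = "lagrange_poly {1..r} (tg n)"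
  have inj: "inj_on (tg n) {1..r}" by (rule inj_on_subset[OF grid_nodes_inj]) auto
  \<comment> \<open>Without the division by the weight this is the Runge-Kutta matrix of Gauss
    collocation, scaled by the step size.\<close>
  define d where "d m i = integral {tt (n - 1)..tg n m} (poly (?g i)) / gw n i" for m i
  have "(\<Sum>i=1..r. d m i * \<alpha>c r tt tg n i j) = (if m = j then 1 else 0)"
    if m: "m \<in> {1..r}" and j: "j \<in> {1..r}" for m j
  proof -
    have degl: "degree (?l k) \<le> r" if "k \<in> {0..r}" for k
      using degree_lagrange_poly[of "{0..r}" k "tg n"] that by simp
    have degp: "degree (pderiv (?l j)) \<le> r - 1" using degl[of j] j by (simp add: degree_pderiv diff_le_mono)
    \<comment> \<open>The product has degree at most 2 r - 1, so the formula is exact and only node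
      \<open>i\<close> contributes.\<close>
    have al: "\<alpha>c r tt tg n i j = gw n i * poly (pderiv (?l j)) (tg n i)" if i: "i \<in> {1..r}" for i
    proof -
      have "degree (pderiv (?l j) * ?l i) \<le> (r - 1) + r"
        by (rule order_trans[OF degree_mult_le]) (use degp degl[of i] i in auto)
      then have "degree (pderiv (?l j) * ?l i) \<le> 2 * r - 1" using i by simp
      then have "\<alpha>c r tt tg n i j = (\<Sum>k=1..r. gw n k * poly (pderiv (?l j) * ?l i) (tg n k))"
        using grid_gauss(1) unfolding \<alpha>c_eq_poly gauss_formula_def by blast
      also have "\<dots> = (\<Sum>k=1..r. if k = i then gw n i * poly (pderiv (?l j)) (tg n i) else 0)"
        by (rule sum.cong) (use i in \<open>auto simp: poly_lagrange_poly grid_nodes_inj\<close>)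
      finally show ?thesis using i by simp
    qed
    have int: "poly q integrable_on {a..b}" for q :: "real poly" and a b
      by (intro integrable_continuous_interval continuous_intros)
    have w0: "gw n i \<noteq> 0" if "i \<in> {1..r}" for i
      using gauss_weight_pos[OF grid_gauss(1) grid_step that] by simp
    have "(\<Sum>i=1..r. d m i * \<alpha>c r tt tg n i j)
        = (\<Sum>i=1..r. integral {tt (n - 1)..tg n m} (\<lambda>t. poly (pderiv (?l j)) (tg n i) * poly (?g i) t))"
      by (rule sum.cong) (use w0 in \<open>auto simp: d_def al\<close>)
    also have "\<dots> = integral {tt (n - 1)..tg n m} (\<lambda>t. \<Sum>i=1..r. poly (pderiv (?l j)) (tg n i) * poly (?g i) t)"
      by (rule integral_sum[symmetric]) (use int in \<open>auto intro!: integrable_on_mult_right\<close>)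
    also have "(\<lambda>t. \<Sum>i=1..r. poly (pderiv (?l j)) (tg n i) * poly (?g i) t) = poly (pderiv (?l j))"
      by (subst (3) lagrange_interpolation[of "{1..r}" "tg n"])
         (use inj degp m in \<open>auto simp: poly_sum\<close>)
    also have "integral {tt (n - 1)..tg n m} \<dots> = poly (?l j) (tg n m) - poly (?l j) (tt (n - 1))"
      by (rule integral_pderiv) (use gauss_nodes_gt[OF grid_gauss(1) grid_step m] in simp)
    also have "poly (?l j) (tt (n - 1)) = 0" using lagrange_start[of j] j by (simp add: lagrange_eq_poly)
    finally show ?thesis using m j by (simp add: poly_lagrange_poly grid_nodes_inj)
  qed
  then show ?thesis by blast
qed

end

section \<open>The fixed-stress contraction\<close>

locale biot_scheme = meshed_domain \<Omega> Th TK
  for \<Omega> :: "(real^'d::finite) set" and Th TK +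
  fixes Kp :: "real^'d \<Rightarrow> real^'d^'d" and M b \<mu> lam L :: real and s :: nat
    and Wh :: "(real^'d \<Rightarrow> real) set" and Vh Hh :: "(real^'d \<Rightarrow> real^'d) set"
  assumes perm: "permeability \<Omega> Kp"
    and params: "M > 0" "b > 0" "\<mu> > 0" "lam > 0" "L > 0" "b\<^sup>2 / (2 * lam) \<le> L"
    and Wh: "Wh = pressure_space \<Omega> Th TK s"
    and Vh: "Vh = flux_space \<Omega> Th TK s"
    and Hh: "Hh = displacement_space \<Omega> Th TK (s + 1)"
begin

lemma Wh_L2: "w \<in> Wh \<Longrightarrow> w \<in> L2 \<Omega>" using pressure_space_L2 Wh by blast
lemma Vh_Hdiv: "v \<in> Vh \<Longrightarrow> v \<in> Hdiv \<Omega>" by (simp add: Vh flux_space_def)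
lemma Vh_L2: "v \<in> Vh \<Longrightarrow> v \<in> L2 \<Omega>" by (simp add: Vh_Hdiv Hdiv_L2)
lemma Hh_H1: "z \<in> Hh \<Longrightarrow> z \<in> H1 \<Omega>" unfolding Hh by (rule displacement_H1)
lemma Hh_Hdiv: "z \<in> Hh \<Longrightarrow> z \<in> Hdiv \<Omega>" by (intro H1_Hdiv Hh_H1)

lemma Wh_lincomb: "(\<And>j. j \<in> J \<Longrightarrow> w j \<in> Wh) \<Longrightarrow> (\<lambda>x. \<Sum>j\<in>J. a j *\<^sub>R w j x) \<in> Wh"
  unfolding Wh by (rule pressure_space_lincomb)
lemma Vh_lincomb: "(\<And>j. j \<in> J \<Longrightarrow> v j \<in> Vh) \<Longrightarrow> (\<lambda>x. \<Sum>j\<in>J. a j *\<^sub>R v j x) \<in> Vh"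
  unfolding Vh by (rule flux_space_lincomb)
lemma Hh_lincomb: "(\<And>j. j \<in> J \<Longrightarrow> z j \<in> Hh) \<Longrightarrow> (\<lambda>x. \<Sum>j\<in>J. a j *\<^sub>R z j x) \<in> Hh"
  unfolding Hh by (rule displacement_space_lincomb)

text \<open>Indexing by \<open>bool\<close> makes a difference an instance of a linear combination,
  so that closure and linearity need only be proved for the latter.\<close>

lemma diff_as_lincomb:
  fixes f g :: "'x \<Rightarrow> 'v::real_vector"
  shows "(\<lambda>x. f x - g x) = (\<lambda>x. \<Sum>t\<in>(UNIV::bool set). (if t then 1 else -1) *\<^sub>R (if t then f else g) x)"
  by (simp add: UNIV_bool)

lemma Wh_diff: "f \<in> Wh \<Longrightarrow> g \<in> Wh \<Longrightarrow> (\<lambda>x. f x - g x) \<in> Wh"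
  by (subst diff_as_lincomb) (intro Wh_lincomb, auto)
lemma Vh_diff: "f \<in> Vh \<Longrightarrow> g \<in> Vh \<Longrightarrow> (\<lambda>x. f x - g x) \<in> Vh"
  by (subst diff_as_lincomb) (intro Vh_lincomb, auto)
lemma Hh_diff: "f \<in> Hh \<Longrightarrow> g \<in> Hh \<Longrightarrow> (\<lambda>x. f x - g x) \<in> Hh"
  by (subst diff_as_lincomb) (intro Hh_lincomb, auto)

lemma wdiv_lincomb_inner:
  assumes "\<And>j. j \<in> J \<Longrightarrow> v j \<in> Hdiv \<Omega>" "h \<in> L2 \<Omega>"
  shows "l2_inner \<Omega> (wdiv \<Omega> (\<lambda>x. \<Sum>j\<in>J. c j *\<^sub>R v j x)) h = (\<Sum>j\<in>J. c j * l2_inner \<Omega> (wdiv \<Omega> (v j)) h)"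
proof -
  have "l2_inner \<Omega> (wdiv \<Omega> (\<lambda>x. \<Sum>j\<in>J. c j *\<^sub>R v j x)) h = l2_inner \<Omega> (\<lambda>x. \<Sum>j\<in>J. c j *\<^sub>R wdiv \<Omega> (v j) x) h"
    by (rule l2_inner_cong[OF sets_\<Omega> _ eq_ae_refl], rule Hdiv_lincomb(2)) (rule assms)
  also have "\<dots> = (\<Sum>j\<in>J. c j * l2_inner \<Omega> (wdiv \<Omega> (v j)) h)"
    by (rule l2_inner_lincomb_left) (use assms wdiv_Hdiv in auto)
  finally show ?thesis .
qed

lemma wdiv_diff_inner:
  assumes "f \<in> Hdiv \<Omega>" "g \<in> Hdiv \<Omega>" "h \<in> L2 \<Omega>"
  shows "l2_inner \<Omega> (wdiv \<Omega> (\<lambda>x. f x - g x)) h = l2_inner \<Omega> (wdiv \<Omega> f) h - l2_inner \<Omega> (wdiv \<Omega> g) h"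
  unfolding diff_as_lincomb[of f g]
  by (subst wdiv_lincomb_inner) (use assms in \<open>auto simp: UNIV_bool\<close>)

text \<open>The equation is linear in the pair of pressure and displacement, so it passes to the
  time combinations S_p and S_u and to the values at the end of the interval.\<close>

lemma mechanics_eq_lincomb:
  assumes "\<And>j. j \<in> J \<Longrightarrow> P j \<in> L2 \<Omega> \<and> U j \<in> Hh \<and> mechanics_eq \<Omega> b \<mu> lam Hh (P j) (U j)"
  shows "mechanics_eq \<Omega> b \<mu> lam Hh (\<lambda>x. \<Sum>j\<in>J. c j *\<^sub>R P j x) (\<lambda>x. \<Sum>j\<in>J. c j *\<^sub>R U j x)"
  unfolding mechanics_eq_def
proof
  fix z assume z: "z \<in> Hh"
  have zL: "strain \<Omega> z \<in> L2 \<Omega>" "wdiv \<Omega> z \<in> L2 \<Omega>"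
    using strain_L2[OF Hh_H1[OF z]] wdiv_Hdiv(1)[OF Hh_Hdiv[OF z]] by auto
  have e: "l2_inner \<Omega> (strain \<Omega> (\<lambda>x. \<Sum>j\<in>J. c j *\<^sub>R U j x)) (strain \<Omega> z)
      = (\<Sum>j\<in>J. c j * l2_inner \<Omega> (strain \<Omega> (U j)) (strain \<Omega> z))"
  proof -
    have "l2_inner \<Omega> (strain \<Omega> (\<lambda>x. \<Sum>j\<in>J. c j *\<^sub>R U j x)) (strain \<Omega> z)
      = l2_inner \<Omega> (\<lambda>x. \<Sum>j\<in>J. c j *\<^sub>R strain \<Omega> (U j) x) (strain \<Omega> z)"
      by (rule l2_inner_cong[OF sets_\<Omega> _ eq_ae_refl], rule strain_lincomb) (use assms Hh_H1 in auto)
    also have "\<dots> = (\<Sum>j\<in>J. c j * l2_inner \<Omega> (strain \<Omega> (U j)) (strain \<Omega> z))"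
      by (rule l2_inner_lincomb_left) (use assms zL strain_L2 Hh_H1 in auto)
    finally show ?thesis .
  qed
  have d: "l2_inner \<Omega> (wdiv \<Omega> (\<lambda>x. \<Sum>j\<in>J. c j *\<^sub>R U j x)) (wdiv \<Omega> z)
      = (\<Sum>j\<in>J. c j * l2_inner \<Omega> (wdiv \<Omega> (U j)) (wdiv \<Omega> z))"
    by (rule wdiv_lincomb_inner) (use assms zL Hh_Hdiv in auto)
  have p: "l2_inner \<Omega> (\<lambda>x. \<Sum>j\<in>J. c j *\<^sub>R P j x) (wdiv \<Omega> z) = (\<Sum>j\<in>J. c j * l2_inner \<Omega> (P j) (wdiv \<Omega> z))"
    by (rule l2_inner_lincomb_left) (use assms zL in auto)
  have "(\<Sum>j\<in>J. c j * (2 * \<mu> * l2_inner \<Omega> (strain \<Omega> (U j)) (strain \<Omega> z)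
      + lam * l2_inner \<Omega> (wdiv \<Omega> (U j)) (wdiv \<Omega> z) - b * l2_inner \<Omega> (P j) (wdiv \<Omega> z))) = 0"
    using assms z by (intro sum.neutral) (auto simp: mechanics_eq_def)
  then show "2 * \<mu> * l2_inner \<Omega> (strain \<Omega> (\<lambda>x. \<Sum>j\<in>J. c j *\<^sub>R U j x)) (strain \<Omega> z)
      + lam * l2_inner \<Omega> (wdiv \<Omega> (\<lambda>x. \<Sum>j\<in>J. c j *\<^sub>R U j x)) (wdiv \<Omega> z)
      - b * l2_inner \<Omega> (\<lambda>x. \<Sum>j\<in>J. c j *\<^sub>R P j x) (wdiv \<Omega> z) = 0"
    unfolding e d p by (simp add: sum_distrib_left sum.distrib sum_subtractf algebra_simps)
qed

lemma mechanics_eq_diff: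
  assumes "P \<in> L2 \<Omega>" "P' \<in> L2 \<Omega>" "U \<in> Hh" "U' \<in> Hh"
    "mechanics_eq \<Omega> b \<mu> lam Hh P U" "mechanics_eq \<Omega> b \<mu> lam Hh P' U'"
  shows "mechanics_eq \<Omega> b \<mu> lam Hh (\<lambda>x. P x - P' x) (\<lambda>x. U x - U' x)"
  unfolding diff_as_lincomb[of P P'] diff_as_lincomb[of U U']
  by (rule mechanics_eq_lincomb) (use assms in auto)

text \<open>For errors of index 0: the scheme imposes no equation there, but vanishing errors
  satisfy it.\<close>

lemma mechanics_eq_null:
  assumes "eq_ae \<Omega> P (\<lambda>x. 0)" "eq_ae \<Omega> U (\<lambda>x. 0)"
  shows "mechanics_eq \<Omega> b \<mu> lam Hh P U"
proof -
  have "mechanics_eq \<Omega> b \<mu> lam Hh (\<lambda>x. 0) (\<lambda>x. 0)"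
    using mechanics_eq_lincomb[of "{}" "\<lambda>_ _. 0" "\<lambda>_ _. 0"] by simp
  then show ?thesis
    using strain_cong[OF assms(2)] wdiv_cong[OF assms(2)] l2_inner_cong[OF sets_\<Omega> assms(1) eq_ae_refl]
    by (simp add: mechanics_eq_def)
qed

lemma flux_eq_lincomb:
  assumes "\<And>j. j \<in> J \<Longrightarrow> P j \<in> L2 \<Omega> \<and> Q j \<in> Vh \<and> flux_eq \<Omega> Kp Vh (P j) (Q j)"
  shows "flux_eq \<Omega> Kp Vh (\<lambda>x. \<Sum>j\<in>J. c j *\<^sub>R P j x) (\<lambda>x. \<Sum>j\<in>J. c j *\<^sub>R Q j x)"
  unfolding flux_eq_def
proof
  fix v assume v: "v \<in> Vh"
  obtain K2: "\<And>v. v \<in> L2 \<Omega> \<Longrightarrow> (\<lambda>x. matrix_inv (Kp x) *v v x) \<in> L2 \<Omega>"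
    using permeability_inverse[OF perm] by metis
  have "(\<lambda>x. matrix_inv (Kp x) *v (\<Sum>j\<in>J. c j *\<^sub>R Q j x)) = (\<lambda>x. \<Sum>j\<in>J. c j *\<^sub>R (matrix_inv (Kp x) *v Q j x))"
  proof
    fix x
    have "linear ((*v) (matrix_inv (Kp x)))" by (rule matrix_vector_mul_linear)
    then show "matrix_inv (Kp x) *v (\<Sum>j\<in>J. c j *\<^sub>R Q j x) = (\<Sum>j\<in>J. c j *\<^sub>R (matrix_inv (Kp x) *v Q j x))"
      by (simp add: linear_sum linear_scale)
  qed
  then have e: "l2_inner \<Omega> (\<lambda>x. matrix_inv (Kp x) *v (\<Sum>j\<in>J. c j *\<^sub>R Q j x)) v
      = (\<Sum>j\<in>J. c j * l2_inner \<Omega> (\<lambda>x. matrix_inv (Kp x) *v Q j x) v)"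
    using assms K2 v by (simp add: l2_inner_lincomb_left Vh_L2)
  have p: "l2_inner \<Omega> (\<lambda>x. \<Sum>j\<in>J. c j *\<^sub>R P j x) (wdiv \<Omega> v) = (\<Sum>j\<in>J. c j * l2_inner \<Omega> (P j) (wdiv \<Omega> v))"
    by (rule l2_inner_lincomb_left) (use assms v wdiv_Hdiv Vh_Hdiv in auto)
  have "(\<Sum>j\<in>J. c j * (l2_inner \<Omega> (\<lambda>x. matrix_inv (Kp x) *v Q j x) v - l2_inner \<Omega> (P j) (wdiv \<Omega> v))) = 0"
    using assms v by (intro sum.neutral) (auto simp: flux_eq_def)
  then show "l2_inner \<Omega> (\<lambda>x. matrix_inv (Kp x) *v (\<Sum>j\<in>J. c j *\<^sub>R Q j x)) v
      - l2_inner \<Omega> (\<lambda>x. \<Sum>j\<in>J. c j *\<^sub>R P j x) (wdiv \<Omega> v) = 0"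
    unfolding e p by (simp add: sum_subtractf right_diff_distrib)
qed

lemma flux_eq_diff:
  assumes "P \<in> L2 \<Omega>" "P' \<in> L2 \<Omega>" "Q \<in> Vh" "Q' \<in> Vh"
    "flux_eq \<Omega> Kp Vh P Q" "flux_eq \<Omega> Kp Vh P' Q'"
  shows "flux_eq \<Omega> Kp Vh (\<lambda>x. P x - P' x) (\<lambda>x. Q x - Q' x)"
  unfolding diff_as_lincomb[of P P'] diff_as_lincomb[of Q Q']
  by (rule flux_eq_lincomb) (use assms in auto)

lemma flux_eq_null:
  assumes "eq_ae \<Omega> P (\<lambda>x. 0)" "eq_ae \<Omega> Q (\<lambda>x. 0)"
  shows "flux_eq \<Omega> Kp Vh P Q"
proof -
  have "eq_ae \<Omega> (\<lambda>x. matrix_inv (Kp x) *v Q x) (\<lambda>x. 0)"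
    using assms(2) unfolding eq_ae_def by eventually_elim simp
  then show ?thesis
    using l2_inner_cong[OF sets_\<Omega> _ eq_ae_refl] assms(1) by (simp add: flux_eq_def l2_inner_cong[OF sets_\<Omega> _ eq_ae_refl])
qed

text \<open>Test with \<open>U\<close> itself. Dropping the strain gives the first bound; the second
  inserts its consequence |div U| \<le> b |P| / lam into the right-hand side and drops the
  divergence instead.\<close>

lemma mechanics_eq_bounds:
  assumes U: "U \<in> Hh" and P: "P \<in> L2 \<Omega>" and eq: "mechanics_eq \<Omega> b \<mu> lam Hh P U"
  shows "lam * (l2_norm \<Omega> (wdiv \<Omega> U))\<^sup>2 \<le> b * l2_inner \<Omega> P (wdiv \<Omega> U)"
    and "(l2_norm \<Omega> (strain \<Omega> U))\<^sup>2 \<le> b\<^sup>2 / (2 * \<mu> * lam) * (l2_norm \<Omega> P)\<^sup>2"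
proof -
  let ?d = "l2_norm \<Omega> (wdiv \<Omega> U)" and ?e = "l2_norm \<Omega> (strain \<Omega> U)" and ?p = "l2_norm \<Omega> P"
  have "2 * \<mu> * ?e\<^sup>2 + lam * ?d\<^sup>2 - b * l2_inner \<Omega> P (wdiv \<Omega> U) = 0"
    using eq U unfolding mechanics_eq_def l2_norm_squared by blast
  then have id: "2 * \<mu> * ?e\<^sup>2 + lam * ?d\<^sup>2 = b * l2_inner \<Omega> P (wdiv \<Omega> U)" by simp
  moreover have "0 \<le> 2 * \<mu> * ?e\<^sup>2" "0 \<le> lam * ?d\<^sup>2" using params by simp_all
  ultimately show 1: "lam * ?d\<^sup>2 \<le> b * l2_inner \<Omega> P (wdiv \<Omega> U)" by linarith
  have "l2_inner \<Omega> P (wdiv \<Omega> U) \<le> ?p * ?d"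
    using l2_Cauchy_Schwarz[OF P wdiv_Hdiv(1)[OF Hh_Hdiv[OF U]]] by simp
  then have pd: "b * l2_inner \<Omega> P (wdiv \<Omega> U) \<le> b * (?p * ?d)" using params by (intro mult_left_mono) auto
  have "lam * ?d * ?d \<le> (b * ?p) * ?d" using 1 pd by (simp add: power2_eq_square mult_ac)
  then have "lam * ?d \<le> b * ?p"
    using params by (cases "?d = 0") (auto simp: mult_le_cancel_right order_less_le)
  then have "?d \<le> b * ?p / lam" using params by (simp add: field_simps)
  then have "b * ?p * ?d \<le> b * ?p * (b * ?p / lam)" using params by (intro mult_left_mono) auto
  then have "2 * \<mu> * ?e\<^sup>2 \<le> b * ?p * (b * ?p / lam)" using id pd \<open>0 \<le> lam * ?d\<^sup>2\<close> by linarith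
  then have "?e\<^sup>2 \<le> b * ?p * (b * ?p / lam) / (2 * \<mu>)" using params by (simp add: field_simps)
  also have "\<dots> = b\<^sup>2 / (2 * \<mu> * lam) * ?p\<^sup>2" by (simp add: power2_eq_square field_simps)
  finally show "?e\<^sup>2 \<le> b\<^sup>2 / (2 * \<mu> * lam) * ?p\<^sup>2" .
qed

lemma mechanics_stability:
  obtains C where "C \<ge> 0"
    "\<And>P U. P \<in> L2 \<Omega> \<Longrightarrow> U \<in> Hh \<Longrightarrow> mechanics_eq \<Omega> b \<mu> lam Hh P U \<Longrightarrow> h1_norm \<Omega> U \<le> C * l2_norm \<Omega> P"
proof -
  obtain C where C: "C > 0" "\<And>z. z \<in> Hh \<Longrightarrow> h1_norm \<Omega> z \<le> C * l2_norm \<Omega> (strain \<Omega> z)"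
    using h1_norm_le_strain unfolding Hh by metis
  define c where "c = b\<^sup>2 / (2 * \<mu> * lam)"
  have "h1_norm \<Omega> U \<le> (C * sqrt c) * l2_norm \<Omega> P"
    if h: "P \<in> L2 \<Omega>" "U \<in> Hh" "mechanics_eq \<Omega> b \<mu> lam Hh P U" for P U
  proof -
    have "sqrt ((l2_norm \<Omega> (strain \<Omega> U))\<^sup>2) \<le> sqrt (c * (l2_norm \<Omega> P)\<^sup>2)"
      unfolding c_def by (rule real_sqrt_le_mono) (rule mechanics_eq_bounds(2)[OF h(2,1,3)])
    then have "l2_norm \<Omega> (strain \<Omega> U) \<le> sqrt c * l2_norm \<Omega> P" by (simp add: real_sqrt_mult)
    then have "C * l2_norm \<Omega> (strain \<Omega> U) \<le> C * (sqrt c * l2_norm \<Omega> P)" using C(1) by (intro mult_left_mono) auto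
    then show ?thesis using C(2)[OF h(2)] by (simp add: mult.assoc)
  qed
  moreover have "C * sqrt c \<ge> 0" using C params by (simp add: c_def)
  ultimately show ?thesis using that by blast
qed

text \<open>Test with \<open>Q\<close> itself: coercivity of the inverse permeability bounds c |Q|^2
  by |P| |div Q|, and the inverse inequality lets one power of |Q| be cancelled.\<close>

lemma flux_stability:
  obtains C where "C \<ge> 0"
    "\<And>P Q. P \<in> L2 \<Omega> \<Longrightarrow> Q \<in> Vh \<Longrightarrow> flux_eq \<Omega> Kp Vh P Q \<Longrightarrow> hdiv_norm \<Omega> Q \<le> C * l2_norm \<Omega> P"
proof -
  obtain B where B: "B \<ge> 0" "\<And>v. v \<in> Vh \<Longrightarrow> l2_norm \<Omega> (wdiv \<Omega> v) \<le> B * l2_norm \<Omega> v"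
    using flux_space_inverse_inequality[of s] unfolding Vh by metis
  obtain c where c: "c > 0" "\<And>v. v \<in> L2 \<Omega> \<Longrightarrow> c * l2_inner \<Omega> v v \<le> l2_inner \<Omega> (\<lambda>x. matrix_inv (Kp x) *v v x) v"
    using permeability_inverse[OF perm] by metis
  have "hdiv_norm \<Omega> Q \<le> (sqrt (1 + B\<^sup>2) * (B / c)) * l2_norm \<Omega> P"
    if h: "P \<in> L2 \<Omega>" "Q \<in> Vh" "flux_eq \<Omega> Kp Vh P Q" for P Q
  proof -
    let ?q = "l2_norm \<Omega> Q" and ?p = "l2_norm \<Omega> P" and ?d = "l2_norm \<Omega> (wdiv \<Omega> Q)"
    have "c * ?q\<^sup>2 \<le> l2_inner \<Omega> (\<lambda>x. matrix_inv (Kp x) *v Q x) Q"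
      using c(2)[OF Vh_L2[OF h(2)]] by (simp add: l2_norm_squared)
    also have "\<dots> = l2_inner \<Omega> P (wdiv \<Omega> Q)" using h by (auto simp: flux_eq_def)
    also have "\<dots> \<le> ?p * ?d" using l2_Cauchy_Schwarz[OF h(1) wdiv_Hdiv(1)[OF Vh_Hdiv[OF h(2)]]] by simp
    also have "\<dots> \<le> ?p * (B * ?q)" using B(2)[OF h(2)] by (intro mult_left_mono) auto
    finally have "(c * ?q) * ?q \<le> (B * ?p) * ?q" by (simp add: power2_eq_square mult_ac)
    then have "c * ?q \<le> B * ?p"
      using B c by (cases "?q = 0") (auto simp: mult_le_cancel_right order_less_le)
    then have q: "?q \<le> (B / c) * ?p" using c by (simp add: field_simps)
    have "?d\<^sup>2 \<le> (B * ?q)\<^sup>2" using B(2)[OF h(2)] by (intro power_mono) auto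
    then have "?q\<^sup>2 + ?d\<^sup>2 \<le> (1 + B\<^sup>2) * ?q\<^sup>2" by (simp add: power_mult_distrib algebra_simps)
    then have "hdiv_norm \<Omega> Q \<le> sqrt ((1 + B\<^sup>2) * ?q\<^sup>2)" unfolding hdiv_norm_def by (rule real_sqrt_le_mono)
    also have "\<dots> = sqrt (1 + B\<^sup>2) * ?q" by (simp add: real_sqrt_mult)
    also have "\<dots> \<le> sqrt (1 + B\<^sup>2) * ((B / c) * ?p)" by (intro mult_left_mono q) simp
    finally show ?thesis by (simp add: mult.assoc)
  qed
  moreover have "sqrt (1 + B\<^sup>2) * (B / c) \<ge> 0" using B c by simp
  ultimately show ?thesis using that by blast
qed

text \<open>
  Since \<open>\<alpha> i j + \<alpha> j i = l i * l j\<close>, the flux term of the error identity is half the squared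
  \<open>K\<^sup>-\<^sup>1\<close>-norm of the flux error at the end of the time interval.
\<close>

lemma flux_term_nonneg:
  assumes q: "\<And>j. j \<in> I \<Longrightarrow> q j \<in> Vh" and sym: "\<And>i j. i \<in> I \<Longrightarrow> j \<in> I \<Longrightarrow> \<alpha> i j + \<alpha> j i = l i * (l j :: real)"
  shows "(\<Sum>i\<in>I. \<Sum>j\<in>I. \<alpha> i j * l2_inner \<Omega> (\<lambda>x. matrix_inv (Kp x) *v q j x) (q i)) \<ge> 0"
proof -
  obtain c where c: "c > 0" and K2: "\<And>v. v \<in> L2 \<Omega> \<Longrightarrow> (\<lambda>x. matrix_inv (Kp x) *v v x) \<in> L2 \<Omega>"
    and Ksym: "\<And>v w. v \<in> L2 \<Omega> \<Longrightarrow> w \<in> L2 \<Omega> \<Longrightarrow> \<Omega> \<in> sets lebesgue \<Longrightarrow>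
      l2_inner \<Omega> (\<lambda>x. matrix_inv (Kp x) *v v x) w = l2_inner \<Omega> (\<lambda>x. matrix_inv (Kp x) *v w x) v"
    and Kpos: "\<And>v. v \<in> L2 \<Omega> \<Longrightarrow> c * l2_inner \<Omega> v v \<le> l2_inner \<Omega> (\<lambda>x. matrix_inv (Kp x) *v v x) v"
    by (rule permeability_inverse[OF perm]) blast
  define B where "B i j = l2_inner \<Omega> (\<lambda>x. matrix_inv (Kp x) *v q j x) (q i)" for i j
  have qL: "q j \<in> L2 \<Omega>" if "j \<in> I" for j using q[OF that] by (rule Vh_L2)
  have Bsym: "B i j = B j i" if "i \<in> I" "j \<in> I" for i j
    unfolding B_def by (rule Ksym) (use qL that in auto)
  \<comment> \<open>Twice the sum is the sum plus its transpose; the symmetry of \<open>B\<close>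
    lets the coefficients be symmetrised.\<close>
  have "2 * (\<Sum>i\<in>I. \<Sum>j\<in>I. \<alpha> i j * B i j) = (\<Sum>i\<in>I. \<Sum>j\<in>I. \<alpha> i j * B i j) + (\<Sum>i\<in>I. \<Sum>j\<in>I. \<alpha> j i * B j i)"
    using sum.swap[of "\<lambda>i j. \<alpha> i j * B i j" I I] by simp
  also have "\<dots> = (\<Sum>i\<in>I. \<Sum>j\<in>I. (\<alpha> i j + \<alpha> j i) * B i j)"
    by (simp only: sum.distrib[symmetric]) (intro sum.cong refl, simp add: Bsym distrib_right)
  also have "\<dots> = (\<Sum>i\<in>I. l i * (\<Sum>j\<in>I. l j * B i j))"
    by (intro sum.cong refl) (simp add: sym sum_distrib_left mult.assoc)
  also have "\<dots> = l2_inner \<Omega> (\<lambda>x. matrix_inv (Kp x) *v (\<Sum>j\<in>I. l j *\<^sub>R q j x)) (\<lambda>x. \<Sum>i\<in>I. l i *\<^sub>R q i x)"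
  proof -
    have eq: "(\<lambda>x. matrix_inv (Kp x) *v (\<Sum>j\<in>I. l j *\<^sub>R q j x)) = (\<lambda>x. \<Sum>j\<in>I. l j *\<^sub>R (matrix_inv (Kp x) *v q j x))"
    proof
      fix x
      have "linear ((*v) (matrix_inv (Kp x)))" by (rule matrix_vector_mul_linear)
      then show "matrix_inv (Kp x) *v (\<Sum>j\<in>I. l j *\<^sub>R q j x) = (\<Sum>j\<in>I. l j *\<^sub>R (matrix_inv (Kp x) *v q j x))"
        by (simp add: linear_sum linear_scale)
    qed
    have KL: "(\<lambda>x. \<Sum>j\<in>I. l j *\<^sub>R (matrix_inv (Kp x) *v q j x)) \<in> L2 \<Omega>"
      by (rule L2_lincomb) (use qL K2 in auto)
    have "l2_inner \<Omega> (\<lambda>x. \<Sum>j\<in>I. l j *\<^sub>R (matrix_inv (Kp x) *v q j x)) (\<lambda>x. \<Sum>i\<in>I. l i *\<^sub>R q i x)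
        = (\<Sum>i\<in>I. l i * l2_inner \<Omega> (\<lambda>x. \<Sum>j\<in>I. l j *\<^sub>R (matrix_inv (Kp x) *v q j x)) (q i))"
      by (rule l2_inner_lincomb_right) (use qL KL in auto)
    also have "\<dots> = (\<Sum>i\<in>I. l i * (\<Sum>j\<in>I. l j * B i j))"
    proof (intro sum.cong refl arg_cong2[where f = "(*)"])
      fix i assume "i \<in> I"
      then show "l2_inner \<Omega> (\<lambda>x. \<Sum>j\<in>I. l j *\<^sub>R (matrix_inv (Kp x) *v q j x)) (q i) = (\<Sum>j\<in>I. l j * B i j)"
        unfolding B_def by (intro l2_inner_lincomb_left) (use qL K2 in auto)
    qed
    finally show ?thesis by (simp add: eq)
  qed
  also have "\<dots> \<ge> 0"
  proof -
    have "(\<lambda>x. \<Sum>i\<in>I. l i *\<^sub>R q i x) \<in> L2 \<Omega>" by (rule L2_lincomb) (use qL in auto)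
    from Kpos[OF this] show ?thesis
      using c l2_inner_self_nonneg[of \<Omega> "\<lambda>x. \<Sum>i\<in>I. l i *\<^sub>R q i x"] by (smt (verit) mult_nonneg_nonneg)
  qed
  finally show ?thesis by (simp add: B_def)
qed

text \<open>Unprimed data are errors of the old iterate, primed ones of the new. Mechanics is used
  for the old displacement and the flux equation for the new flux, as the scheme couples them;
  \<open>wt\<close> stands for the Gauss weights.\<close>

lemma fixed_stress_contraction:
  fixes \<alpha> :: "nat \<Rightarrow> nat \<Rightarrow> real" and wt l :: "nat \<Rightarrow> real"
  assumes wt: "\<And>i. i \<in> {1..r} \<Longrightarrow> wt i > 0"
    and sym: "\<And>i j. i \<in> {1..r} \<Longrightarrow> j \<in> {1..r} \<Longrightarrow> \<alpha> i j + \<alpha> j i = l i * l j"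
    and p: "\<And>j. j \<in> {0..r} \<Longrightarrow> p j \<in> Wh" and p': "\<And>j. j \<in> {0..r} \<Longrightarrow> p' j \<in> Wh"
    and q': "\<And>j. j \<in> {1..r} \<Longrightarrow> q' j \<in> Vh" and u: "\<And>j. j \<in> {0..r} \<Longrightarrow> u j \<in> Hh"
    and p'0: "eq_ae \<Omega> (p' 0) (\<lambda>x. 0)"
    and flux: "\<And>j. j \<in> {1..r} \<Longrightarrow> flux_eq \<Omega> Kp Vh (p' j) (q' j)"
    and mech: "\<And>j. j \<in> {0..r} \<Longrightarrow> mechanics_eq \<Omega> b \<mu> lam Hh (p j) (u j)"
    and S: "S = (\<lambda>i x. \<Sum>j=0..r. \<alpha> i j *\<^sub>R p j x)" and S': "S' = (\<lambda>i x. \<Sum>j=0..r. \<alpha> i j *\<^sub>R p' j x)"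
    and balance: "\<And>i w. i \<in> {1..r} \<Longrightarrow> w \<in> Wh \<Longrightarrow>
      1 / M * l2_inner \<Omega> (S' i) w + L * (l2_inner \<Omega> (S' i) w - l2_inner \<Omega> (S i) w)
        + wt i * l2_inner \<Omega> (wdiv \<Omega> (q' i)) w
      = - b * l2_inner \<Omega> (wdiv \<Omega> (\<lambda>x. \<Sum>j=0..r. \<alpha> i j *\<^sub>R u j x)) w"
  shows "(\<Sum>i=1..r. (l2_norm \<Omega> (S' i))\<^sup>2 / wt i)
    \<le> (L / 2) / (1 / M + L / 2) * (\<Sum>i=1..r. (l2_norm \<Omega> (S i))\<^sup>2 / wt i)"
proof -
  define D where "D i = wdiv \<Omega> (\<lambda>x. \<Sum>j=0..r. \<alpha> i j *\<^sub>R u j x)" for i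
  have SW: "S i \<in> Wh" "S' i \<in> Wh" for i unfolding S S' by (intro Wh_lincomb p p'; simp)+
  have SL: "S i \<in> L2 \<Omega>" "S' i \<in> L2 \<Omega>" for i using SW Wh_L2 by auto
  have uH: "(\<lambda>x. \<Sum>j=0..r. \<alpha> i j *\<^sub>R u j x) \<in> Hh" for i by (intro Hh_lincomb u)
  have DL: "D i \<in> L2 \<Omega>" for i unfolding D_def by (intro wdiv_Hdiv Hh_Hdiv uH)
  have step: "(1 / M + L / 2) * (l2_norm \<Omega> (S' i))\<^sup>2 + wt i * l2_inner \<Omega> (wdiv \<Omega> (q' i)) (S' i)
      \<le> L / 2 * (l2_norm \<Omega> (S i))\<^sup>2" if i: "i \<in> {1..r}" for i
  proof -
    have mS: "mechanics_eq \<Omega> b \<mu> lam Hh (S i) (\<lambda>x. \<Sum>j=0..r. \<alpha> i j *\<^sub>R u j x)"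
      unfolding S by (rule mechanics_eq_lincomb) (use p u mech Wh_L2 in auto)
    have lamD: "lam * (l2_norm \<Omega> (D i))\<^sup>2 \<le> b * l2_inner \<Omega> (S i) (D i)"
      unfolding D_def by (rule mechanics_eq_bounds(1)[OF uH SL(1) mS])
    \<comment> \<open>\<open>E\<close> collects the old data in the balance, so a bound of its norm
      by L |S| is all that is required of the coupling.\<close>
    define E where "E x = L *\<^sub>R S i x - b *\<^sub>R D i x" for x
    have EL: "E \<in> L2 \<Omega>" unfolding E_def[abs_def] by (intro L2_diff L2_scale SL DL)
    have "l2_inner \<Omega> E E = L\<^sup>2 * l2_inner \<Omega> (S i) (S i) - 2 * L * b * l2_inner \<Omega> (S i) (D i) + b\<^sup>2 * l2_inner \<Omega> (D i) (D i)"
      unfolding E_def by (rule l2_inner_diff_diff[OF SL(1) DL])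
    \<comment> \<open>The lower bound on \<open>L\<close> enters here: the cross term outweighs the
      squared divergence.\<close>
    also have "\<dots> \<le> L\<^sup>2 * l2_inner \<Omega> (S i) (S i)"
    proof -
      have "b\<^sup>2 \<le> 2 * L * lam" using params by (simp add: field_simps)
      then have "b\<^sup>2 * (l2_norm \<Omega> (D i))\<^sup>2 \<le> 2 * L * lam * (l2_norm \<Omega> (D i))\<^sup>2" by (rule mult_right_mono) simp
      also have "\<dots> = 2 * L * (lam * (l2_norm \<Omega> (D i))\<^sup>2)" by simp
      also have "\<dots> \<le> 2 * L * (b * l2_inner \<Omega> (S i) (D i))" using params by (intro mult_left_mono lamD) auto
      finally show ?thesis by (simp add: l2_norm_squared)
    qed
    finally have EE: "l2_inner \<Omega> E E \<le> L\<^sup>2 * (l2_norm \<Omega> (S i))\<^sup>2" by (simp add: l2_norm_squared)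
    \<comment> \<open>Young's inequality in the form of a square; the factor \<open>L\<close> makes
      exactly L/2 |S'|^2 move to the left side.\<close>
    have "0 \<le> l2_inner \<Omega> (\<lambda>x. 1 *\<^sub>R E x - L *\<^sub>R S' i x) (\<lambda>x. 1 *\<^sub>R E x - L *\<^sub>R S' i x)"
      by (rule l2_inner_self_nonneg)
    also have "\<dots> = l2_inner \<Omega> E E - 2 * L * l2_inner \<Omega> E (S' i) + L\<^sup>2 * (l2_norm \<Omega> (S' i))\<^sup>2"
      using l2_inner_diff_diff[OF EL SL(2), of 1 L i] by (simp add: l2_norm_squared)
    finally have "2 * L * l2_inner \<Omega> E (S' i) \<le> L\<^sup>2 * (l2_norm \<Omega> (S i))\<^sup>2 + L\<^sup>2 * (l2_norm \<Omega> (S' i))\<^sup>2"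
      using EE by simp
    then have "L * (2 * l2_inner \<Omega> E (S' i)) \<le> L * (L * (l2_norm \<Omega> (S i))\<^sup>2 + L * (l2_norm \<Omega> (S' i))\<^sup>2)"
      by (simp add: power2_eq_square algebra_simps)
    then have ES: "2 * l2_inner \<Omega> E (S' i) \<le> L * (l2_norm \<Omega> (S i))\<^sup>2 + L * (l2_norm \<Omega> (S' i))\<^sup>2"
      using params by (simp add: mult_le_cancel_left)
    have Eeq: "l2_inner \<Omega> E (S' i) = L * l2_inner \<Omega> (S i) (S' i) - b * l2_inner \<Omega> (D i) (S' i)"
      unfolding E_def l2_inner_diff_left[OF L2_scale[OF SL(1)] L2_scale[OF DL] SL(2)] l2_inner_scale_left ..
    have "1 / M * (l2_norm \<Omega> (S' i))\<^sup>2 + L * ((l2_norm \<Omega> (S' i))\<^sup>2 - l2_inner \<Omega> (S i) (S' i))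
        + wt i * l2_inner \<Omega> (wdiv \<Omega> (q' i)) (S' i) = - b * l2_inner \<Omega> (D i) (S' i)"
      using balance[OF i SW(2)] by (simp add: D_def l2_norm_squared)
    then show ?thesis using ES Eeq by (simp add: algebra_simps)
  qed
  \<comment> \<open>The flux equation tested with the new flux converts the pressures in S' into
    fluxes. The term of index 0, for which no flux equation is at hand, drops out because that error
    vanishes.\<close>
  have flux0: "(\<Sum>i=1..r. l2_inner \<Omega> (wdiv \<Omega> (q' i)) (S' i)) \<ge> 0"
  proof -
    have "l2_inner \<Omega> (wdiv \<Omega> (q' i)) (S' i)
        = (\<Sum>j=1..r. \<alpha> i j * l2_inner \<Omega> (\<lambda>x. matrix_inv (Kp x) *v q' j x) (q' i))" if i: "i \<in> {1..r}" for i
    proof -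
      have dL: "wdiv \<Omega> (q' i) \<in> L2 \<Omega>" by (intro wdiv_Hdiv Vh_Hdiv q' i)
      have "l2_inner \<Omega> (wdiv \<Omega> (q' i)) (S' i) = (\<Sum>j=0..r. \<alpha> i j * l2_inner \<Omega> (wdiv \<Omega> (q' i)) (p' j))"
        unfolding S' by (rule l2_inner_lincomb_right) (use p' Wh_L2 dL in auto)
      also have "\<dots> = (\<Sum>j=1..r. \<alpha> i j * l2_inner \<Omega> (wdiv \<Omega> (q' i)) (p' j))"
        using l2_inner_cong[OF sets_\<Omega> eq_ae_refl p'0, of "wdiv \<Omega> (q' i)"]
        by (simp add: sum.atLeast_Suc_atMost)
      also have "\<dots> = (\<Sum>j=1..r. \<alpha> i j * l2_inner \<Omega> (\<lambda>x. matrix_inv (Kp x) *v q' j x) (q' i))"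
      proof (intro sum.cong refl arg_cong2[where f = "(*)"])
        fix j assume j: "j \<in> {1..r}"
        show "l2_inner \<Omega> (wdiv \<Omega> (q' i)) (p' j) = l2_inner \<Omega> (\<lambda>x. matrix_inv (Kp x) *v q' j x) (q' i)"
          using flux[OF j] q'[OF i] unfolding flux_eq_def l2_inner_commute[of \<Omega> "wdiv \<Omega> (q' i)"] by fastforce
      qed
      finally show ?thesis .
    qed
    then have "(\<Sum>i=1..r. l2_inner \<Omega> (wdiv \<Omega> (q' i)) (S' i))
        = (\<Sum>i=1..r. \<Sum>j=1..r. \<alpha> i j * l2_inner \<Omega> (\<lambda>x. matrix_inv (Kp x) *v q' j x) (q' i))"
      by (rule sum.cong[OF refl])
    also have "\<dots> \<ge> 0" by (rule flux_term_nonneg[where l = l]) (use q' sym in auto)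
    finally show ?thesis .
  qed
  have "(1 / M + L / 2) * (\<Sum>i=1..r. (l2_norm \<Omega> (S' i))\<^sup>2 / wt i) + (\<Sum>i=1..r. l2_inner \<Omega> (wdiv \<Omega> (q' i)) (S' i))
      = (\<Sum>i=1..r. (1 / M + L / 2) * ((l2_norm \<Omega> (S' i))\<^sup>2 / wt i) + l2_inner \<Omega> (wdiv \<Omega> (q' i)) (S' i))"
    by (simp only: sum_distrib_left sum.distrib)
  also have "\<dots> \<le> (\<Sum>i=1..r. L / 2 * ((l2_norm \<Omega> (S i))\<^sup>2 / wt i))"
  proof (rule sum_mono)
    fix i assume i: "i \<in> {1..r}"
    have "((1 / M + L / 2) * (l2_norm \<Omega> (S' i))\<^sup>2 + wt i * l2_inner \<Omega> (wdiv \<Omega> (q' i)) (S' i)) / wt i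
        \<le> (L / 2 * (l2_norm \<Omega> (S i))\<^sup>2) / wt i"
      using step[OF i] wt[OF i] by (intro divide_right_mono) auto
    then show "(1 / M + L / 2) * ((l2_norm \<Omega> (S' i))\<^sup>2 / wt i) + l2_inner \<Omega> (wdiv \<Omega> (q' i)) (S' i)
        \<le> L / 2 * ((l2_norm \<Omega> (S i))\<^sup>2 / wt i)"
      using wt[OF i] by (simp add: add_divide_distrib)
  qed
  also have "\<dots> = L / 2 * (\<Sum>i=1..r. (l2_norm \<Omega> (S i))\<^sup>2 / wt i)" by (simp only: sum_distrib_left)
  finally have "(1 / M + L / 2) * (\<Sum>i=1..r. (l2_norm \<Omega> (S' i))\<^sup>2 / wt i) \<le> L / 2 * (\<Sum>i=1..r. (l2_norm \<Omega> (S i))\<^sup>2 / wt i)"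
    using flux0 by linarith
  moreover have "1 / M + L / 2 > 0" using params by (intro add_pos_pos) auto
  moreover have "X \<le> d / c * Y" if "c * X \<le> d * Y" "c > 0" for c d X Y :: real
    using that by (simp add: field_simps)
  ultimately show ?thesis by blast
qed

end

section \<open>Convergence on one time interval\<close>

context biot_scheme
begin

text \<open>Isolated from the grid: \<alpha> enters through its symmetric part and a left inverse,
  the same numbers \<open>l\<close> factor that part and evaluate at the right end, and agreement at
  index 0 is a hypothesis for the induction over the intervals to supply.\<close>

lemma interval_convergence:
  fixes P :: "nat \<Rightarrow> real^'d \<Rightarrow> real" and Q U :: "nat \<Rightarrow> real^'d \<Rightarrow> real^'d"
    and Pk :: "nat \<Rightarrow> nat \<Rightarrow> real^'d \<Rightarrow> real" and Qk Uk :: "nat \<Rightarrow> nat \<Rightarrow> real^'d \<Rightarrow> real^'d"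
    and \<alpha> :: "nat \<Rightarrow> nat \<Rightarrow> real" and wt l :: "nat \<Rightarrow> real"
  assumes wt: "\<And>i. i \<in> {1..r} \<Longrightarrow> wt i > 0"
    and sym: "\<And>i j. i \<in> {1..r} \<Longrightarrow> j \<in> {1..r} \<Longrightarrow> \<alpha> i j + \<alpha> j i = l i * l j"
    and inv: "\<And>m j. m \<in> {1..r} \<Longrightarrow> j \<in> {1..r} \<Longrightarrow> (\<Sum>i=1..r. d m i * \<alpha> i j) = (if m = j then 1 else (0::real))"
    and sol: "\<And>j. j \<in> {0..r} \<Longrightarrow> P j \<in> Wh \<and> Q j \<in> Vh \<and> U j \<in> Hh"
    and iter: "\<And>k j. j \<in> {0..r} \<Longrightarrow> Pk k j \<in> Wh \<and> Qk k j \<in> Vh \<and> Uk k j \<in> Hh"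
    and start: "\<And>k. eq_ae \<Omega> (Pk k 0) (P 0) \<and> eq_ae \<Omega> (Qk k 0) (Q 0) \<and> eq_ae \<Omega> (Uk k 0) (U 0)"
    and sol_eq: "\<And>i w. i \<in> {1..r} \<Longrightarrow> w \<in> Wh \<Longrightarrow>
      1 / M * (\<Sum>j=0..r. \<alpha> i j * l2_inner \<Omega> (P j) w) + wt i * l2_inner \<Omega> (wdiv \<Omega> (Q i)) w
      = wt i * l2_inner \<Omega> (f i) w - b * (\<Sum>j=0..r. \<alpha> i j * l2_inner \<Omega> (wdiv \<Omega> (U j)) w)"
    and sol_flux: "\<And>i. i \<in> {1..r} \<Longrightarrow> flux_eq \<Omega> Kp Vh (P i) (Q i)"
    and sol_mech: "\<And>i. i \<in> {1..r} \<Longrightarrow> mechanics_eq \<Omega> b \<mu> lam Hh (P i) (U i)"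
    and iter_eq: "\<And>k i w. i \<in> {1..r} \<Longrightarrow> w \<in> Wh \<Longrightarrow>
      1 / M * (\<Sum>j=0..r. \<alpha> i j * l2_inner \<Omega> (Pk (Suc k) j) w)
        + L * (\<Sum>j=0..r. \<alpha> i j * l2_inner \<Omega> (\<lambda>x. Pk (Suc k) j x - Pk k j x) w)
        + wt i * l2_inner \<Omega> (wdiv \<Omega> (Qk (Suc k) i)) w
      = wt i * l2_inner \<Omega> (f i) w - b * (\<Sum>j=0..r. \<alpha> i j * l2_inner \<Omega> (wdiv \<Omega> (Uk k j)) w)"
    and iter_flux: "\<And>k i. i \<in> {1..r} \<Longrightarrow> flux_eq \<Omega> Kp Vh (Pk (Suc k) i) (Qk (Suc k) i)"
    and iter_mech: "\<And>k i. i \<in> {1..r} \<Longrightarrow> mechanics_eq \<Omega> b \<mu> lam Hh (Pk (Suc k) i) (Uk (Suc k) i)"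
  shows "\<And>k i. (\<lambda>x. \<Sum>j=0..r. \<alpha> i j * (Pk k j x - P j x)) \<in> Wh"
    and "\<And>i. i \<in> {1..r} \<Longrightarrow>
      converges_geometrically (l2_norm \<Omega>) (\<lambda>k x. \<Sum>j=0..r. \<alpha> i j * (Pk k j x - P j x)) (\<lambda>x. 0)"
    and "(\<lambda>k. l2_norm \<Omega> (\<lambda>x. \<Sum>j=0..r. l j *\<^sub>R (Pk k j x - P j x))) \<longlonglongrightarrow> 0"
    and "(\<lambda>k. hdiv_norm \<Omega> (\<lambda>x. \<Sum>j=0..r. l j *\<^sub>R (Qk k j x - Q j x))) \<longlonglongrightarrow> 0"
    and "(\<lambda>k. h1_norm \<Omega> (\<lambda>x. \<Sum>j=0..r. l j *\<^sub>R (Uk k j x - U j x))) \<longlonglongrightarrow> 0"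
proof -
  define p q u where "p k j x = Pk k j x - P j x" and "q k j x = Qk k j x - Q j x" and "u k j x = Uk k j x - U j x"
    for k j x
  have pW: "p k j \<in> Wh" and qV: "q k j \<in> Vh" and uH: "u k j \<in> Hh" if "j \<in> {0..r}" for k j
    unfolding p_def[abs_def] q_def[abs_def] u_def[abs_def]
    using sol[OF that] iter[OF that, of k] by (auto intro: Wh_diff Vh_diff Hh_diff)
  have pL: "p k j \<in> L2 \<Omega>" if "j \<in> {0..r}" for k j using pW[OF that] by (rule Wh_L2)
  have p0: "eq_ae \<Omega> (p k 0) (\<lambda>x. 0)" and q0: "eq_ae \<Omega> (q k 0) (\<lambda>x. 0)" and u0: "eq_ae \<Omega> (u k 0) (\<lambda>x. 0)" for k
    using start[of k] unfolding p_def[abs_def] q_def[abs_def] u_def[abs_def] by (simp_all add: eq_ae_def)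
  have mech: "mechanics_eq \<Omega> b \<mu> lam Hh (p (Suc k) j) (u (Suc k) j)" if j: "j \<in> {0..r}" for k j
  proof (cases "j = 0")
    case True
    then show ?thesis using mechanics_eq_null[OF p0 u0] by simp
  next
    case False
    then show ?thesis unfolding p_def[abs_def] u_def[abs_def]
      using j sol[OF j] iter[OF j, of "Suc k"] by (intro mechanics_eq_diff iter_mech sol_mech) (auto intro: Wh_L2)
  qed
  have flux: "flux_eq \<Omega> Kp Vh (p (Suc k) j) (q (Suc k) j)" if j: "j \<in> {0..r}" for k j
  proof (cases "j = 0")
    case True
    then show ?thesis using flux_eq_null[OF p0 q0] by simp
  next
    case False
    then show ?thesis unfolding p_def[abs_def] q_def[abs_def]
      using j sol[OF j] iter[OF j, of "Suc k"] by (intro flux_eq_diff iter_flux sol_flux) (auto intro: Wh_L2)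
  qed
  define S where "S k i x = (\<Sum>j=0..r. \<alpha> i j *\<^sub>R p k j x)" for k i x
  have SW: "S k i \<in> Wh" for k i unfolding S_def[abs_def] by (intro Wh_lincomb pW)
  have S_eq: "(\<lambda>x. \<Sum>j=0..r. \<alpha> i j * (Pk k j x - P j x)) = S k i" for k i
    by (simp add: S_def[abs_def] p_def)
  have Sinner: "l2_inner \<Omega> (S k i) w = (\<Sum>j=0..r. \<alpha> i j * l2_inner \<Omega> (p k j) w)" if "w \<in> Wh" for k i w
    unfolding S_def by (rule l2_inner_lincomb_left) (use pL that Wh_L2 in auto)
  have balance: "1 / M * l2_inner \<Omega> (S (Suc k) i) w + L * (l2_inner \<Omega> (S (Suc k) i) w - l2_inner \<Omega> (S k i) w)
        + wt i * l2_inner \<Omega> (wdiv \<Omega> (q (Suc k) i)) w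
      = - b * l2_inner \<Omega> (wdiv \<Omega> (\<lambda>x. \<Sum>j=0..r. \<alpha> i j *\<^sub>R u k j x)) w"
    if i: "i \<in> {1..r}" and w: "w \<in> Wh" for k i w
  proof -
    have wL: "w \<in> L2 \<Omega>" using w by (rule Wh_L2)
    have i0: "i \<in> {0..r}" using i by auto
    have PL: "P j \<in> L2 \<Omega>" "Pk k j \<in> L2 \<Omega>" if "j \<in> {0..r}" for k j
      using sol[OF that] iter[OF that] Wh_L2 by auto
    have pin: "l2_inner \<Omega> (p k j) w = l2_inner \<Omega> (Pk k j) w - l2_inner \<Omega> (P j) w" if "j \<in> {0..r}" for k j
      unfolding p_def by (rule l2_inner_diff_left[OF PL(2)[OF that] PL(1)[OF that] wL])
    have Pdiff: "l2_inner \<Omega> (\<lambda>x. Pk (Suc k) j x - Pk k j x) w = l2_inner \<Omega> (p (Suc k) j) w - l2_inner \<Omega> (p k j) w"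
      if "j \<in> {0..r}" for j
      using l2_inner_diff_left[OF PL(2)[OF that] PL(2)[OF that] wL, of "Suc k" k] pin[OF that] by simp
    have qin: "l2_inner \<Omega> (wdiv \<Omega> (q (Suc k) i)) w = l2_inner \<Omega> (wdiv \<Omega> (Qk (Suc k) i)) w - l2_inner \<Omega> (wdiv \<Omega> (Q i)) w"
      unfolding q_def by (rule wdiv_diff_inner) (use sol[OF i0] iter[OF i0] Vh_Hdiv wL in auto)
    have uin: "l2_inner \<Omega> (wdiv \<Omega> (u k j)) w = l2_inner \<Omega> (wdiv \<Omega> (Uk k j)) w - l2_inner \<Omega> (wdiv \<Omega> (U j)) w"
      if "j \<in> {0..r}" for j
      unfolding u_def by (rule wdiv_diff_inner) (use sol[OF that] iter[OF that] Hh_Hdiv wL in auto)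
    have s1: "l2_inner \<Omega> (S (Suc k) i) w
        = (\<Sum>j=0..r. \<alpha> i j * l2_inner \<Omega> (Pk (Suc k) j) w) - (\<Sum>j=0..r. \<alpha> i j * l2_inner \<Omega> (P j) w)"
      unfolding Sinner[OF w] sum_subtractf[symmetric] by (intro sum.cong refl) (simp add: pin right_diff_distrib)
    have s2: "l2_inner \<Omega> (S (Suc k) i) w - l2_inner \<Omega> (S k i) w
        = (\<Sum>j=0..r. \<alpha> i j * l2_inner \<Omega> (\<lambda>x. Pk (Suc k) j x - Pk k j x) w)"
      unfolding Sinner[OF w] sum_subtractf[symmetric] by (intro sum.cong refl) (simp add: Pdiff right_diff_distrib)
    have s3: "l2_inner \<Omega> (wdiv \<Omega> (\<lambda>x. \<Sum>j=0..r. \<alpha> i j *\<^sub>R u k j x)) w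
        = (\<Sum>j=0..r. \<alpha> i j * l2_inner \<Omega> (wdiv \<Omega> (Uk k j)) w) - (\<Sum>j=0..r. \<alpha> i j * l2_inner \<Omega> (wdiv \<Omega> (U j)) w)"
    proof -
      have "l2_inner \<Omega> (wdiv \<Omega> (\<lambda>x. \<Sum>j=0..r. \<alpha> i j *\<^sub>R u k j x)) w = (\<Sum>j=0..r. \<alpha> i j * l2_inner \<Omega> (wdiv \<Omega> (u k j)) w)"
        by (rule wdiv_lincomb_inner) (use uH Hh_Hdiv wL in auto)
      also have "\<dots> = (\<Sum>j=0..r. \<alpha> i j * l2_inner \<Omega> (wdiv \<Omega> (Uk k j)) w - \<alpha> i j * l2_inner \<Omega> (wdiv \<Omega> (U j)) w)"
        by (intro sum.cong refl) (simp add: uin right_diff_distrib)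
      finally show ?thesis by (simp only: sum_subtractf)
    qed
    show ?thesis unfolding s2 unfolding s1 s3 qin right_diff_distrib
      using sol_eq[OF i w] iter_eq[OF i w, of k] by linarith
  qed
  define X where "X k = (\<Sum>i=1..r. (l2_norm \<Omega> (S k i))\<^sup>2 / wt i)" for k
  define \<rho> where "\<rho> = (L / 2) / (1 / M + L / 2)"
  have \<rho>: "0 < \<rho>" "\<rho> < 1" using params by (auto simp: \<rho>_def add_pos_pos)
  have X0: "X k \<ge> 0" for k unfolding X_def by (intro sum_nonneg divide_nonneg_nonneg) (use wt in \<open>auto intro: less_imp_le\<close>)
  have contr: "X (Suc (Suc k)) \<le> \<rho> * X (Suc k)" for k
    unfolding X_def \<rho>_def
    by (rule fixed_stress_contraction[where \<alpha> = \<alpha> and l = l and p = "p (Suc k)" and p' = "p (Suc (Suc k))"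
          and q' = "q (Suc (Suc k))" and u = "u (Suc k)"])
       (use wt sym pW qV uH p0 flux mech balance in \<open>auto simp: S_def[abs_def]\<close>)
  \<comment> \<open>\<open>X 0\<close> covers the starting iterate, from which no contraction is
    available; \<open>X 1 / \<rho>\<close> starts the geometric bound at k = 1.\<close>
  define A where "A = X 0 + X 1 / \<rho>"
  have A: "A \<ge> 0" using X0 \<rho> by (simp add: A_def)
  have Xk: "X k \<le> A * \<rho> ^ k" for k
  proof (cases k)
    case 0
    then show ?thesis using X0[of 1] \<rho> by (simp add: A_def)
  next
    case (Suc m)
    have "X (Suc m) \<le> A * \<rho> ^ Suc m" for m
    proof (induction m)
      case 0
      then show ?case using X0[of 0] \<rho> by (simp add: A_def distrib_right)
    next
      case (Suc m)
      have "X (Suc (Suc m)) \<le> \<rho> * (A * \<rho> ^ Suc m)"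
        using contr[of m] mult_left_mono[OF Suc, of \<rho>] \<rho> by linarith
      then show ?case by (simp add: mult_ac)
    qed
    then show ?thesis using Suc by simp
  qed
  \<comment> \<open>\<open>X\<close> is a weighted sum of squares, so the rate for the norms is the
    square root of \<open>\<rho>\<close>.\<close>
  have Sbound: "l2_norm \<Omega> (S k i) \<le> sqrt (wt i * A) * sqrt \<rho> ^ k" if i: "i \<in> {1..r}" for k i
  proof -
    have "(l2_norm \<Omega> (S k i))\<^sup>2 / wt i \<le> X k"
      unfolding X_def
    proof (rule member_le_sum[OF i])
      show "0 \<le> (l2_norm \<Omega> (S k j))\<^sup>2 / wt j" if "j \<in> {1..r} - {i}" for j
        by (rule divide_nonneg_pos) (use that wt[of j] in auto)
    qed simp
    then have "(l2_norm \<Omega> (S k i))\<^sup>2 / wt i \<le> A * \<rho> ^ k" using Xk[of k] by linarith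
    then have "(l2_norm \<Omega> (S k i))\<^sup>2 \<le> (wt i * A) * \<rho> ^ k" using wt[OF i] by (simp add: field_simps)
    then have "sqrt ((l2_norm \<Omega> (S k i))\<^sup>2) \<le> sqrt ((wt i * A) * \<rho> ^ k)" by (rule real_sqrt_le_mono)
    then show ?thesis by (simp add: real_sqrt_mult real_sqrt_power)
  qed
  show "(\<lambda>x. \<Sum>j=0..r. \<alpha> i j * (Pk k j x - P j x)) \<in> Wh" for k i unfolding S_eq by (rule SW)
  have sq\<rho>: "0 < sqrt \<rho>" "sqrt \<rho> < 1" using \<rho> by auto
  show "converges_geometrically (l2_norm \<Omega>) (\<lambda>k x. \<Sum>j=0..r. \<alpha> i j * (Pk k j x - P j x)) (\<lambda>x. 0)" if i: "i \<in> {1..r}" for i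
    unfolding converges_geometrically_def
  proof (intro exI conjI allI)
    show "0 \<le> sqrt (wt i * A)" using wt[OF i] A by simp
    show "0 < sqrt \<rho>" "sqrt \<rho> < 1" by (rule sq\<rho>)+
    show "l2_norm \<Omega> (\<lambda>x. (\<Sum>j=0..r. \<alpha> i j * (Pk k j x - P j x)) - 0) \<le> sqrt (wt i * A) * sqrt \<rho> ^ k" for k
      using Sbound[OF i, of k] S_eq[where i = i and k = k] by simp
  qed
  have Slim: "(\<lambda>k. l2_norm \<Omega> (S k i)) \<longlonglongrightarrow> 0" if i: "i \<in> {1..r}" for i
  proof (rule tendsto_sandwich[OF _ _ tendsto_const])
    have "(\<lambda>k. sqrt (wt i * A) * sqrt \<rho> ^ k) \<longlonglongrightarrow> sqrt (wt i * A) * 0"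
      using sq\<rho> by (intro tendsto_mult tendsto_const LIMSEQ_power_zero) auto
    then show "(\<lambda>k. sqrt (wt i * A) * sqrt \<rho> ^ k) \<longlonglongrightarrow> 0" by simp
  qed (use Sbound[OF i] in auto)
  have plim: "(\<lambda>k. l2_norm \<Omega> (p k m)) \<longlonglongrightarrow> 0" if m: "m \<in> {0..r}" for m
  proof (cases "m = 0")
    case True
    have "l2_norm \<Omega> (p k 0) = 0" for k using l2_norm_cong[OF sets_\<Omega> p0[of k]] by simp
    then show ?thesis using True by simp
  next
    case False
    then have m1: "m \<in> {1..r}" using m by simp
    \<comment> \<open>The left inverse covers the indices from 1 on; the points where the error of
      index 0 is nonzero form a null set and are discarded.\<close>
    have rep: "eq_ae \<Omega> (p k m) (\<lambda>x. \<Sum>i=1..r. d m i *\<^sub>R S k i x)" for k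
    proof -
      have "(\<Sum>i=1..r. d m i *\<^sub>R S k i x) = p k m x" if "p k 0 x = 0" for x
      proof -
        have "S k i x = (\<Sum>j=1..r. \<alpha> i j * p k j x)" for i
          using that by (simp add: S_def sum.atLeast_Suc_atMost[of 0])
        then have "(\<Sum>i=1..r. d m i *\<^sub>R S k i x) = (\<Sum>i=1..r. \<Sum>j=1..r. (d m i * \<alpha> i j) * p k j x)"
          by (simp add: sum_distrib_left mult.assoc)
        also have "\<dots> = (\<Sum>j=1..r. (\<Sum>i=1..r. d m i * \<alpha> i j) * p k j x)"
          by (subst sum.swap) (simp add: sum_distrib_right)
        also have "\<dots> = (\<Sum>j=1..r. if j = m then p k j x else 0)"
          by (intro sum.cong refl) (use inv[OF m1] in auto)
        also have "\<dots> = p k m x" using m1 by simp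
        finally show ?thesis .
      qed
      then show ?thesis using p0[of k] unfolding eq_ae_def by (auto elim!: eventually_mono)
    qed
    have le: "l2_norm \<Omega> (p k m) \<le> (\<Sum>i=1..r. \<bar>d m i\<bar> * l2_norm \<Omega> (S k i))" for k
      unfolding l2_norm_cong[OF sets_\<Omega> rep[of k]] by (rule l2_norm_lincomb_le) (intro Wh_L2 SW)
    show ?thesis
    proof (rule tendsto_sandwich[OF _ _ tendsto_const])
      have "(\<lambda>k. \<Sum>i=1..r. \<bar>d m i\<bar> * l2_norm \<Omega> (S k i)) \<longlonglongrightarrow> (\<Sum>i=1..r. \<bar>d m i\<bar> * 0)"
        by (intro tendsto_sum tendsto_mult tendsto_const Slim)
      then show "(\<lambda>k. \<Sum>i=1..r. \<bar>d m i\<bar> * l2_norm \<Omega> (S k i)) \<longlonglongrightarrow> 0" by simp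
    qed (use le in auto)
  qed
  have endP: "(\<lambda>x. \<Sum>j=0..r. l j *\<^sub>R p k j x) \<in> L2 \<Omega>" for k by (rule L2_lincomb) (rule pL)
  have Plim: "(\<lambda>k. l2_norm \<Omega> (\<lambda>x. \<Sum>j=0..r. l j *\<^sub>R p k j x)) \<longlonglongrightarrow> 0"
  proof (rule tendsto_sandwich[OF _ _ tendsto_const])
    have "(\<lambda>k. \<Sum>j=0..r. \<bar>l j\<bar> * l2_norm \<Omega> (p k j)) \<longlonglongrightarrow> (\<Sum>j=0..r. \<bar>l j\<bar> * 0)"
      by (intro tendsto_sum tendsto_mult tendsto_const plim)
    then show "(\<lambda>k. \<Sum>j=0..r. \<bar>l j\<bar> * l2_norm \<Omega> (p k j)) \<longlonglongrightarrow> 0" by simp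
    show "\<forall>\<^sub>F k in sequentially. l2_norm \<Omega> (\<lambda>x. \<Sum>j=0..r. l j *\<^sub>R p k j x) \<le> (\<Sum>j=0..r. \<bar>l j\<bar> * l2_norm \<Omega> (p k j))"
      by (intro always_eventually allI l2_norm_lincomb_le pL)
  qed auto
  then show "(\<lambda>k. l2_norm \<Omega> (\<lambda>x. \<Sum>j=0..r. l j *\<^sub>R (Pk k j x - P j x))) \<longlonglongrightarrow> 0"
    by (simp only: p_def)
  obtain CQ where CQ: "CQ \<ge> 0"
    "\<And>P Q. P \<in> L2 \<Omega> \<Longrightarrow> Q \<in> Vh \<Longrightarrow> flux_eq \<Omega> Kp Vh P Q \<Longrightarrow> hdiv_norm \<Omega> Q \<le> CQ * l2_norm \<Omega> P"
    by (rule flux_stability) blast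
  obtain CU where CU: "CU \<ge> 0"
    "\<And>P U. P \<in> L2 \<Omega> \<Longrightarrow> U \<in> Hh \<Longrightarrow> mechanics_eq \<Omega> b \<mu> lam Hh P U \<Longrightarrow> h1_norm \<Omega> U \<le> CU * l2_norm \<Omega> P"
    by (rule mechanics_stability) blast
  \<comment> \<open>The flux and mechanics equations hold from the first computed iterate on, and a
    limit does not depend on the first term.\<close>
  have Suc_lim: "g \<longlonglongrightarrow> 0"
    if "\<And>k. 0 \<le> g k" "\<And>k. g (Suc k) \<le> C * l2_norm \<Omega> (\<lambda>x. \<Sum>j=0..r. l j *\<^sub>R p (Suc k) j x)" for g :: "nat \<Rightarrow> real" and C
  proof (rule LIMSEQ_imp_Suc, rule tendsto_sandwich[OF _ _ tendsto_const])
    have "(\<lambda>k. C * l2_norm \<Omega> (\<lambda>x. \<Sum>j=0..r. l j *\<^sub>R p (Suc k) j x)) \<longlonglongrightarrow> C * 0"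
      by (intro tendsto_mult tendsto_const LIMSEQ_Suc[OF Plim])
    then show "(\<lambda>k. C * l2_norm \<Omega> (\<lambda>x. \<Sum>j=0..r. l j *\<^sub>R p (Suc k) j x)) \<longlonglongrightarrow> 0" by simp
  qed (use that in auto)
  have "(\<lambda>k. hdiv_norm \<Omega> (\<lambda>x. \<Sum>j=0..r. l j *\<^sub>R q k j x)) \<longlonglongrightarrow> 0"
  proof (rule Suc_lim[where C = CQ])
    show "0 \<le> hdiv_norm \<Omega> (\<lambda>x. \<Sum>j=0..r. l j *\<^sub>R q k j x)" for k by (simp add: hdiv_norm_def)
    show "hdiv_norm \<Omega> (\<lambda>x. \<Sum>j=0..r. l j *\<^sub>R q (Suc k) j x) \<le> CQ * l2_norm \<Omega> (\<lambda>x. \<Sum>j=0..r. l j *\<^sub>R p (Suc k) j x)" for k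
      by (rule CQ(2)[OF endP Vh_lincomb flux_eq_lincomb]) (use pL qV flux in auto)
  qed
  then show "(\<lambda>k. hdiv_norm \<Omega> (\<lambda>x. \<Sum>j=0..r. l j *\<^sub>R (Qk k j x - Q j x))) \<longlonglongrightarrow> 0"
    by (simp only: q_def)
  have "(\<lambda>k. h1_norm \<Omega> (\<lambda>x. \<Sum>j=0..r. l j *\<^sub>R u k j x)) \<longlonglongrightarrow> 0"
  proof (rule Suc_lim[where C = CU])
    show "0 \<le> h1_norm \<Omega> (\<lambda>x. \<Sum>j=0..r. l j *\<^sub>R u k j x)" for k by (simp add: h1_norm_def)
    show "h1_norm \<Omega> (\<lambda>x. \<Sum>j=0..r. l j *\<^sub>R u (Suc k) j x) \<le> CU * l2_norm \<Omega> (\<lambda>x. \<Sum>j=0..r. l j *\<^sub>R p (Suc k) j x)" for k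
      by (rule CU(2)[OF endP Hh_lincomb mechanics_eq_lincomb]) (use pL uH mech in auto)
  qed
  then show "(\<lambda>k. h1_norm \<Omega> (\<lambda>x. \<Sum>j=0..r. l j *\<^sub>R (Uk k j x - U j x))) \<longlonglongrightarrow> 0"
    by (simp only: u_def)
qed

end

section \<open>Induction over the time intervals\<close>

theorem theorem4p2:
  fixes \<Omega> :: "(real^'d::finite) set"
    and M b \<mu> lam L T :: real
    and Kp :: "real^'d \<Rightarrow> real^'d^'d"
    and f :: "real \<Rightarrow> real^'d \<Rightarrow> real"
    and Th :: "(real^'d) set set"
    and TK :: "(real^'d) set \<Rightarrow> real^'d \<Rightarrow> real^'d"
    and s r N :: nat
    and tt :: "nat \<Rightarrow> real"
    and tg gw :: "nat \<Rightarrow> nat \<Rightarrow> real"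
    and Wh :: "(real^'d \<Rightarrow> real) set"
    and Vh Hh :: "(real^'d \<Rightarrow> real^'d) set"
    and q0 :: "real^'d \<Rightarrow> real^'d"
    and p :: "real \<Rightarrow> real^'d \<Rightarrow> real"
    and q u :: "real \<Rightarrow> real^'d \<Rightarrow> real^'d"
    and P :: "nat \<Rightarrow> nat \<Rightarrow> real^'d \<Rightarrow> real"
    and Q U :: "nat \<Rightarrow> nat \<Rightarrow> real^'d \<Rightarrow> real^'d"
    and pk :: "nat \<Rightarrow> real \<Rightarrow> real^'d \<Rightarrow> real"
    and qk uk :: "nat \<Rightarrow> real \<Rightarrow> real^'d \<Rightarrow> real^'d"
    and Pk :: "nat \<Rightarrow> nat \<Rightarrow> nat \<Rightarrow> real^'d \<Rightarrow> real"
    and Qk Uk :: "nat \<Rightarrow> nat \<Rightarrow> nat \<Rightarrow> real^'d \<Rightarrow> real^'d"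
  assumes dim: "CARD('d) = 2 \<or> CARD('d) = 3"
    and domain: "polyhedral_lipschitz_domain \<Omega>"
    and params: "M > 0" "b > 0" "\<mu> > 0" "lam > 0"
    and perm: "permeability \<Omega> Kp"
    and mesh: "hex_mesh \<Omega> Th TK"
    and Wh: "Wh = pressure_space \<Omega> Th TK s"
    and Vh: "Vh = flux_space \<Omega> Th TK s"
    and Hh: "Hh = displacement_space \<Omega> Th TK (s + 1)"
    and infsup: "inf_sup_stable \<Omega> Wh Vh"
    and deg: "r \<ge> 1"
    and grid: "time_grid T r N tt tg gw"
    and source: "\<forall>n\<in>{1..N}. \<forall>i\<in>{1..r}. f (tg n i) \<in> L2 \<Omega>"
    and init_flux: "q0 \<in> Vh"
    and coupled: "coupled_solution \<Omega> M b \<mu> lam Kp f Wh Vh Hh r N tt tg gw q0 p q u P Q U"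
    and coupled_unique:
      "\<And>p' q' u' P' Q' U' t.
         coupled_solution \<Omega> M b \<mu> lam Kp f Wh Vh Hh r N tt tg gw q0 p' q' u' P' Q' U'
           \<Longrightarrow> t \<in> {0..T} \<Longrightarrow> eq_ae \<Omega> (p' t) (p t) \<and> eq_ae \<Omega> (q' t) (q t) \<and> eq_ae \<Omega> (u' t) (u t)"
    and iterates:
      "fixed_stress_iterates \<Omega> M b \<mu> lam Kp f Wh Vh Hh r N tt tg gw q0 L pk qk uk Pk Qk Uk"
    and L: "L > 0" "L \<ge> b\<^sup>2 / (2 * lam)"
  shows "(\<forall>n\<in>{1..N}. \<forall>i\<in>{1..r}.
            (\<forall>k. (\<lambda>x. \<Sum>j=0..r. \<alpha>c r tt tg n i j * (Pk k n j x - P n j x)) \<in> Wh) \<and>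
            converges_geometrically (l2_norm \<Omega>)
              (\<lambda>k x. \<Sum>j=0..r. \<alpha>c r tt tg n i j * (Pk k n j x - P n j x)) (\<lambda>x. 0)) \<and>
         (\<forall>n\<in>{1..N}.
            (\<lambda>k. l2_norm \<Omega> (\<lambda>x. pk k (tt n) x - p (tt n) x)) \<longlonglongrightarrow> 0 \<and>
            (\<lambda>k. hdiv_norm \<Omega> (\<lambda>x. qk k (tt n) x - q (tt n) x)) \<longlonglongrightarrow> 0 \<and>
            (\<lambda>k. h1_norm \<Omega> (\<lambda>x. uk k (tt n) x - u (tt n) x)) \<longlonglongrightarrow> 0)"
proof -
  interpret bounded_open \<Omega>
    using domain by unfold_locales (auto simp: polyhedral_lipschitz_domain_def)
  interpret biot_scheme \<Omega> Th TK Kp M b \<mu> lam L s Wh Vh Hh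
    using domain mesh perm params L Wh Vh Hh by unfold_locales auto
  note C = coupled[unfolded coupled_solution_def]
  note F = iterates[unfolded fixed_stress_iterates_def]
  define \<alpha> where "\<alpha> n i j = \<alpha>c r tt tg n i j" for n i j
  define l where "l n j = lagrange r tg n j (tt n)" for n j
  have solW: "P n j \<in> Wh \<and> Q n j \<in> Vh \<and> U n j \<in> Hh" if "n \<in> {1..N}" "j \<in> {0..r}" for n j
    using C that by blast
  have iterW: "Pk k n j \<in> Wh \<and> Qk k n j \<in> Vh \<and> Uk k n j \<in> Hh" if "n \<in> {1..N}" "j \<in> {0..r}" for k n j
    using F that by blast
  have at_start: "time_expansion r tg Z n (tt (n - 1)) = Z n 0" if "n \<in> {1..N}"
    for Z :: "nat \<Rightarrow> nat \<Rightarrow> real^'d \<Rightarrow> 'x::euclidean_space" and n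
  proof
    fix x
    have "time_expansion r tg Z n (tt (n - 1)) x = (\<Sum>j=0..r. if j = 0 then Z n j x else 0)"
      unfolding time_expansion_def by (intro sum.cong refl) (use lagrange_start[OF grid that] in auto)
    then show "time_expansion r tg Z n (tt (n - 1)) x = Z n 0 x" by simp
  qed
  \<comment> \<open>The solution is expanded on the closed interval, so its coefficient of index 0
    is its value at the left end. The iterates are expanded on the half-open interval, which gives
    their right end only.\<close>
  have sol_start: "eq_ae \<Omega> (p (tt (n - 1))) (P n 0) \<and> eq_ae \<Omega> (q (tt (n - 1))) (Q n 0) \<and> eq_ae \<Omega> (u (tt (n - 1))) (U n 0)"
    if n: "n \<in> {1..N}" for n
  proof -
    have "tt (n - 1) \<in> {tt (n - 1)..tt n}" using grid_step[OF grid n] by simp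
    then have "eq_ae \<Omega> (p (tt (n - 1))) (time_expansion r tg P n (tt (n - 1))) \<and>
        eq_ae \<Omega> (q (tt (n - 1))) (time_expansion r tg Q n (tt (n - 1))) \<and>
        eq_ae \<Omega> (u (tt (n - 1))) (time_expansion r tg U n (tt (n - 1)))"
      using C n by blast
    then show ?thesis unfolding at_start[OF n] .
  qed
  have sol_end: "eq_ae \<Omega> (p (tt n)) (time_expansion r tg P n (tt n)) \<and>
        eq_ae \<Omega> (q (tt n)) (time_expansion r tg Q n (tt n)) \<and> eq_ae \<Omega> (u (tt n)) (time_expansion r tg U n (tt n))"
    if n: "n \<in> {1..N}" for n
  proof -
    have "tt n \<in> {tt (n - 1)..tt n}" using grid_step[OF grid n] by simp
    then show ?thesis using C n by blast
  qed
  have iter_end: "eq_ae \<Omega> (pk k (tt n)) (time_expansion r tg (Pk k) n (tt n)) \<and>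
        eq_ae \<Omega> (qk k (tt n)) (time_expansion r tg (Qk k) n (tt n)) \<and> eq_ae \<Omega> (uk k (tt n)) (time_expansion r tg (Uk k) n (tt n))"
    if n: "n \<in> {1..N}" for k n
  proof -
    have "tt n \<in> {tt (n - 1)<..tt n}" using grid_step[OF grid n] by simp
    then show ?thesis using F n by blast
  qed
  have expansion_diff: "eq_ae \<Omega> (\<lambda>x. y x - y' x) (\<lambda>x. \<Sum>j=0..r. l n j *\<^sub>R (Y n j x - Y' n j x))"
    if "eq_ae \<Omega> y (time_expansion r tg Y n (tt n))" "eq_ae \<Omega> y' (time_expansion r tg Y' n (tt n))"
    for y y' and Y Y' :: "nat \<Rightarrow> nat \<Rightarrow> real^'d \<Rightarrow> 'x::euclidean_space" and n
    using eq_ae_diff[OF that]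
    by (simp add: time_expansion_def l_def scaleR_diff_right sum_subtractf)
  \<comment> \<open>Agreement at the left end is all that the estimate on an interval needs from the
    past.\<close>
  define start where "start n \<longleftrightarrow> (\<forall>k. eq_ae \<Omega> (Pk k n 0) (P n 0) \<and> eq_ae \<Omega> (Qk k n 0) (Q n 0) \<and> eq_ae \<Omega> (Uk k n 0) (U n 0))" for n
  define conclusion where "conclusion n \<longleftrightarrow>
      (\<forall>i\<in>{1..r}. (\<forall>k. (\<lambda>x. \<Sum>j=0..r. \<alpha> n i j * (Pk k n j x - P n j x)) \<in> Wh) \<and>
         converges_geometrically (l2_norm \<Omega>) (\<lambda>k x. \<Sum>j=0..r. \<alpha> n i j * (Pk k n j x - P n j x)) (\<lambda>x. 0)) \<and>
      (\<lambda>k. l2_norm \<Omega> (\<lambda>x. pk k (tt n) x - p (tt n) x)) \<longlonglongrightarrow> 0 \<and>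
      (\<lambda>k. hdiv_norm \<Omega> (\<lambda>x. qk k (tt n) x - q (tt n) x)) \<longlonglongrightarrow> 0 \<and>
      (\<lambda>k. h1_norm \<Omega> (\<lambda>x. uk k (tt n) x - u (tt n) x)) \<longlonglongrightarrow> 0" for n
  have interval: "conclusion n" if n: "n \<in> {1..N}" and st: "start n" for n
  proof -
    obtain d where d: "\<And>m j. m \<in> {1..r} \<Longrightarrow> j \<in> {1..r} \<Longrightarrow> (\<Sum>i=1..r. d m i * \<alpha> n i j) = (if m = j then 1 else (0::real))"
      using \<alpha>c_left_inverse[OF grid n] unfolding \<alpha>_def by blast
    have sol_eqs: "(\<forall>w\<in>Wh. 1 / M * (\<Sum>j=0..r. \<alpha> n i j * l2_inner \<Omega> (P n j) w)
           + \<tau>\<beta> r tg gw n i * l2_inner \<Omega> (wdiv \<Omega> (Q n i)) w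
           = \<tau>\<beta> r tg gw n i * l2_inner \<Omega> (f (tg n i)) w
             - b * (\<Sum>j=0..r. \<alpha> n i j * l2_inner \<Omega> (wdiv \<Omega> (U n j)) w)) \<and>
        flux_eq \<Omega> Kp Vh (P n i) (Q n i) \<and> mechanics_eq \<Omega> b \<mu> lam Hh (P n i) (U n i)"
      if "i \<in> {1..r}" for i
      unfolding \<alpha>_def using C n that by blast
    have iter_eqs: "(\<forall>w\<in>Wh. 1 / M * (\<Sum>j=0..r. \<alpha> n i j * l2_inner \<Omega> (Pk (Suc k) n j) w)
           + L * (\<Sum>j=0..r. \<alpha> n i j * l2_inner \<Omega> (\<lambda>x. Pk (Suc k) n j x - Pk k n j x) w)
           + \<tau>\<beta> r tg gw n i * l2_inner \<Omega> (wdiv \<Omega> (Qk (Suc k) n i)) w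
           = \<tau>\<beta> r tg gw n i * l2_inner \<Omega> (f (tg n i)) w
             - b * (\<Sum>j=0..r. \<alpha> n i j * l2_inner \<Omega> (wdiv \<Omega> (Uk k n j)) w)) \<and>
        flux_eq \<Omega> Kp Vh (Pk (Suc k) n i) (Qk (Suc k) n i) \<and>
        mechanics_eq \<Omega> b \<mu> lam Hh (Pk (Suc k) n i) (Uk (Suc k) n i)"
      if "i \<in> {1..r}" for k i
      unfolding \<alpha>_def using F n that by blast
    have asym: "\<alpha> n i j + \<alpha> n j i = l n i * l n j" if "i \<in> {1..r}" "j \<in> {1..r}" for i j
      unfolding \<alpha>_def l_def by (rule \<alpha>c_symmetric_part[OF grid n that])
    have st': "eq_ae \<Omega> (Pk k n 0) (P n 0) \<and> eq_ae \<Omega> (Qk k n 0) (Q n 0) \<and> eq_ae \<Omega> (Uk k n 0) (U n 0)" for k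
      using st by (simp add: start_def)
    note conv = interval_convergence[where \<alpha> = "\<alpha> n" and l = "l n" and d = d and wt = "\<tau>\<beta> r tg gw n"
        and f = "\<lambda>i. f (tg n i)" and P = "P n" and Q = "Q n" and U = "U n"
        and Pk = "\<lambda>k. Pk k n" and Qk = "\<lambda>k. Qk k n" and Uk = "\<lambda>k. Uk k n" and r = r,
        OF \<tau>\<beta>_pos[OF grid n] asym d solW[OF n] iterW[OF n] st' sol_eqs[THEN conjunct1, THEN bspec]
          sol_eqs[THEN conjunct2, THEN conjunct1] sol_eqs[THEN conjunct2, THEN conjunct2]
          iter_eqs[THEN conjunct1, THEN bspec]
          iter_eqs[THEN conjunct2, THEN conjunct1] iter_eqs[THEN conjunct2, THEN conjunct2]]
    have "(\<lambda>k. l2_norm \<Omega> (\<lambda>x. pk k (tt n) x - p (tt n) x)) \<longlonglongrightarrow> 0"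
    proof -
      have "l2_norm \<Omega> (\<lambda>x. pk k (tt n) x - p (tt n) x)
          = l2_norm \<Omega> (\<lambda>x. \<Sum>j=0..r. l n j *\<^sub>R (Pk k n j x - P n j x))" for k
        by (rule l2_norm_cong[OF sets_\<Omega> expansion_diff]) (use iter_end[OF n] sol_end[OF n] in blast)+
      then show ?thesis using conv(3) by simp
    qed
    moreover have "(\<lambda>k. hdiv_norm \<Omega> (\<lambda>x. qk k (tt n) x - q (tt n) x)) \<longlonglongrightarrow> 0"
    proof -
      have "hdiv_norm \<Omega> (\<lambda>x. qk k (tt n) x - q (tt n) x)
          = hdiv_norm \<Omega> (\<lambda>x. \<Sum>j=0..r. l n j *\<^sub>R (Qk k n j x - Q n j x))" for k
        by (rule hdiv_norm_cong[OF expansion_diff]) (use iter_end[OF n] sol_end[OF n] in blast)+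
      then show ?thesis using conv(4) by simp
    qed
    moreover have "(\<lambda>k. h1_norm \<Omega> (\<lambda>x. uk k (tt n) x - u (tt n) x)) \<longlonglongrightarrow> 0"
    proof -
      have "h1_norm \<Omega> (\<lambda>x. uk k (tt n) x - u (tt n) x)
          = h1_norm \<Omega> (\<lambda>x. \<Sum>j=0..r. l n j *\<^sub>R (Uk k n j x - U n j x))" for k
        by (rule h1_norm_cong[OF expansion_diff]) (use iter_end[OF n] sol_end[OF n] in blast)+
      then show ?thesis using conv(5) by simp
    qed
    ultimately show ?thesis unfolding conclusion_def using conv(1,2) by blast
  qed
  have first: "start 1"
    unfolding start_def
  proof
    fix k
    have N: "1 \<in> {1..N}" and t0: "tt (1 - 1) = 0" using grid by (auto simp: time_grid_def)
    have s: "eq_ae \<Omega> (p 0) (P 1 0)" "eq_ae \<Omega> (q 0) (Q 1 0)" "eq_ae \<Omega> (u 0) (U 1 0)"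
      using sol_start[OF N] unfolding t0 by auto
    have c: "eq_ae \<Omega> (p 0) (\<lambda>x. 0)" "eq_ae \<Omega> (q 0) q0" "eq_ae \<Omega> (u 0) (\<lambda>x. 0)" using C by blast+
    have i: "eq_ae \<Omega> (Pk k 1 0) (\<lambda>x. 0)" "eq_ae \<Omega> (Qk k 1 0) q0" "eq_ae \<Omega> (Uk k 1 0) (\<lambda>x. 0)" using F by blast+
    show "eq_ae \<Omega> (Pk k 1 0) (P 1 0) \<and> eq_ae \<Omega> (Qk k 1 0) (Q 1 0) \<and> eq_ae \<Omega> (Uk k 1 0) (U 1 0)"
      using s c i by (meson eq_ae_sym eq_ae_trans)
  qed
  have next_start: "start (Suc n)" if n: "n \<in> {1..N}" "Suc n \<in> {1..N}" and cn: "conclusion n" for n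
  proof -
    have N2: "Suc n \<in> {2..N}" and pred: "Suc n - 1 = n" using n by auto
    have zero: "0 \<in> {0..r}" by simp
    have s: "eq_ae \<Omega> (p (tt n)) (P (Suc n) 0)" "eq_ae \<Omega> (q (tt n)) (Q (Suc n) 0)" "eq_ae \<Omega> (u (tt n)) (U (Suc n) 0)"
      using sol_start[OF n(2)] unfolding pred by auto
    have lim: "(\<lambda>k. l2_norm \<Omega> (\<lambda>x. pk k (tt n) x - p (tt n) x)) \<longlonglongrightarrow> 0"
      "(\<lambda>k. hdiv_norm \<Omega> (\<lambda>x. qk k (tt n) x - q (tt n) x)) \<longlonglongrightarrow> 0"
      "(\<lambda>k. h1_norm \<Omega> (\<lambda>x. uk k (tt n) x - u (tt n) x)) \<longlonglongrightarrow> 0"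
      using cn by (auto simp: conclusion_def)
    \<comment> \<open>\<open>p (tt n)\<close> is known to agree with a member of \<open>Wh\<close>
      only almost everywhere, so the limit clause of the scheme is applied to the coefficient
      \<open>P (Suc n) 0\<close>; likewise for the flux and the displacement.\<close>
    have lim': "(\<lambda>k. l2_norm \<Omega> (\<lambda>x. pk k (tt (Suc n - 1)) x - P (Suc n) 0 x)) \<longlonglongrightarrow> 0"
      "(\<lambda>k. hdiv_norm \<Omega> (\<lambda>x. qk k (tt (Suc n - 1)) x - Q (Suc n) 0 x)) \<longlonglongrightarrow> 0"
      "(\<lambda>k. h1_norm \<Omega> (\<lambda>x. uk k (tt (Suc n - 1)) x - U (Suc n) 0 x)) \<longlonglongrightarrow> 0"
      unfolding pred
      using lim l2_norm_cong[OF sets_\<Omega> eq_ae_diff[OF eq_ae_refl s(1)]]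
        hdiv_norm_cong[OF eq_ae_diff[OF eq_ae_refl s(2)]] h1_norm_cong[OF eq_ae_diff[OF eq_ae_refl s(3)]]
      by simp_all
    have mem: "P (Suc n) 0 \<in> Wh" "Q (Suc n) 0 \<in> Vh" "U (Suc n) 0 \<in> Hh" using solW[OF n(2) zero] by auto
    show ?thesis unfolding start_def
    proof
      fix k
      have "(\<forall>y\<in>Wh. (\<lambda>l. l2_norm \<Omega> (\<lambda>x. pk l (tt (Suc n - 1)) x - y x)) \<longlonglongrightarrow> 0 \<longrightarrow> eq_ae \<Omega> (Pk k (Suc n) 0) y) \<and>
        (\<forall>y\<in>Vh. (\<lambda>l. hdiv_norm \<Omega> (\<lambda>x. qk l (tt (Suc n - 1)) x - y x)) \<longlonglongrightarrow> 0 \<longrightarrow> eq_ae \<Omega> (Qk k (Suc n) 0) y) \<and>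
        (\<forall>y\<in>Hh. (\<lambda>l. h1_norm \<Omega> (\<lambda>x. uk l (tt (Suc n - 1)) x - y x)) \<longlonglongrightarrow> 0 \<longrightarrow> eq_ae \<Omega> (Uk k (Suc n) 0) y)"
        using F N2 by blast
      then show "eq_ae \<Omega> (Pk k (Suc n) 0) (P (Suc n) 0) \<and> eq_ae \<Omega> (Qk k (Suc n) 0) (Q (Suc n) 0) \<and> eq_ae \<Omega> (Uk k (Suc n) 0) (U (Suc n) 0)"
        using lim' mem by blast
    qed
  qed
  \<comment> \<open>The claim is void at 0, so the first interval is handled inside the induction
    step.\<close>
  have "n \<in> {1..N} \<longrightarrow> start n" for n
  proof (induction n)
    case (Suc n)
    show ?case
    proof
      assume Sn: "Suc n \<in> {1..N}"
      show "start (Suc n)"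
      proof (cases "n = 0")
        case True
        then show ?thesis using first by simp
      next
        case False
        then have n: "n \<in> {1..N}" using Sn by simp
        then show ?thesis using Suc interval[OF n] next_start[OF n Sn] by blast
      qed
    qed
  qed simp
  then have "conclusion n" if "n \<in> {1..N}" for n using interval that by blast
  then show ?thesis unfolding conclusion_def \<alpha>_def by blast
qed

end
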